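(* For each $n\ge 1$ let $\beta=\beta_n>0$ and $p_1=p_1(n)\ge n$, $p_2=p_2(n)\ge n$, and let $\boldsymbol{\lambda}=(\lambda_1,\dots,\lambda_n)$ be the $\beta$-Jacobi ensemble on $[0,1]^n$, i.e. a random vector with joint density $$f_{\beta,p_1,p_2}(x_1,\dots,x_n)=c_{\beta,p_1,p_2}\prod_{1\le i<j\le n}|x_i-x_j|^{\beta}\prod_{i=1}^n x_i^{\frac{\beta}{2}(p_1-n+1)-1}(1-x_i)^{\frac{\beta}{2}(p_2-n+1)-1},$$ all these random vectors being defined on a common probability space. Set $$Y_i=\frac{(p_1+p_2)\lambda_i-p_1}{\sqrt{np_1}},\quad 1\le i\le n,\qquad L_n=\frac1n\sum_{i=1}^n\delta_{Y_i}.$$ Suppose that $$\lim_{n\to\infty}\frac{n}{p_1}=\gamma\in[0,1],\qquad \lim_{n\to\infty}\frac{p_1}{p_2}=\sigma\in[0,\gamma^{-1}),\qquad \lim_{n\to\infty}\beta n=+\infty$$ (with $\gamma^{-1}=+\infty$ when $\gamma=0$). Then, almost surely, $L_n$ converges weakly to the probability measure $\tilde\nu_{\gamma,\sigma}$ with density $\tilde h_{\gamma,\sigma}$.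
   Context: $c_{\beta,p_1,p_2}$ is the normalizing constant. The parameters $\beta,p_1,p_2$ may depend on $n$. The density $\tilde h_{\gamma,\sigma}$ is $$\tilde h_{\gamma,\sigma}(x)=\begin{cases}\frac{\sigma\sqrt\gamma}{1+\sigma}\,h_{\gamma,\sigma}\!\left(\frac{\sigma}{1+\sigma}(\sqrt\gamma x+1)\right), & 0<\sigma\gamma\le1,\\ \sqrt\gamma\,h_\gamma(1+\sqrt\gamma x), & \sigma=0,\ 0<\gamma\le1,\\ \frac{1+\sigma}{2\pi}\sqrt{\frac{4}{1+\sigma}-x^2}\ \text{ for } x^2\le \frac{4}{1+\sigma}\ (0\text{ otherwise}), & \gamma=0,\ \sigma\ge0,\end{cases}$$ where $h_\gamma$ is the Marchenko-Pastur density $$h_\gamma(x)=\frac{1}{2\pi\gamma x}\sqrt{(x-\gamma_1)(\gamma_2-x)}\,\mathbf 1_{[\gamma_1,\gamma_2]}(x),\quad \gamma_1=(\sqrt\gamma-1)^2,\ \gamma_2=(\sqrt\gamma+1)^2,$$ and $h_{\gamma,\sigma}$ is the Wachter density $$h_{\gamma,\sigma}(x)=\frac{1+\sigma}{2\pi\sigma\gamma}\frac{\sqrt{(x-u_1)(u_2-x)}}{x(1-x)}\mathbf 1_{[u_1,u_2]}(x),$$ $$u_1=\frac{\sigma}{1+\sigma}\left(\sqrt{1-\frac{\sigma\gamma}{1+\sigma}}-\sqrt{\frac{\gamma}{1+\sigma}}\right)^2,\quad u_2=\frac{\sigma}{1+\sigma}\left(\sqrt{1-\frac{\sigma\gamma}{1+\sigma}}+\sqrt{\frac{\gamma}{1+\sigma}}\right)^2.$$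 *)

theory Defs
  imports "HOL-Probability.Probability"
begin

text \<open>
  A point of \<open>\<real>\<^sup>n\<close> is an element of the space of \<open>Pi\<^sub>M {..<n} (\<lambda>_. lborel)\<close>, because the
  dimension varies along the sequence; coordinates are numbered from 0 to \<open>n - 1\<close>.
\<close>

definition jacobi_weight :: "nat \<Rightarrow> real \<Rightarrow> real \<Rightarrow> real \<Rightarrow> (nat \<Rightarrow> real) \<Rightarrow> real" where
  "jacobi_weight n \<beta> p1 p2 x =
     (\<Prod>j<n. \<Prod>i<j. \<bar>x i - x j\<bar> powr \<beta>) *
     (\<Prod>i<n. x i powr (\<beta> / 2 * (p1 - real n + 1) - 1) *
             (1 - x i) powr (\<beta> / 2 * (p2 - real n + 1) - 1)) *
     indicator ({..<n} \<rightarrow>\<^sub>E {0..1}) x"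

definition jacobi_const :: "nat \<Rightarrow> real \<Rightarrow> real \<Rightarrow> real \<Rightarrow> real" where
  "jacobi_const n \<beta> p1 p2 =
     1 / (\<integral>x. jacobi_weight n \<beta> p1 p2 x \<partial>(Pi\<^sub>M {..<n} (\<lambda>_. lborel)))"

definition jacobi_density :: "nat \<Rightarrow> real \<Rightarrow> real \<Rightarrow> real \<Rightarrow> (nat \<Rightarrow> real) \<Rightarrow> real" where
  "jacobi_density n \<beta> p1 p2 x = jacobi_const n \<beta> p1 p2 * jacobi_weight n \<beta> p1 p2 x"

text \<open>\<open>\<Lambda> \<omega> i\<close> is the \<open>i\<close>-th coordinate of the random vector at \<open>\<omega>\<close>; its values for \<open>i \<ge> n\<close> are
  irrelevant.\<close>

definition beta_jacobi_ensemble ::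
    "'a measure \<Rightarrow> nat \<Rightarrow> real \<Rightarrow> real \<Rightarrow> real \<Rightarrow> ('a \<Rightarrow> nat \<Rightarrow> real) \<Rightarrow> bool" where
  "beta_jacobi_ensemble M n \<beta> p1 p2 \<Lambda> \<longleftrightarrow>
     distributed M (Pi\<^sub>M {..<n} (\<lambda>_. lborel)) (\<lambda>\<omega>. restrict (\<Lambda> \<omega>) {..<n})
       (\<lambda>x. ennreal (jacobi_density n \<beta> p1 p2 x))"

definition empirical_measure :: "nat \<Rightarrow> (nat \<Rightarrow> real) \<Rightarrow> real measure" where
  "empirical_measure n y = distr (uniform_count_measure {..<n}) borel y"

definition marchenko_pastur_density :: "real \<Rightarrow> real \<Rightarrow> real" where
  "marchenko_pastur_density \<gamma> x =
     (let \<gamma>1 = (sqrt \<gamma> - 1)\<^sup>2; \<gamma>2 = (sqrt \<gamma> + 1)\<^sup>2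
      in 1 / (2 * pi * \<gamma> * x) * sqrt ((x - \<gamma>1) * (\<gamma>2 - x)) * indicator {\<gamma>1..\<gamma>2} x)"

definition wachter_density :: "real \<Rightarrow> real \<Rightarrow> real \<Rightarrow> real" where
  "wachter_density \<gamma> \<sigma> x =
     (let u1 = \<sigma> / (1 + \<sigma>) * (sqrt (1 - \<sigma> * \<gamma> / (1 + \<sigma>)) - sqrt (\<gamma> / (1 + \<sigma>)))\<^sup>2;
          u2 = \<sigma> / (1 + \<sigma>) * (sqrt (1 - \<sigma> * \<gamma> / (1 + \<sigma>)) + sqrt (\<gamma> / (1 + \<sigma>)))\<^sup>2
      in (1 + \<sigma>) / (2 * pi * \<sigma> * \<gamma>) * (sqrt ((x - u1) * (u2 - x)) / (x * (1 - x))) *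
         indicator {u1..u2} x)"

text \<open>For \<open>0 \<le> \<gamma> \<le> 1\<close>, \<open>\<sigma> \<ge> 0\<close>, \<open>\<sigma> * \<gamma> \<le> 1\<close> the first three cases are exhaustive; the
  value 0 in the last one is only there to make the function total.\<close>

definition limit_density :: "real \<Rightarrow> real \<Rightarrow> real \<Rightarrow> real" where
  "limit_density \<gamma> \<sigma> x =
     (if 0 < \<sigma> * \<gamma> \<and> \<sigma> * \<gamma> \<le> 1 then
        \<sigma> * sqrt \<gamma> / (1 + \<sigma>) * wachter_density \<gamma> \<sigma> (\<sigma> / (1 + \<sigma>) * (sqrt \<gamma> * x + 1))
      else if \<sigma> = 0 \<and> 0 < \<gamma> \<and> \<gamma> \<le> 1 then
        sqrt \<gamma> * marchenko_pastur_density \<gamma> (1 + sqrt \<gamma> * x)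
      else if \<gamma> = 0 \<and> 0 \<le> \<sigma> then
        (if x\<^sup>2 \<le> 4 / (1 + \<sigma>) then (1 + \<sigma>) / (2 * pi) * sqrt (4 / (1 + \<sigma>) - x\<^sup>2) else 0)
      else 0)"

definition limit_measure :: "real \<Rightarrow> real \<Rightarrow> real measure" where
  "limit_measure \<gamma> \<sigma> = density lborel (\<lambda>x. ennreal (limit_density \<gamma> \<sigma> x))"

end

theory Submission
  imports Defs
begin

text \<open>
  Why the theorem is true. Write \<open>x\<^sub>i\<close> for the points, and move all of them at once by
  \<open>x\<^sub>i \<mapsto> T x\<^sub>i\<close>, where \<open>T\<close> is an increasing \<open>C\<^sup>1\<close> bijection of \<open>[0, 1]\<close>. The substitution does not
  change the total mass of the weight, hence the ratio of the moved weight (Jacobian included) to the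
  original weight has expectation 1. With \<open>T\<close> at distance \<open>\<delta>\<close> from the identity in the scale of the
  \<open>Y\<^sub>i\<close>, the logarithm of this ratio is at least
  \<open>\<beta> n\<^sup>2 (\<delta> L - C \<delta>\<^sup>2) - O(n)\<close>, where \<open>L\<close> is the linear statistic whose vanishing is the loop
  (Schwinger-Dyson) equation of the ensemble. Markov's inequality gives
  \<open>P (L \<ge> \<epsilon>) \<le> exp (O(n) - c \<beta> n\<^sup>2)\<close>, and since \<open>\<beta> n\<close> tends to infinity this is summable whatever
  the rate: by Borel-Cantelli the loop equations hold almost surely in the limit
  (\<open>beta_jacobi_loop_tail\<close>, \<open>beta_jacobi_loop_AE_tendsto_0\<close>). Negative exponents of the weight at
  the edges do no harm, because \<open>T\<close> fixes 0 and 1 and moves points by a bounded factor there.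

  Let \<open>T x - x\<close> be proportional to the real part of \<open>\<theta> x (1 - x) / (\<zeta> - x)\<close>, \<open>\<zeta>\<close> nonreal,
  with \<open>\<theta>\<close> running through the powers of \<open>\<i>\<close>. The factor
  \<open>x (1 - x)\<close> cancels the poles of the potential, and the loop equation closes: up to \<open>O(1/n)\<close> it is
  a quadratic equation for the mean resolvent \<open>G\<^sub>n(z) = (1/n) \<Sum> 1 / (z - Y\<^sub>i)\<close>, whose limit is
  \<open>q(z) G\<^sup>2 - ((1 + \<sigma> - 2 \<sigma> \<gamma>) z + \<surd>\<gamma> (1 - \<sigma>)) G + (1 + \<sigma> - \<sigma> \<gamma>) = 0\<close> with
  \<open>q(z) = (1 + \<surd>\<gamma> z) (1 - \<sigma> \<surd>\<gamma> z)\<close>, in all three regimes of the limit law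
  (\<open>loop_sum_eq_quadratic\<close>).

  The three densities are one formula, \<open>(1 + \<sigma>) \<surd>(r\<^sup>2 - (x - m)\<^sup>2) / (2 \<pi> q(x))\<close>
  (\<open>limit_density_eq\<close>). After \<open>x = m + r cos t\<close> both factors of \<open>q\<close> become Chebyshev kernels
  \<open>1 - 2 w cos t + w\<^sup>2\<close>, so total mass and Stieltjes transform come from
  \<open>\<integral> sin\<^sup>2 t / (1 - 2 w cos t + w\<^sup>2) dt = \<pi> / 2\<close> by partial fractions, the latter as an explicit
  rational function of the Joukowski variable \<open>w\<close>, \<open>z = m + (r / 2) (w + 1 / w)\<close>. The two roots of
  the quadratic are the values of this function at \<open>w\<close> and \<open>1 / w\<close>
  (\<open>loop_equation_factorization\<close>). The second one is excluded because
  \<open>Y\<^sub>i \<le> 1 / (\<rho>\<^sub>n s\<^sub>n)\<close>, with \<open>\<rho>\<^sub>n = p\<^sub>1 / p\<^sub>2\<close> and \<open>s\<^sub>n = \<surd>(n / p\<^sub>1)\<close>, forces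
  \<open>Im ((1 - \<rho>\<^sub>n s\<^sub>n z) G\<^sub>n(z)) \<le> 0\<close>, a sign that the second root violates
  (\<open>resolvent_mean_right_edge\<close>, \<open>Im_other_branch_pos\<close>). Hence \<open>G\<^sub>n\<close> converges to the
  Stieltjes transform of the limit law.

  Finally, \<open>- Im G\<^sub>n(t + i y) / \<pi>\<close> is the density of the empirical measure smoothed by a Cauchy
  law of scale \<open>y\<close>. Pointwise convergence of these densities is convergence in \<open>L\<^sup>1\<close> by Scheffe's
  lemma, and letting \<open>y\<close> tend to 0 yields weak convergence
  (\<open>weak_conv_m_if_poisson_integrals_converge\<close>).
\<close>

section \<open>A change of variables on the unit cube\<close>

lemma nn_integral_unit_interval_substitution:
  fixes T T' :: "real \<Rightarrow> real" and f :: "real \<Rightarrow> ennreal"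
  assumes [measurable]: "f \<in> borel_measurable borel"
    and deriv: "\<And>t. (T has_real_derivative T' t) (at t)"
    and T': "continuous_on UNIV T'"
    and nonneg: "\<And>t. t \<in> {0..1} \<Longrightarrow> 0 \<le> T' t"
    and ends: "T 0 = 0" "T 1 = 1"
  shows "(\<integral>\<^sup>+t. f (T t) * (ennreal (T' t) * indicator {0..1} t) \<partial>lborel)
       = (\<integral>\<^sup>+t. f t * indicator {0..1} t \<partial>lborel)"
proof -
  have "(\<integral>\<^sup>+t. f t * indicator {T 0..T 1} t \<partial>lborel)
      = (\<integral>\<^sup>+t. f (T t) * T' t * indicator {0..1} t \<partial>lborel)"
    by (rule nn_integral_substitution_aux)
      (use assms in \<open>auto intro: continuous_on_subset\<close>)
  then show ?thesis
    by (simp add: ends mult.assoc)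
qed

lemma nn_integral_PiM_unit_cube_substitution:
  fixes T T' :: "real \<Rightarrow> real" and F :: "('i \<Rightarrow> real) \<Rightarrow> ennreal"
  assumes "finite I"
    and deriv: "\<And>t. (T has_real_derivative T' t) (at t)"
    and T': "continuous_on UNIV T'"
    and nonneg: "\<And>t. t \<in> {0..1} \<Longrightarrow> 0 \<le> T' t"
    and ends: "T 0 = 0" "T 1 = 1"
    and F: "F \<in> borel_measurable (Pi\<^sub>M I (\<lambda>_. lborel))"
  shows "(\<integral>\<^sup>+x. F (\<lambda>i\<in>I. T (x i)) * (\<Prod>i\<in>I. ennreal (T' (x i)) * indicator {0..1} (x i))
            \<partial>(Pi\<^sub>M I (\<lambda>_. lborel)))
       = (\<integral>\<^sup>+x. F x * (\<Prod>i\<in>I. indicator {0..1} (x i)) \<partial>(Pi\<^sub>M I (\<lambda>_. lborel)))"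
  using \<open>finite I\<close> F
proof (induction I arbitrary: F rule: finite_induct)
  case empty
  have eq: "(\<lambda>i\<in>{}. T (x i)) = x" if "x \<in> space (Pi\<^sub>M {} (\<lambda>_. lborel))" for x :: "'i \<Rightarrow> real"
    using that by (auto simp: space_PiM)
  show ?case
    by (intro nn_integral_cong) (simp add: eq)
next
  case (insert i I)
  interpret product_sigma_finite "\<lambda>_::'i. lborel :: real measure"
    by standard
  note [measurable] = insert.prems
  have T_meas [measurable]: "T \<in> borel_measurable borel"
    by (intro borel_measurable_continuous_onI continuous_at_imp_continuous_on)
      (use deriv DERIV_isCont in blast)
  have T'_meas [measurable]: "T' \<in> borel_measurable borel"
    using T' by (intro borel_measurable_continuous_onI)
  have restr: "(\<lambda>j\<in>insert i I. T ((x(i := t)) j)) = (\<lambda>j\<in>I. T (x j))(i := T t)" for x t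
    by (auto simp: fun_eq_iff)
  have prod_I: "(\<Prod>j\<in>insert i I. g ((x(i := t)) j)) = g t * (\<Prod>j\<in>I. g (x j))"
    for g :: "real \<Rightarrow> ennreal" and x t
  proof -
    have "(\<Prod>j\<in>I. g ((x(i := t)) j)) = (\<Prod>j\<in>I. g (x j))"
      using insert.hyps by (intro prod.cong) auto
    then show ?thesis
      using insert.hyps by simp
  qed
  note prod_T' = prod_I[of "\<lambda>v. ennreal (T' v) * indicator {0..1} v"]
    and prod_ind = prod_I[of "indicator {0..1}"]
  have IH: "(\<integral>\<^sup>+x. F ((\<lambda>j\<in>I. T (x j))(i := s)) *
          (\<Prod>j\<in>I. ennreal (T' (x j)) * indicator {0..1} (x j)) \<partial>(Pi\<^sub>M I (\<lambda>_. lborel)))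
      = (\<integral>\<^sup>+x. F (x(i := s)) * (\<Prod>j\<in>I. indicator {0..1} (x j)) \<partial>(Pi\<^sub>M I (\<lambda>_. lborel)))"
    (is "_ = ?\<Phi> s") for s
  proof (rule insert.IH)
    show "(\<lambda>x. F (x(i := s))) \<in> borel_measurable (Pi\<^sub>M I (\<lambda>_. lborel))"
      by measurable
  qed
  interpret I: sigma_finite_measure "Pi\<^sub>M I (\<lambda>_. lborel :: real measure)"
    by (rule sigma_finite) fact
  have \<Phi>_meas: "?\<Phi> \<in> borel_measurable borel"
  proof (rule I.borel_measurable_nn_integral)
    have "(\<lambda>w. (snd w)(i := fst w)) \<in>
        measurable (borel \<Otimes>\<^sub>M Pi\<^sub>M I (\<lambda>_. lborel)) (Pi\<^sub>M (insert i I) (\<lambda>_. lborel))"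
      by (rule measurable_fun_upd[where J = I]) auto
    then show "(\<lambda>(s, x). F (x(i := s)) * (\<Prod>j\<in>I. indicator {0..1} (x j)))
        \<in> borel_measurable (borel \<Otimes>\<^sub>M Pi\<^sub>M I (\<lambda>_. lborel))"
      unfolding case_prod_beta
      by (intro borel_measurable_times_ennreal measurable_compose[OF _ insert.prems]
          borel_measurable_prod_ennreal) measurable
  qed
  have "(\<integral>\<^sup>+x. F (\<lambda>j\<in>insert i I. T (x j)) *
          (\<Prod>j\<in>insert i I. ennreal (T' (x j)) * indicator {0..1} (x j))
          \<partial>(Pi\<^sub>M (insert i I) (\<lambda>_. lborel)))
      = (\<integral>\<^sup>+t. \<integral>\<^sup>+x. F ((\<lambda>j\<in>I. T (x j))(i := T t)) * (ennreal (T' t) * indicator {0..1} t *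
          (\<Prod>j\<in>I. ennreal (T' (x j)) * indicator {0..1} (x j))) \<partial>(Pi\<^sub>M I (\<lambda>_. lborel)) \<partial>lborel)"
    using insert.hyps
    by (subst product_nn_integral_insert_rev) (simp_all only: restr prod_T' finite.insertI, measurable)
  also have "\<dots> = (\<integral>\<^sup>+t. (\<integral>\<^sup>+x. F ((\<lambda>j\<in>I. T (x j))(i := T t)) *
          (\<Prod>j\<in>I. ennreal (T' (x j)) * indicator {0..1} (x j)) \<partial>(Pi\<^sub>M I (\<lambda>_. lborel))) *
          (ennreal (T' t) * indicator {0..1} t) \<partial>lborel)"
    by (intro nn_integral_cong, subst nn_integral_multc[symmetric])
      (auto simp: mult_ac intro!: nn_integral_cong)
  also have "\<dots> = (\<integral>\<^sup>+t. ?\<Phi> (T t) * (ennreal (T' t) * indicator {0..1} t) \<partial>lborel)"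
    by (simp only: IH)
  also have "\<dots> = (\<integral>\<^sup>+t. ?\<Phi> t * indicator {0..1} t \<partial>lborel)"
    by (rule nn_integral_unit_interval_substitution[OF \<Phi>_meas]) (use assms in auto)
  also have "\<dots> = (\<integral>\<^sup>+t. \<integral>\<^sup>+x. F (x(i := t)) *
          (indicator {0..1} t * (\<Prod>j\<in>I. indicator {0..1} (x j))) \<partial>(Pi\<^sub>M I (\<lambda>_. lborel)) \<partial>lborel)"
    by (intro nn_integral_cong, subst nn_integral_multc[symmetric])
      (auto simp: mult_ac intro!: nn_integral_cong)
  also have "\<dots> = (\<integral>\<^sup>+x. F x * (\<Prod>j\<in>insert i I. indicator {0..1} (x j))
          \<partial>(Pi\<^sub>M (insert i I) (\<lambda>_. lborel)))"
    using insert.hyps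
    by (subst product_nn_integral_insert_rev) (simp_all only: prod_ind, measurable)
  finally show ?case .
qed

section \<open>The gain of the Jacobi weight along a flow of the unit interval\<close>

text \<open>
  The factor \<open>t (1 - t)\<close> keeps the two ends of the interval in place and cancels the poles of the
  external field at 0 and 1; the denominator makes the loop equation an equation for the resolvent.
\<close>
definition cauchy_flow :: "complex \<Rightarrow> complex \<Rightarrow> real \<Rightarrow> real" where
  "cauchy_flow \<zeta> e t = t + Re (e * (of_real (t * (1 - t)) / (\<zeta> - of_real t)))"

text \<open>
  The displacement \<open>t (1 - t) / (\<zeta> - t)\<close> equals \<open>\<zeta> (1 - \<zeta>) / (\<zeta> - t) - (1 - \<zeta>) + t\<close>;
  this is its difference quotient, which stays bounded and makes sense on the diagonal.
\<close>
definition flow_quotient :: "complex \<Rightarrow> real \<Rightarrow> real \<Rightarrow> complex" where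
  "flow_quotient \<zeta> s t = \<zeta> * (1 - \<zeta>) / ((\<zeta> - of_real s) * (\<zeta> - of_real t)) + 1"

lemma nonreal_minus_real_nonzero: "Im \<zeta> \<noteq> 0 \<Longrightarrow> \<zeta> - of_real t \<noteq> 0"
  by (auto simp: complex_eq_iff)

lemma cauchy_flow_factor_0:
  "cauchy_flow \<zeta> e t = t * (1 + Re (e * (of_real (1 - t) / (\<zeta> - of_real t))))"
proof -
  have "e * (of_real (t * (1 - t)) / (\<zeta> - of_real t))
      = of_real t * (e * (of_real (1 - t) / (\<zeta> - of_real t)))"
    by simp
  then show ?thesis
    unfolding cauchy_flow_def by (simp only: Re_complex_of_real times_complex.sel Im_complex_of_real) (simp add: algebra_simps)
qed

lemma cauchy_flow_factor_1:
  "1 - cauchy_flow \<zeta> e t = (1 - t) * (1 - Re (e * (of_real t / (\<zeta> - of_real t))))"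
proof -
  have "e * (of_real (t * (1 - t)) / (\<zeta> - of_real t))
      = of_real (1 - t) * (e * (of_real t / (\<zeta> - of_real t)))"
    by (simp add: mult_ac)
  then show ?thesis
    unfolding cauchy_flow_def by (simp only: Re_complex_of_real times_complex.sel Im_complex_of_real) (simp add: algebra_simps)
qed

lemma cauchy_flow_diff:
  assumes "Im \<zeta> \<noteq> 0"
  shows "cauchy_flow \<zeta> e s - cauchy_flow \<zeta> e t = (s - t) * (1 + Re (e * flow_quotient \<zeta> s t))"
proof -
  have nz: "\<zeta> - of_real s \<noteq> 0" "\<zeta> - of_real t \<noteq> 0"
    using assms by (auto intro: nonreal_minus_real_nonzero)
  have "of_real (s * (1 - s)) / (\<zeta> - of_real s) - of_real (t * (1 - t)) / (\<zeta> - of_real t)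
      = of_real (s - t) * flow_quotient \<zeta> s t"
    using nz unfolding flow_quotient_def by (simp add: divide_simps) (simp add: algebra_simps)
  then have "e * (of_real (s * (1 - s)) / (\<zeta> - of_real s)) - e * (of_real (t * (1 - t)) / (\<zeta> - of_real t))
      = of_real (s - t) * (e * flow_quotient \<zeta> s t)"
    by (metis mult.left_commute right_diff_distrib)
  then have "Re (e * (of_real (s * (1 - s)) / (\<zeta> - of_real s)))
        - Re (e * (of_real (t * (1 - t)) / (\<zeta> - of_real t)))
      = (s - t) * Re (e * flow_quotient \<zeta> s t)"
    by (metis minus_complex.sel(1) Re_complex_of_real Im_complex_of_real times_complex.sel(1)
        mult_zero_left diff_zero)
  then show ?thesis
    unfolding cauchy_flow_def by (simp add: algebra_simps)
qed

lemma cauchy_flow_has_derivative: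
  assumes "Im \<zeta> \<noteq> 0"
  shows "(cauchy_flow \<zeta> e has_real_derivative 1 + Re (e * flow_quotient \<zeta> t t)) (at t)"
  unfolding CARAT_DERIV
proof (intro exI[of _ "\<lambda>s. 1 + Re (e * flow_quotient \<zeta> s t)"] conjI allI)
  show "isCont (\<lambda>s. 1 + Re (e * flow_quotient \<zeta> s t)) t"
    unfolding flow_quotient_def
    using nonreal_minus_real_nonzero[OF assms] by (intro continuous_intros) auto
qed (simp_all add: cauchy_flow_diff[OF assms] mult.commute)

lemma continuous_on_flow_quotient_diag:
  assumes "Im \<zeta> \<noteq> 0"
  shows "continuous_on A (\<lambda>t. 1 + Re (e * flow_quotient \<zeta> t t))"
  unfolding flow_quotient_def
  using nonreal_minus_real_nonzero[OF assms] by (intro continuous_intros) auto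

lemma cauchy_flow_ends [simp]: "cauchy_flow \<zeta> e 0 = 0" "cauchy_flow \<zeta> e 1 = 1"
  by (simp_all add: cauchy_flow_def)

lemma exp_le_one_plus:
  fixes u :: real
  assumes "\<bar>u\<bar> \<le> 1 / 2"
  shows "exp (u - 2 * u\<^sup>2) \<le> 1 + u"
proof -
  have "u - 2 * u\<^sup>2 \<le> ln (1 + u)"
    using abs_ln_one_plus_x_minus_x_bound[OF assms] by linarith
  then have "exp (u - 2 * u\<^sup>2) \<le> exp (ln (1 + u))" by simp
  then show ?thesis using assms by simp
qed

lemma exp_le_one_plus_powr:
  fixes u :: real
  assumes "\<bar>u\<bar> \<le> 1 / 2" "0 \<le> c"
  shows "exp (c * (u - 2 * u\<^sup>2)) \<le> (1 + u) powr c"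
proof -
  have "exp (c * (u - 2 * u\<^sup>2)) = exp (u - 2 * u\<^sup>2) powr c"
    by (simp add: powr_def)
  also have "\<dots> \<le> (1 + u) powr c"
    using exp_le_one_plus[OF assms(1)] assms(2) by (intro powr_mono2) auto
  finally show ?thesis .
qed

text \<open>
  The exponents of the weight are of the form \<open>c - 1\<close> and may be negative. Splitting off the \<open>- 1\<close>
  costs a constant factor only, because the perturbation is relative to \<open>t\<close> itself; what remains
  is a nonnegative exponent \<open>c\<close>, for the Jacobi weight a multiple of \<open>\<beta>\<close>.
\<close>
lemma powr_perturb_lower_bound:
  fixes t u :: real
  assumes "0 \<le> t" "\<bar>u\<bar> \<le> 1 / 2" "0 \<le> c"
  shows "t powr (c - 1) * (2 / 3 * exp (c * (u - 2 * u\<^sup>2))) \<le> (t * (1 + u)) powr (c - 1)"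
proof -
  have "2 / 3 * exp (c * (u - 2 * u\<^sup>2)) \<le> 1 / (1 + u) * (1 + u) powr c"
    using assms by (intro mult_mono exp_le_one_plus_powr) (auto simp: field_simps)
  also have "\<dots> = (1 + u) powr (c - 1)"
    using assms by (simp add: powr_diff)
  finally have "t powr (c - 1) * (2 / 3 * exp (c * (u - 2 * u\<^sup>2))) \<le> t powr (c - 1) * (1 + u) powr (c - 1)"
    by (rule mult_left_mono) simp
  then show ?thesis
    using assms by (simp add: powr_mult)
qed

text \<open>
  Factor by factor, each point pair contributes \<open>1 + u\<close> and each end of the interval \<open>1 + a\<close> or
  \<open>1 - b\<close>, to powers that are proportional to \<open>\<beta>\<close> up to the \<open>- 1\<close>. The constant \<open>2 / 9 = (2 / 3) (2 / 3) (1 / 2)\<close>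
  per point pays for the two exponents \<open>- 1\<close> and for the Jacobian.
\<close>
lemma jacobi_weight_flow_lower_bound:
  assumes \<zeta>: "Im \<zeta> \<noteq> 0" and "\<beta> > 0" and p: "real n \<le> p1" "real n \<le> p2"
    and x: "x \<in> {..<n} \<rightarrow>\<^sub>E {0..1}"
    and pair: "\<And>s t. s \<in> {0..1} \<Longrightarrow> t \<in> {0..1} \<Longrightarrow> \<bar>Re (e * flow_quotient \<zeta> s t)\<bar> \<le> 1 / 2"
    and left: "\<And>t. t \<in> {0..1} \<Longrightarrow> \<bar>Re (e * (of_real (1 - t) / (\<zeta> - of_real t)))\<bar> \<le> 1 / 2"
    and right: "\<And>t. t \<in> {0..1} \<Longrightarrow> \<bar>Re (e * (of_real t / (\<zeta> - of_real t)))\<bar> \<le> 1 / 2"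
  defines "u \<equiv> \<lambda>i j. Re (e * flow_quotient \<zeta> (x i) (x j))"
    and "a \<equiv> \<lambda>i. Re (e * (of_real (1 - x i) / (\<zeta> - of_real (x i))))"
    and "b \<equiv> \<lambda>i. Re (e * (of_real (x i) / (\<zeta> - of_real (x i))))"
  shows "jacobi_weight n \<beta> p1 p2 x * (2 / 9) ^ n *
      exp (\<beta> * ((\<Sum>j<n. \<Sum>i<j. u i j - 2 * (u i j)\<^sup>2) +
        (\<Sum>i<n. (p1 - real n + 1) / 2 * (a i - 2 * (a i)\<^sup>2) + (p2 - real n + 1) / 2 * (- b i - 2 * (b i)\<^sup>2))))
    \<le> jacobi_weight n \<beta> p1 p2 (\<lambda>i\<in>{..<n}. cauchy_flow \<zeta> e (x i)) *
      (\<Prod>i<n. 1 + Re (e * flow_quotient \<zeta> (x i) (x i)))"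
proof -
  let ?T = "cauchy_flow \<zeta> e"
  define c1 where "c1 = \<beta> / 2 * (p1 - real n + 1)"
  define c2 where "c2 = \<beta> / 2 * (p2 - real n + 1)"
  have c: "c1 \<ge> 0" "c2 \<ge> 0"
    using \<open>\<beta> > 0\<close> p by (auto simp: c1_def c2_def)
  have x01: "x i \<in> {0..1}" if "i < n" for i
    using x that by (auto simp: PiE_iff)
  have T01: "?T (x i) \<in> {0..1}" if "i < n" for i
  proof -
    have "0 \<le> ?T (x i)"
      using x01[OF that] left[OF x01[OF that]] unfolding cauchy_flow_factor_0
      by (intro mult_nonneg_nonneg) auto
    moreover have "0 \<le> 1 - ?T (x i)"
      using x01[OF that] right[OF x01[OF that]] unfolding cauchy_flow_factor_1
      by (intro mult_nonneg_nonneg) auto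
    ultimately show ?thesis by simp
  qed
  have restr: "(\<lambda>i\<in>{..<n}. ?T (x i)) \<in> {..<n} \<rightarrow>\<^sub>E {0..1}"
    using T01 by auto
  define V where "V = (\<Prod>j<n. \<Prod>i<j. \<bar>x i - x j\<bar> powr \<beta>)"
  define S where "S = (\<Prod>i<n. x i powr (c1 - 1) * (1 - x i) powr (c2 - 1))"
  have pairs: "V * exp (\<beta> * (\<Sum>j<n. \<Sum>i<j. u i j - 2 * (u i j)\<^sup>2))
      \<le> (\<Prod>j<n. \<Prod>i<j. \<bar>?T (x i) - ?T (x j)\<bar> powr \<beta>)"
  proof -
    have "V * exp (\<beta> * (\<Sum>j<n. \<Sum>i<j. u i j - 2 * (u i j)\<^sup>2))
        = (\<Prod>j<n. \<Prod>i<j. \<bar>x i - x j\<bar> powr \<beta> * exp (\<beta> * (u i j - 2 * (u i j)\<^sup>2)))"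
      by (simp add: V_def prod.distrib exp_sum sum_distrib_left)
    also have "\<dots> \<le> (\<Prod>j<n. \<Prod>i<j. \<bar>?T (x i) - ?T (x j)\<bar> powr \<beta>)"
    proof (intro prod_mono conjI prod_nonneg ballI)
      fix j i assume ij: "j \<in> {..<n}" "i \<in> {..<j}"
      have u: "\<bar>u i j\<bar> \<le> 1 / 2"
        unfolding u_def using ij x01 by (intro pair) auto
      have Tdiff: "?T (x i) - ?T (x j) = (x i - x j) * (1 + u i j)"
        by (simp only: cauchy_flow_diff[OF \<zeta>] u_def)
      have "\<bar>x i - x j\<bar> powr \<beta> * exp (\<beta> * (u i j - 2 * (u i j)\<^sup>2))
          \<le> \<bar>x i - x j\<bar> powr \<beta> * (1 + u i j) powr \<beta>"
        using exp_le_one_plus_powr[OF u] \<open>\<beta> > 0\<close> by (intro mult_left_mono) auto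
      also have "\<dots> = \<bar>?T (x i) - ?T (x j)\<bar> powr \<beta>"
        using u by (simp only: Tdiff abs_mult powr_mult abs_ge_zero)
      finally show "\<bar>x i - x j\<bar> powr \<beta> * exp (\<beta> * (u i j - 2 * (u i j)\<^sup>2))
          \<le> \<bar>?T (x i) - ?T (x j)\<bar> powr \<beta>" .
    qed auto
    finally show ?thesis .
  qed
  have sites: "S * (2 / 9) ^ n * exp (\<Sum>i<n. c1 * (a i - 2 * (a i)\<^sup>2) + c2 * (- b i - 2 * (b i)\<^sup>2))
      \<le> (\<Prod>i<n. ?T (x i) powr (c1 - 1) * (1 - ?T (x i)) powr (c2 - 1)) *
        (\<Prod>i<n. 1 + u i i)"
  proof -
    have "S * (2 / 9) ^ n * exp (\<Sum>i<n. c1 * (a i - 2 * (a i)\<^sup>2) + c2 * (- b i - 2 * (b i)\<^sup>2))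
        = (\<Prod>i<n. x i powr (c1 - 1) * (1 - x i) powr (c2 - 1) * (2 / 9) *
            exp (c1 * (a i - 2 * (a i)\<^sup>2) + c2 * (- b i - 2 * (b i)\<^sup>2)))"
      unfolding S_def by (simp only: prod.distrib exp_sum finite_lessThan prod_constant card_lessThan)
    also have "\<dots> = (\<Prod>i<n. ((x i powr (c1 - 1) * (2 / 3 * exp (c1 * (a i - 2 * (a i)\<^sup>2)))) *
           ((1 - x i) powr (c2 - 1) * (2 / 3 * exp (c2 * (- b i - 2 * (- b i)\<^sup>2))))) * (1 / 2))"
      by (intro prod.cong refl) (simp add: exp_add)
    also have "\<dots> \<le> (\<Prod>i<n. (?T (x i) powr (c1 - 1) * (1 - ?T (x i)) powr (c2 - 1)) * (1 + u i i))"
    proof (intro prod_mono conjI mult_mono)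
      fix i assume "i \<in> {..<n}"
      then have i: "x i \<in> {0..1}" using x01 by auto
      show "x i powr (c1 - 1) * (2 / 3 * exp (c1 * (a i - 2 * (a i)\<^sup>2))) \<le> ?T (x i) powr (c1 - 1)"
        unfolding cauchy_flow_factor_0 a_def using i left[OF i] c
        by (intro powr_perturb_lower_bound) auto
      show "(1 - x i) powr (c2 - 1) * (2 / 3 * exp (c2 * (- b i - 2 * (- b i)\<^sup>2))) \<le> (1 - ?T (x i)) powr (c2 - 1)"
        unfolding cauchy_flow_factor_1 b_def diff_conv_add_uminus[of 1 "Re _"] using i right[OF i] c
        by (intro powr_perturb_lower_bound) auto
      show "1 / 2 \<le> 1 + u i i"
        using pair[OF i i] unfolding u_def by linarith
    qed auto
    finally show ?thesis
      by (simp add: prod.distrib)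
  qed
  have "jacobi_weight n \<beta> p1 p2 x * (2 / 9) ^ n *
      exp (\<beta> * ((\<Sum>j<n. \<Sum>i<j. u i j - 2 * (u i j)\<^sup>2) +
        (\<Sum>i<n. (p1 - real n + 1) / 2 * (a i - 2 * (a i)\<^sup>2) + (p2 - real n + 1) / 2 * (- b i - 2 * (b i)\<^sup>2))))
    = (V * exp (\<beta> * (\<Sum>j<n. \<Sum>i<j. u i j - 2 * (u i j)\<^sup>2))) *
      (S * (2 / 9) ^ n * exp (\<Sum>i<n. c1 * (a i - 2 * (a i)\<^sup>2) + c2 * (- b i - 2 * (b i)\<^sup>2)))"
  proof -
    have "\<beta> * (\<Sum>i<n. (p1 - real n + 1) / 2 * (a i - 2 * (a i)\<^sup>2) + (p2 - real n + 1) / 2 * (- b i - 2 * (b i)\<^sup>2))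
        = (\<Sum>i<n. c1 * (a i - 2 * (a i)\<^sup>2) + c2 * (- b i - 2 * (b i)\<^sup>2))"
      unfolding sum_distrib_left c1_def c2_def
      by (intro sum.cong refl) (subst distrib_left, simp)
    then show ?thesis
      using x unfolding jacobi_weight_def V_def S_def c1_def[symmetric] c2_def[symmetric]
        distrib_left[of \<beta>] exp_add by simp
  qed
  also have "\<dots> \<le> (\<Prod>j<n. \<Prod>i<j. \<bar>?T (x i) - ?T (x j)\<bar> powr \<beta>) *
      ((\<Prod>i<n. ?T (x i) powr (c1 - 1) * (1 - ?T (x i)) powr (c2 - 1)) * (\<Prod>i<n. 1 + u i i))"
    using x01 by (intro mult_mono pairs sites) (auto intro!: prod_nonneg mult_nonneg_nonneg simp: S_def)
  also have "(\<Prod>j<n. \<Prod>i<j. \<bar>?T (x i) - ?T (x j)\<bar> powr \<beta>)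
      = (\<Prod>j<n. \<Prod>i<j. \<bar>(\<lambda>i\<in>{..<n}. ?T (x i)) i - (\<lambda>i\<in>{..<n}. ?T (x i)) j\<bar> powr \<beta>)"
    by (intro prod.cong) auto
  also have "\<dots> * ((\<Prod>i<n. ?T (x i) powr (c1 - 1) * (1 - ?T (x i)) powr (c2 - 1)) * (\<Prod>i<n. 1 + u i i))
      = jacobi_weight n \<beta> p1 p2 (\<lambda>i\<in>{..<n}. ?T (x i)) * (\<Prod>i<n. 1 + u i i)"
    using restr unfolding jacobi_weight_def c1_def c2_def by (simp add: mult.assoc)
  finally show ?thesis
    unfolding u_def .
qed

text \<open>
  The rescaled points are \<open>Y = (x - p1 / (p1 + p2)) / h\<close>, where \<open>h\<close> is this scale.
\<close>
definition spectral_scale :: "nat \<Rightarrow> real \<Rightarrow> real \<Rightarrow> real" where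
  "spectral_scale n p1 p2 = sqrt (real n * p1) / (p1 + p2)"

definition spectral_point :: "nat \<Rightarrow> real \<Rightarrow> real \<Rightarrow> complex \<Rightarrow> complex" where
  "spectral_point n p1 p2 z = of_real (p1 / (p1 + p2)) + of_real (spectral_scale n p1 p2) * z"

text \<open>
  First-order gain of the logarithm of the weight, divided by \<open>\<beta>\<close>, per unit of the (complex)
  amplitude of the flow. Its vanishing in the limit is the loop equation.
\<close>
definition loop_sum :: "nat \<Rightarrow> real \<Rightarrow> real \<Rightarrow> complex \<Rightarrow> (nat \<Rightarrow> real) \<Rightarrow> complex" where
  "loop_sum n p1 p2 \<zeta> x = (\<Sum>j<n. \<Sum>i<j. flow_quotient \<zeta> (x i) (x j)) +
     (\<Sum>i<n. of_real ((p1 - real n + 1) / 2 * (1 - x i) - (p2 - real n + 1) / 2 * x i) /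
        (\<zeta> - of_real (x i)))"

lemma Re_mult_loop_sum:
  "Re (e * loop_sum n p1 p2 \<zeta> x) =
    (\<Sum>j<n. \<Sum>i<j. Re (e * flow_quotient \<zeta> (x i) (x j))) +
    (\<Sum>i<n. (p1 - real n + 1) / 2 * Re (e * (of_real (1 - x i) / (\<zeta> - of_real (x i)))) -
            (p2 - real n + 1) / 2 * Re (e * (of_real (x i) / (\<zeta> - of_real (x i)))))"
proof -
  have eq: "e * (of_real (c1 * (1 - t) - c2 * t) / w)
      = of_real c1 * (e * (of_real (1 - t) / w)) - of_real c2 * (e * (of_real t / w))"
    for c1 c2 t :: real and w
    by (simp add: diff_divide_distrib add_divide_distrib algebra_simps)
  have Re_eq: "Re (e * (of_real (c1 * (1 - t) - c2 * t) / w))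
      = c1 * Re (e * (of_real (1 - t) / w)) - c2 * Re (e * (of_real t / w))"
    for c1 c2 t :: real and w
    unfolding eq minus_complex.sel Re_complex_of_real Im_complex_of_real
    by (simp only: times_complex.sel Re_complex_of_real Im_complex_of_real mult_zero_left diff_zero)
  then show ?thesis
    unfolding loop_sum_def distrib_left sum_distrib_left plus_complex.sel Re_sum
    by (simp only: Re_eq)
qed

definition flow_bound :: "real \<Rightarrow> complex \<Rightarrow> real" where
  "flow_bound R z = (1 + norm z) * (1 + R * norm z) / (Im z)\<^sup>2 + R"

text \<open>
  The three terms control the second-order loss of the pair interaction, of the field at 0 and of
  the field at 1.
\<close>
definition flow_const :: "real \<Rightarrow> complex \<Rightarrow> real" where
  "flow_const R z = (flow_bound R z)\<^sup>2 + ((1 + R) / Im z)\<^sup>2 +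
     (1 + R) * ((1 + norm z) / (Im z)\<^sup>2 + 1 / Im z)"

context
  fixes n :: nat and p1 p2 R \<delta> :: real and z \<theta> \<zeta> e :: complex
  assumes n: "n \<ge> 1" and p: "real n \<le> p1" "real n \<le> p2" and R: "p1 / p2 \<le> R"
    and z: "Im z > 0" and \<theta>: "norm \<theta> \<le> 1" and \<delta>: "\<delta> > 0"
  defines "\<zeta> \<equiv> spectral_point n p1 p2 z" and "e \<equiv> \<theta> * of_real (\<delta> * real n / p2)"
begin

lemma parameters_pos: "p1 > 0" "p2 > 0" and R_nonneg: "R \<ge> 0"
proof -
  show "p1 > 0" "p2 > 0" using n p by auto
  then have "0 \<le> p1 / p2" by simp
  then show "R \<ge> 0" using R by linarith
qed

lemma scale_pos: "spectral_scale n p1 p2 > 0"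
  using parameters_pos n by (simp add: spectral_scale_def)

lemma scale_square: "(spectral_scale n p1 p2)\<^sup>2 = real n * p1 / (p1 + p2)\<^sup>2"
  using parameters_pos by (simp add: spectral_scale_def power_divide)

lemma scale_eq: "spectral_scale n p1 p2 = p1 / (p1 + p2) * sqrt (real n / p1)"
proof -
  have "real n * p1 = p1\<^sup>2 * (real n / p1)"
    using parameters_pos by (simp add: power2_eq_square)
  then have "sqrt (real n * p1) = sqrt (p1\<^sup>2) * sqrt (real n / p1)"
    by (simp only: real_sqrt_mult)
  then have "sqrt (real n * p1) = p1 * sqrt (real n / p1)"
    using parameters_pos by simp
  then show ?thesis by (simp add: spectral_scale_def)
qed

lemma sqrt_ratio_le_1: "0 \<le> sqrt (real n / p1)" "sqrt (real n / p1) \<le> 1"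
  using n p by auto

text \<open>
  With \<open>s = \<surd>(n / p1)\<close> and \<open>\<rho> = p1 / p2\<close>: the amplitude \<open>n / p2 = \<rho> s\<^sup>2\<close> is the one for
  which the flow moves the rescaled points by \<open>\<delta>\<close> times a quantity of order one.
\<close>
lemma n_div_p2_scale: "real n / p2 = sqrt (real n / p1) * (1 + p1 / p2) * spectral_scale n p1 p2"
proof -
  define s where "s = sqrt (real n / p1)"
  have "s\<^sup>2 = real n / p1"
    using parameters_pos by (simp add: s_def)
  have "s * (1 + p1 / p2) * (p1 / (p1 + p2) * s) = s\<^sup>2 * ((1 + p1 / p2) * p1 / (p1 + p2))"
    by (simp add: power2_eq_square)
  also have "\<dots> = real n / p2"
    unfolding \<open>s\<^sup>2 = real n / p1\<close> using parameters_pos by (simp add: divide_simps)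
  finally show ?thesis
    unfolding scale_eq s_def ..
qed

lemma Im_point: "Im \<zeta> = spectral_scale n p1 p2 * Im z"
  by (simp add: \<zeta>_def spectral_point_def)

lemma Im_point_pos: "Im \<zeta> > 0"
  using Im_point scale_pos z by simp

lemma norm_point_minus_real_ge: "spectral_scale n p1 p2 * Im z \<le> norm (\<zeta> - of_real t)"
  using abs_Im_le_cmod[of "\<zeta> - of_real t"] Im_point scale_pos z by simp

lemma norm_e_le: "norm e \<le> \<delta> * (real n / p2)"
proof -
  have "norm e = norm \<theta> * (\<delta> * (real n / p2))"
    using \<delta> parameters_pos unfolding e_def norm_mult norm_of_real by simp
  also have "\<dots> \<le> 1 * (\<delta> * (real n / p2))"
    using \<delta> parameters_pos \<theta> by (intro mult_right_mono) auto
  finally show ?thesis by simp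
qed

lemma norm_point_le: "norm \<zeta> \<le> p1 / (p1 + p2) * (1 + norm z)"
proof -
  have "norm \<zeta> \<le> p1 / (p1 + p2) + spectral_scale n p1 p2 * norm z"
    unfolding \<zeta>_def spectral_point_def
    by (rule norm_triangle_le)
      (use parameters_pos scale_pos in \<open>simp add: norm_mult del: of_real_divide of_real_add\<close>)
  also have "\<dots> = p1 / (p1 + p2) * (1 + sqrt (real n / p1) * norm z)"
    unfolding scale_eq by (simp add: algebra_simps add_divide_distrib)
  also have "\<dots> \<le> p1 / (p1 + p2) * (1 + norm z)"
    using parameters_pos sqrt_ratio_le_1 by (intro mult_left_mono add_mono mult_left_le_one_le) auto
  finally show ?thesis .
qed

lemma norm_one_minus_point_le: "norm (1 - \<zeta>) \<le> p2 / (p1 + p2) * (1 + R * norm z)"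
proof -
  have "1 - \<zeta> = of_real (p2 / (p1 + p2)) - of_real (spectral_scale n p1 p2) * z"
    using parameters_pos unfolding \<zeta>_def spectral_point_def
    by (simp add: field_simps of_real_add[symmetric] del: of_real_add)
  also have "norm \<dots> \<le> p2 / (p1 + p2) + spectral_scale n p1 p2 * norm z"
    by (rule norm_triangle_le_diff)
      (use parameters_pos scale_pos in \<open>simp add: norm_mult del: of_real_divide of_real_add\<close>)
  also have "\<dots> = p2 / (p1 + p2) * (1 + p1 / p2 * (sqrt (real n / p1) * norm z))"
    unfolding scale_eq using parameters_pos by (simp add: divide_simps)
  also have "\<dots> \<le> p2 / (p1 + p2) * (1 + R * norm z)"
    using parameters_pos sqrt_ratio_le_1 R R_nonneg
    by (intro mult_left_mono add_mono mult_mono mult_left_le_one_le) auto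
  finally show ?thesis .
qed

lemma norm_inverse_point_le:
  "norm (1 / (\<zeta> - of_real t)) \<le> 1 / (spectral_scale n p1 p2 * Im z)"
  using norm_point_minus_real_ge[of t] scale_pos z by (simp add: norm_divide frac_le)

lemma norm_flow_quotient_le: "norm (e * flow_quotient \<zeta> s t) \<le> \<delta> * flow_bound R z"
proof -
  let ?h = "spectral_scale n p1 p2"
  have "norm (flow_quotient \<zeta> s t)
      \<le> norm \<zeta> * norm (1 - \<zeta>) * (norm (1 / (\<zeta> - of_real s)) * norm (1 / (\<zeta> - of_real t))) + 1"
    unfolding flow_quotient_def by (rule norm_triangle_le) (simp add: norm_mult norm_divide)
  also have "\<dots> \<le> (p1 / (p1 + p2) * (1 + norm z)) * (p2 / (p1 + p2) * (1 + R * norm z)) *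
      (1 / (?h * Im z) * (1 / (?h * Im z))) + 1"
    using parameters_pos R_nonneg scale_pos z
    by (intro add_mono mult_mono norm_point_le norm_one_minus_point_le norm_inverse_point_le) auto
  also have "\<dots> = p1 * p2 / (p1 + p2)\<^sup>2 / ?h\<^sup>2 * ((1 + norm z) * (1 + R * norm z) / (Im z)\<^sup>2) + 1"
    by (simp add: power2_eq_square mult_ac)
  also have "p1 * p2 / (p1 + p2)\<^sup>2 / ?h\<^sup>2 = p2 / real n"
    unfolding scale_square using parameters_pos n by (simp add: divide_simps)
  finally have q: "norm (flow_quotient \<zeta> s t)
      \<le> p2 / real n * ((1 + norm z) * (1 + R * norm z) / (Im z)\<^sup>2) + 1" .
  have "norm (e * flow_quotient \<zeta> s t)
      \<le> (\<delta> * (real n / p2)) * (p2 / real n * ((1 + norm z) * (1 + R * norm z) / (Im z)\<^sup>2) + 1)"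
    unfolding norm_mult using \<delta> parameters_pos by (intro mult_mono norm_e_le q) auto
  also have "\<dots> = \<delta> * ((1 + norm z) * (1 + R * norm z) / (Im z)\<^sup>2 + real n / p2)"
    using n parameters_pos by (simp add: distrib_left)
  also have "\<dots> \<le> \<delta> * flow_bound R z"
  proof -
    have "real n / p2 \<le> p1 / p2" using p parameters_pos by (intro divide_right_mono) auto
    then have "real n / p2 \<le> R" using R by linarith
    then show ?thesis unfolding flow_bound_def using \<delta> by (intro mult_left_mono add_mono) auto
  qed
  finally show ?thesis .
qed

lemma norm_e_div_le:
  "norm (e / (\<zeta> - of_real t)) \<le> \<delta> * (sqrt (real n / p1) * ((1 + R) / Im z))"
proof -
  let ?h = "spectral_scale n p1 p2"
  have "norm (e / (\<zeta> - of_real t)) = norm e * norm (1 / (\<zeta> - of_real t))"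
    by (simp add: norm_divide)
  also have "\<dots> \<le> (\<delta> * (real n / p2)) * (1 / (?h * Im z))"
    using \<delta> parameters_pos by (intro mult_mono norm_e_le norm_inverse_point_le) auto
  also have "\<dots> = \<delta> * (sqrt (real n / p1) * ((1 + p1 / p2) / Im z))"
    unfolding n_div_p2_scale using scale_pos z by simp
  also have "\<dots> \<le> \<delta> * (sqrt (real n / p1) * ((1 + R) / Im z))"
    using \<delta> z R sqrt_ratio_le_1 by (intro mult_left_mono divide_right_mono) auto
  finally show ?thesis .
qed

lemma Re_left_le:
  assumes "t \<in> {0..1}"
  shows "\<bar>Re (e * (of_real (1 - t) / (\<zeta> - of_real t)))\<bar> \<le> \<delta> * (sqrt (real n / p1) * ((1 + R) / Im z))"
proof -
  have "\<bar>Re (e * (of_real (1 - t) / (\<zeta> - of_real t)))\<bar>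
      \<le> norm (of_real (1 - t) * (e / (\<zeta> - of_real t)))"
    using abs_Re_le_cmod[of "e * (of_real (1 - t) / (\<zeta> - of_real t))"] by (simp add: mult_ac)
  also have "\<dots> \<le> 1 * norm (e / (\<zeta> - of_real t))"
    unfolding norm_mult norm_of_real using assms by (intro mult_right_mono) auto
  finally show ?thesis using norm_e_div_le[of t] by linarith
qed

lemma Re_right_le:
  assumes "t \<in> {0..1}"
  shows "\<bar>Re (e * (of_real t / (\<zeta> - of_real t)))\<bar> \<le> t * norm (e / (\<zeta> - of_real t))"
  using abs_Re_le_cmod[of "e * (of_real t / (\<zeta> - of_real t))"] assms
  by (simp add: mult_ac norm_mult norm_divide)

lemma Re_right_le':
  assumes "t \<in> {0..1}"
  shows "\<bar>Re (e * (of_real t / (\<zeta> - of_real t)))\<bar> \<le> \<delta> * ((1 + R) / Im z)"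
proof -
  have "\<bar>Re (e * (of_real t / (\<zeta> - of_real t)))\<bar> \<le> 1 * norm (e / (\<zeta> - of_real t))"
    by (rule order.trans[OF Re_right_le[OF assms]]) (use assms in \<open>intro mult_right_mono; auto\<close>)
  also have "\<dots> \<le> \<delta> * (sqrt (real n / p1) * ((1 + R) / Im z))"
    using norm_e_div_le by simp
  also have "\<dots> \<le> \<delta> * (1 * ((1 + R) / Im z))"
    using \<delta> sqrt_ratio_le_1 z R_nonneg by (intro mult_left_mono mult_right_mono) auto
  finally show ?thesis by simp
qed

lemma p1_left_square_le:
  assumes "t \<in> {0..1}"
  shows "p1 * (Re (e * (of_real (1 - t) / (\<zeta> - of_real t))))\<^sup>2 \<le> \<delta>\<^sup>2 * real n * ((1 + R) / Im z)\<^sup>2"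
proof -
  have "(Re (e * (of_real (1 - t) / (\<zeta> - of_real t))))\<^sup>2
      \<le> (\<delta> * (sqrt (real n / p1) * ((1 + R) / Im z)))\<^sup>2"
    using power_mono[OF Re_left_le[OF assms], of 2] by simp
  also have "\<dots> = \<delta>\<^sup>2 * (real n / p1) * ((1 + R) / Im z)\<^sup>2"
    using parameters_pos by (simp only: power_mult_distrib real_sqrt_pow2 divide_nonneg_pos of_nat_0_le_iff mult.assoc)
  finally show ?thesis
    using parameters_pos mult_left_mono[of _ _ p1] by fastforce
qed

text \<open>
  Bounding one factor \<open>t\<close> by \<open>norm \<zeta> + norm (\<zeta> - t)\<close> instead of by 1 gains a factor
  \<open>p1 / (p1 + p2)\<close>, which compensates the large prefactor \<open>p2\<close> when \<open>p1 / p2\<close> is small.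
\<close>
lemma p2_right_square_le:
  assumes "t \<in> {0..1}"
  shows "p2 * (Re (e * (of_real t / (\<zeta> - of_real t))))\<^sup>2
    \<le> \<delta>\<^sup>2 * real n * ((1 + R) * ((1 + norm z) / (Im z)\<^sup>2 + 1 / Im z))"
proof -
  let ?h = "spectral_scale n p1 p2"
  define d where "d = norm (\<zeta> - of_real t)"
  have h: "?h * Im z > 0" using scale_pos z by simp
  have d: "?h * Im z \<le> d" unfolding d_def by (rule norm_point_minus_real_ge)
  with h have "d > 0" by linarith
  note d = d h this
  have td: "t / d\<^sup>2 \<le> p1 / (p1 + p2) * (1 + norm z) * (1 / (?h * Im z)\<^sup>2) + 1 / (?h * Im z)"
  proof -
    have "t = norm (\<zeta> - (\<zeta> - of_real t))" using assms by simp
    also have "\<dots> \<le> norm \<zeta> + d" unfolding d_def by (rule norm_triangle_ineq4)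
    finally have "t / d\<^sup>2 \<le> (norm \<zeta> + d) / d\<^sup>2" by (intro divide_right_mono) auto
    also have "\<dots> = norm \<zeta> * (1 / d\<^sup>2) + 1 / d"
      using d by (simp add: add_divide_distrib power2_eq_square)
    also have "\<dots> \<le> p1 / (p1 + p2) * (1 + norm z) * (1 / (?h * Im z)\<^sup>2) + 1 / (?h * Im z)"
      using d parameters_pos z scale_pos
      by (intro add_mono mult_mono norm_point_le divide_left_mono power_mono mult_pos_pos zero_less_power) auto
    finally show ?thesis .
  qed
  have "(Re (e * (of_real t / (\<zeta> - of_real t))))\<^sup>2 \<le> (t * norm (e / (\<zeta> - of_real t)))\<^sup>2"
    using power_mono[OF Re_right_le[OF assms], of 2] by simp
  also have "\<dots> = (t * t) * ((norm e)\<^sup>2 * (1 / d\<^sup>2))"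
    by (simp add: power_mult_distrib power_divide norm_divide d_def power2_eq_square)
  also have "\<dots> \<le> (1 * t) * ((\<delta> * (real n / p2))\<^sup>2 * (1 / d\<^sup>2))"
    using assms by (intro mult_mono power_mono norm_e_le) auto
  also have "\<dots> = (\<delta> * (real n / p2))\<^sup>2 * (t / d\<^sup>2)" by simp
  also have "\<dots> \<le> (\<delta> * (real n / p2))\<^sup>2 *
      (p1 / (p1 + p2) * (1 + norm z) * (1 / (?h * Im z)\<^sup>2) + 1 / (?h * Im z))"
    using td by (rule mult_left_mono) simp
  also have "(\<delta> * (real n / p2))\<^sup>2 *
      (p1 / (p1 + p2) * (1 + norm z) * (1 / (?h * Im z)\<^sup>2) + 1 / (?h * Im z))
    = \<delta>\<^sup>2 * (real n / p2) * (real n / p2 * (p1 / (p1 + p2)) / ?h\<^sup>2 * ((1 + norm z) / (Im z)\<^sup>2)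
        + real n / p2 / ?h * (1 / Im z))"
  proof -
    have "(\<delta> * N)\<^sup>2 * (m * Z * (1 / (h * y)\<^sup>2) + 1 / (h * y))
        = \<delta>\<^sup>2 * N * (N * m / h\<^sup>2 * (Z / y\<^sup>2) + N / h * (1 / y))" for N m Z h y :: real
      by (simp add: power2_eq_square algebra_simps)
    then show ?thesis .
  qed
  also have "real n / p2 * (p1 / (p1 + p2)) / ?h\<^sup>2 = 1 + p1 / p2"
    unfolding scale_square using parameters_pos n by (simp add: divide_simps power2_eq_square)
  also have "real n / p2 / ?h = sqrt (real n / p1) * (1 + p1 / p2)"
    using n_div_p2_scale scale_pos by simp
  also have "\<delta>\<^sup>2 * (real n / p2) * ((1 + p1 / p2) * ((1 + norm z) / (Im z)\<^sup>2)
        + sqrt (real n / p1) * (1 + p1 / p2) * (1 / Im z))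
      \<le> \<delta>\<^sup>2 * (real n / p2) * ((1 + R) * ((1 + norm z) / (Im z)\<^sup>2) + 1 * (1 + R) * (1 / Im z))"
    using parameters_pos z R R_nonneg sqrt_ratio_le_1 \<delta>
    by (intro mult_left_mono add_mono mult_right_mono mult_mono) auto
  finally have "p2 * (Re (e * (of_real t / (\<zeta> - of_real t))))\<^sup>2
      \<le> p2 * (\<delta>\<^sup>2 * (real n / p2) * ((1 + R) * ((1 + norm z) / (Im z)\<^sup>2) + 1 * (1 + R) * (1 / Im z)))"
    using parameters_pos by (intro mult_left_mono) auto
  also have "\<dots> = \<delta>\<^sup>2 * real n * ((1 + R) * ((1 + norm z) / (Im z)\<^sup>2) + 1 * (1 + R) * (1 / Im z))"
    using parameters_pos by simp
  finally show ?thesis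
    by (simp add: distrib_left)
qed

lemma jacobi_weight_flow_gain:
  assumes "\<beta> > 0" and x: "x \<in> {..<n} \<rightarrow>\<^sub>E {0..1}"
    and small: "\<delta> * flow_bound R z \<le> 1 / 2" "\<delta> * ((1 + R) / Im z) \<le> 1 / 2"
  shows "jacobi_weight n \<beta> p1 p2 x * (2 / 9) ^ n *
      exp (\<beta> * (Re (e * loop_sum n p1 p2 \<zeta> x) - 2 * \<delta>\<^sup>2 * (real n)\<^sup>2 * flow_const R z))
    \<le> jacobi_weight n \<beta> p1 p2 (\<lambda>i\<in>{..<n}. cauchy_flow \<zeta> e (x i)) *
      (\<Prod>i<n. 1 + Re (e * flow_quotient \<zeta> (x i) (x i)))"
proof -
  define u where "u = (\<lambda>i j. Re (e * flow_quotient \<zeta> (x i) (x j)))"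
  define a where "a = (\<lambda>i. Re (e * (of_real (1 - x i) / (\<zeta> - of_real (x i)))))"
  define b where "b = (\<lambda>i. Re (e * (of_real (x i) / (\<zeta> - of_real (x i)))))"
  define K where "K = \<delta> * flow_bound R z"
  define E where "E = (\<Sum>j<n. \<Sum>i<j. u i j - 2 * (u i j)\<^sup>2) +
        (\<Sum>i<n. (p1 - real n + 1) / 2 * (a i - 2 * (a i)\<^sup>2) + (p2 - real n + 1) / 2 * (- b i - 2 * (b i)\<^sup>2))"
  have x01: "x i \<in> {0..1}" if "i < n" for i
    using x that by (auto simp: PiE_iff)
  have u_le: "\<bar>Re (e * flow_quotient \<zeta> s t)\<bar> \<le> K" for s t
    unfolding K_def by (rule order.trans[OF abs_Re_le_cmod norm_flow_quotient_le])
  have main: "jacobi_weight n \<beta> p1 p2 x * (2 / 9) ^ n * exp (\<beta> * E)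
    \<le> jacobi_weight n \<beta> p1 p2 (\<lambda>i\<in>{..<n}. cauchy_flow \<zeta> e (x i)) *
      (\<Prod>i<n. 1 + Re (e * flow_quotient \<zeta> (x i) (x i)))"
    unfolding E_def u_def a_def b_def
  proof (rule jacobi_weight_flow_lower_bound[OF _ \<open>\<beta> > 0\<close> p x])
    show "Im \<zeta> \<noteq> 0" using Im_point_pos by simp
    show "\<bar>Re (e * flow_quotient \<zeta> s t)\<bar> \<le> 1 / 2" for s t
      using u_le[of s t] small by (simp add: K_def)
    fix t :: real assume t: "t \<in> {0..1}"
    show "\<bar>Re (e * (of_real t / (\<zeta> - of_real t)))\<bar> \<le> 1 / 2"
      using Re_right_le'[OF t] small by linarith
    have "sqrt (real n / p1) * ((1 + R) / Im z) \<le> (1 + R) / Im z"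
      using sqrt_ratio_le_1 z R_nonneg by (intro mult_left_le_one_le) auto
    then have "\<delta> * (sqrt (real n / p1) * ((1 + R) / Im z)) \<le> \<delta> * ((1 + R) / Im z)"
      using \<delta> by (intro mult_left_mono) auto
    then show "\<bar>Re (e * (of_real (1 - t) / (\<zeta> - of_real t)))\<bar> \<le> 1 / 2"
      using Re_left_le[OF t] small by linarith
  qed
  have pairs: "(\<Sum>j<n. \<Sum>i<j. (u i j)\<^sup>2) \<le> (real n)\<^sup>2 * K\<^sup>2"
  proof -
    have "(\<Sum>i<j. (u i j)\<^sup>2) \<le> real n * K\<^sup>2" if "j < n" for j
    proof -
      have "(\<Sum>i<j. (u i j)\<^sup>2) \<le> (\<Sum>i<j. K\<^sup>2)"
        unfolding u_def by (intro sum_mono abs_le_square_iff[THEN iffD1])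
          (use u_le in \<open>auto intro: order.trans[OF _ abs_ge_self] simp del: times_complex.sel\<close>)
      also have "\<dots> \<le> real n * K\<^sup>2" using that by (simp add: mult_right_mono)
      finally show ?thesis .
    qed
    then have "(\<Sum>j<n. \<Sum>i<j. (u i j)\<^sup>2) \<le> (\<Sum>j<n. real n * K\<^sup>2)"
      by (intro sum_mono) auto
    then show ?thesis by (simp add: power2_eq_square)
  qed
  have sites: "(\<Sum>i<n. (p1 - real n + 1) / 2 * (a i)\<^sup>2 + (p2 - real n + 1) / 2 * (b i)\<^sup>2)
      \<le> (real n)\<^sup>2 * (\<delta>\<^sup>2 * (((1 + R) / Im z)\<^sup>2 + (1 + R) * ((1 + norm z) / (Im z)\<^sup>2 + 1 / Im z)))"
    (is "_ \<le> _ * ?C")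
  proof -
    have "(p1 - real n + 1) / 2 * (a i)\<^sup>2 + (p2 - real n + 1) / 2 * (b i)\<^sup>2 \<le> real n * ?C"
      if "i < n" for i
    proof -
      have "(p1 - real n + 1) / 2 * (a i)\<^sup>2 + (p2 - real n + 1) / 2 * (b i)\<^sup>2
          \<le> p1 * (a i)\<^sup>2 + p2 * (b i)\<^sup>2"
        using n p parameters_pos by (intro add_mono mult_right_mono) auto
      also have "\<dots> \<le> real n * ?C"
        using p1_left_square_le[OF x01[OF that]] p2_right_square_le[OF x01[OF that]]
        by (simp add: a_def b_def algebra_simps)
      finally show ?thesis .
    qed
    then have "(\<Sum>i<n. (p1 - real n + 1) / 2 * (a i)\<^sup>2 + (p2 - real n + 1) / 2 * (b i)\<^sup>2)
        \<le> (\<Sum>i<n. real n * ?C)" by (intro sum_mono) auto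
    then show ?thesis by (simp add: power2_eq_square)
  qed
  have Re_eq: "Re (e * loop_sum n p1 p2 \<zeta> x) = (\<Sum>j<n. \<Sum>i<j. u i j) +
      (\<Sum>i<n. (p1 - real n + 1) / 2 * a i - (p2 - real n + 1) / 2 * b i)"
    unfolding Re_mult_loop_sum u_def a_def b_def ..
  have "E = Re (e * loop_sum n p1 p2 \<zeta> x) - 2 * ((\<Sum>j<n. \<Sum>i<j. (u i j)\<^sup>2) +
      (\<Sum>i<n. (p1 - real n + 1) / 2 * (a i)\<^sup>2 + (p2 - real n + 1) / 2 * (b i)\<^sup>2))"
  proof -
    have site: "(p1 - real n + 1) / 2 * (a i - 2 * (a i)\<^sup>2) + (p2 - real n + 1) / 2 * (- b i - 2 * (b i)\<^sup>2)
        = ((p1 - real n + 1) / 2 * a i - (p2 - real n + 1) / 2 * b i) -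
          2 * ((p1 - real n + 1) / 2 * (a i)\<^sup>2 + (p2 - real n + 1) / 2 * (b i)\<^sup>2)" for i
      by (simp add: field_simps)
    show ?thesis
      unfolding E_def Re_eq site sum_subtractf sum_distrib_left[symmetric] by simp
  qed
  also have "\<dots> \<ge> Re (e * loop_sum n p1 p2 \<zeta> x) - 2 * \<delta>\<^sup>2 * (real n)\<^sup>2 * flow_const R z"
  proof -
    have "(real n)\<^sup>2 * K\<^sup>2 + (real n)\<^sup>2 * ?C = \<delta>\<^sup>2 * (real n)\<^sup>2 * flow_const R z"
      unfolding flow_const_def K_def by (simp add: algebra_simps power_mult_distrib)
    moreover have "(\<Sum>j<n. \<Sum>i<j. (u i j)\<^sup>2) +
        (\<Sum>i<n. (p1 - real n + 1) / 2 * (a i)\<^sup>2 + (p2 - real n + 1) / 2 * (b i)\<^sup>2)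
        \<le> (real n)\<^sup>2 * K\<^sup>2 + (real n)\<^sup>2 * ?C"
      by (intro add_mono pairs sites)
    ultimately show ?thesis by simp
  qed
  finally have "exp (\<beta> * (Re (e * loop_sum n p1 p2 \<zeta> x) - 2 * \<delta>\<^sup>2 * (real n)\<^sup>2 * flow_const R z))
      \<le> exp (\<beta> * E)"
    using \<open>\<beta> > 0\<close> by simp
  moreover have "0 \<le> jacobi_weight n \<beta> p1 p2 x * (2 / 9) ^ n"
    by (auto simp: jacobi_weight_def intro!: mult_nonneg_nonneg prod_nonneg)
  ultimately show ?thesis
    using main by (meson mult_left_mono order.trans)
qed

end

section \<open>Loop equations hold almost surely\<close>

lemma jacobi_weight_nonneg: "0 \<le> jacobi_weight n \<beta> p1 p2 x"
  by (auto simp: jacobi_weight_def intro!: mult_nonneg_nonneg prod_nonneg)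

lemma borel_measurable_jacobi_weight [measurable]:
  "jacobi_weight n \<beta> p1 p2 \<in> borel_measurable (Pi\<^sub>M {..<n} (\<lambda>_. lborel))"
proof -
  have comp: "(\<lambda>x. x i) \<in> borel_measurable (Pi\<^sub>M {..<n} (\<lambda>_. lborel))" if "i < n" for i :: nat
    using measurable_component_singleton[of i "{..<n}" "\<lambda>_. lborel"] that by simp
  have "{..<n} \<rightarrow>\<^sub>E {0..1::real} \<in> sets (Pi\<^sub>M {..<n} (\<lambda>_. lborel))"
    by (intro sets_PiM_I_finite) auto
  then show ?thesis
    unfolding jacobi_weight_def
    by (intro borel_measurable_times borel_measurable_prod powr_real_measurable
        borel_measurable_abs borel_measurable_diff borel_measurable_const comp
        borel_measurable_indicator) auto
qed

lemma borel_measurable_loop_sum [measurable]: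
  "loop_sum n p1 p2 \<zeta> \<in> borel_measurable (Pi\<^sub>M {..<n} (\<lambda>_. lborel))"
proof -
  have comp [measurable]: "(\<lambda>x. x i) \<in> borel_measurable (Pi\<^sub>M {..<n} (\<lambda>_. lborel))"
    if "i < n" for i :: nat
    using measurable_component_singleton[of i "{..<n}" "\<lambda>_. lborel"] that by simp
  show ?thesis
    unfolding loop_sum_def flow_quotient_def
    by (intro borel_measurable_add borel_measurable_sum borel_measurable_divide
        borel_measurable_times borel_measurable_diff borel_measurable_const
        borel_measurable_of_real comp) auto
qed

lemma loop_sum_restrict:
  "loop_sum n p1 p2 \<zeta> (restrict x {..<n}) = loop_sum n p1 p2 \<zeta> x"
  unfolding loop_sum_def by (intro arg_cong2[where f = plus] sum.cong) auto

lemma nn_integral_jacobi_density: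
  assumes "prob_space M" "beta_jacobi_ensemble M n \<beta> p1 p2 \<Lambda>"
  shows "(\<integral>\<^sup>+x. ennreal (jacobi_density n \<beta> p1 p2 x) \<partial>(Pi\<^sub>M {..<n} (\<lambda>_. lborel))) = 1"
  using assms distributed_nn_integral[of M _ _ _ "\<lambda>_. 1"] prob_space.emeasure_space_1[of M]
  unfolding beta_jacobi_ensemble_def by fastforce

lemma beta_jacobi_AE_unit_cube:
  assumes "beta_jacobi_ensemble M n \<beta> p1 p2 \<Lambda>"
  shows "AE \<omega> in M. \<forall>i<n. \<Lambda> \<omega> i \<in> {0..1}"
proof -
  let ?N = "Pi\<^sub>M {..<n} (\<lambda>_. lborel :: real measure)"
  let ?X = "\<lambda>\<omega>. restrict (\<Lambda> \<omega>) {..<n}"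
  have D: "distributed M ?N ?X (\<lambda>x. ennreal (jacobi_density n \<beta> p1 p2 x))"
    using assms by (simp add: beta_jacobi_ensemble_def)
  have X: "?X \<in> measurable M ?N"
    using D by (rule distributed_measurable)
  have cube: "{..<n} \<rightarrow>\<^sub>E {0..1} \<in> sets ?N"
    by (intro sets_PiM_I_finite) auto
  have "AE x in density ?N (\<lambda>x. ennreal (jacobi_density n \<beta> p1 p2 x)). x \<in> {..<n} \<rightarrow>\<^sub>E {0..1}"
    using D by (subst AE_density)
      (auto simp: distributed_def jacobi_density_def jacobi_weight_def indicator_def split: if_splits intro!: AE_I2)
  then have "AE x in distr M ?N ?X. x \<in> {..<n} \<rightarrow>\<^sub>E {0..1}"
    unfolding distributed_distr_eq_density[OF D] .
  then have "AE \<omega> in M. ?X \<omega> \<in> {..<n} \<rightarrow>\<^sub>E {0..1}"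
    using X cube by (subst (asm) AE_distr_iff) auto
  then show ?thesis
    by eventually_elim (auto simp: PiE_iff)
qed

text \<open>
  Exponential form of the integration by parts behind the loop equations: the flow only moves mass
  around, so the ratio of the moved weight to the weight has expectation 1, and Markov's inequality
  applies to its exponential lower bound.
\<close>
lemma beta_jacobi_loop_tail:
  fixes n :: nat and p1 p2 R \<delta> \<beta> \<tau> :: real and z \<theta> :: complex
  assumes M: "prob_space M" and J: "beta_jacobi_ensemble M n \<beta> p1 p2 \<Lambda>" and "\<beta> > 0"
    and n: "n \<ge> 1" and p: "real n \<le> p1" "real n \<le> p2" and R: "p1 / p2 \<le> R"
    and z: "Im z > 0" and \<theta>: "norm \<theta> \<le> 1" and \<delta>: "\<delta> > 0"
    and small: "\<delta> * flow_bound R z \<le> 1 / 2" "\<delta> * ((1 + R) / Im z) \<le> 1 / 2"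
  defines "\<zeta> \<equiv> spectral_point n p1 p2 z" and "e \<equiv> \<theta> * of_real (\<delta> * real n / p2)"
  shows "{\<omega> \<in> space M. \<tau> \<le> Re (e * loop_sum n p1 p2 \<zeta> (\<Lambda> \<omega>))} \<in> sets M"
    and "measure M {\<omega> \<in> space M. \<tau> \<le> Re (e * loop_sum n p1 p2 \<zeta> (\<Lambda> \<omega>))}
      \<le> (9 / 2) ^ n * exp (- \<beta> * (\<tau> - 2 * \<delta>\<^sup>2 * (real n)\<^sup>2 * flow_const R z))"
proof -
  let ?N = "Pi\<^sub>M {..<n} (\<lambda>_. lborel :: real measure)"
  let ?X = "\<lambda>\<omega>. restrict (\<Lambda> \<omega>) {..<n}"
  let ?T = "cauchy_flow \<zeta> e"
  define T' where "T' = (\<lambda>t. 1 + Re (e * flow_quotient \<zeta> t t))"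
  define c where "c = jacobi_const n \<beta> p1 p2"
  define f where "f = jacobi_density n \<beta> p1 p2"
  define A where "A = {x \<in> space ?N. \<tau> \<le> Re (e * loop_sum n p1 p2 \<zeta> x)}"
  define B where "B = exp (\<beta> * (\<tau> - 2 * \<delta>\<^sup>2 * (real n)\<^sup>2 * flow_const R z)) * (2 / 9) ^ n"
  interpret prob_space M by fact
  have D: "distributed M ?N ?X (\<lambda>x. ennreal (f x))"
    using J by (simp add: beta_jacobi_ensemble_def f_def)
  have X: "?X \<in> measurable M ?N"
    using D by (rule distributed_measurable)
  have A [measurable]: "A \<in> sets ?N"
    unfolding A_def by measurable
  have event: "{\<omega> \<in> space M. \<tau> \<le> Re (e * loop_sum n p1 p2 \<zeta> (\<Lambda> \<omega>))} = ?X -` A \<inter> space M"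
    using measurable_space[OF X] by (auto simp: A_def loop_sum_restrict)
  show "{\<omega> \<in> space M. \<tau> \<le> Re (e * loop_sum n p1 p2 \<zeta> (\<Lambda> \<omega>))} \<in> sets M"
    unfolding event using X A by (rule measurable_sets)
  have \<zeta>: "Im \<zeta> \<noteq> 0"
    using Im_point_pos[OF n p R z \<theta> \<delta>] by (simp add: \<zeta>_def)
  have "c \<ge> 0"
    unfolding c_def jacobi_const_def
    by (intro divide_nonneg_nonneg integral_nonneg_AE) (auto simp: jacobi_weight_nonneg)
  have f_eq: "f x = c * jacobi_weight n \<beta> p1 p2 x" for x
    by (simp add: f_def c_def jacobi_density_def)
  have f_meas [measurable]: "f \<in> borel_measurable ?N"
    unfolding f_eq[abs_def] by measurable
  have f_cube: "ennreal (f x) * (\<Prod>i<n. indicator {0..1} (x i)) = ennreal (f x)"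
    if "x \<in> space ?N" for x
  proof (cases "x \<in> {..<n} \<rightarrow>\<^sub>E {0..1}")
    case True
    then have "(\<Prod>i<n. indicator {0..1} (x i)) = (1 :: ennreal)"
      by (intro prod.neutral) (auto simp: PiE_iff)
    then show ?thesis by simp
  qed (simp add: f_eq jacobi_weight_def)
  have deriv: "(?T has_real_derivative T' t) (at t)" for t
    unfolding T'_def by (rule cauchy_flow_has_derivative[OF \<zeta>])
  have T'_nonneg: "0 \<le> T' t" for t
  proof -
    have "norm (e * flow_quotient \<zeta> t t) \<le> 1 / 2"
      using norm_flow_quotient_le[OF n p R z \<theta> \<delta>, of t t] small by (simp add: \<zeta>_def e_def)
    then show ?thesis
      using abs_Re_le_cmod[of "e * flow_quotient \<zeta> t t"] unfolding T'_def by linarith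
  qed
  have cont: "continuous_on UNIV T'"
    unfolding T'_def by (rule continuous_on_flow_quotient_diag[OF \<zeta>])
  have gain: "B * f x \<le> f (\<lambda>i\<in>{..<n}. ?T (x i)) * (\<Prod>i<n. T' (x i))"
    if "x \<in> A" "x \<in> {..<n} \<rightarrow>\<^sub>E {0..1}" for x
  proof -
    have "B * f x = c * (jacobi_weight n \<beta> p1 p2 x * (2 / 9) ^ n *
        exp (\<beta> * (\<tau> - 2 * \<delta>\<^sup>2 * (real n)\<^sup>2 * flow_const R z)))"
      by (simp add: B_def f_eq)
    also have "\<dots> \<le> c * (jacobi_weight n \<beta> p1 p2 x * (2 / 9) ^ n *
        exp (\<beta> * (Re (e * loop_sum n p1 p2 \<zeta> x) - 2 * \<delta>\<^sup>2 * (real n)\<^sup>2 * flow_const R z)))"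
      using \<open>c \<ge> 0\<close> \<open>\<beta> > 0\<close> \<open>x \<in> A\<close>
      by (intro mult_left_mono) (auto simp: A_def jacobi_weight_nonneg simp del: times_complex.sel)
    also have "\<dots> \<le> c * (jacobi_weight n \<beta> p1 p2 (\<lambda>i\<in>{..<n}. ?T (x i)) * (\<Prod>i<n. T' (x i)))"
      unfolding T'_def \<zeta>_def e_def using \<open>c \<ge> 0\<close> \<open>\<beta> > 0\<close> that small
      by (intro mult_left_mono jacobi_weight_flow_gain[OF n p R z \<theta> \<delta>]) auto
    finally show ?thesis
      by (simp add: f_eq mult.assoc)
  qed
  then have le: "ennreal B * (ennreal (f x) * indicator A x)
      \<le> ennreal (f (\<lambda>i\<in>{..<n}. ?T (x i))) * (\<Prod>i<n. ennreal (T' (x i)) * indicator {0..1} (x i))"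
    if "x \<in> space ?N" for x
  proof (cases "x \<in> A \<and> x \<in> {..<n} \<rightarrow>\<^sub>E {0..1}")
    case True
    then have "(\<Prod>i<n. ennreal (T' (x i)) * indicator {0..1} (x i)) = ennreal (\<Prod>i<n. T' (x i))"
      by (subst prod_ennreal[symmetric]) (auto simp: PiE_iff T'_nonneg intro!: prod.cong)
    moreover have "B \<ge> 0" by (simp add: B_def)
    moreover have "f (\<lambda>i\<in>{..<n}. ?T (x i)) \<ge> 0" "f x \<ge> 0"
      using \<open>c \<ge> 0\<close> by (simp_all add: f_eq jacobi_weight_nonneg)
    ultimately show ?thesis
      using gain[of x] True
      by (simp add: ennreal_mult'[symmetric] ennreal_leI)
  next
    case False
    then have "ennreal (f x) * indicator A x = 0"
      by (cases "x \<in> A") (simp_all add: f_eq jacobi_weight_def)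
    then show ?thesis by (simp only: mult_zero_right zero_le)
  qed
  have "ennreal B * emeasure M (?X -` A \<inter> space M)
      = (\<integral>\<^sup>+x. ennreal B * (ennreal (f x) * indicator A x) \<partial>?N)"
    unfolding distributed_emeasure[OF D A] by (subst nn_integral_cmult) auto
  also have "\<dots> \<le> (\<integral>\<^sup>+x. ennreal (f (\<lambda>i\<in>{..<n}. ?T (x i))) *
      (\<Prod>i<n. ennreal (T' (x i)) * indicator {0..1} (x i)) \<partial>?N)"
    by (intro nn_integral_mono le)
  also have "\<dots> = (\<integral>\<^sup>+x. ennreal (f x) * (\<Prod>i<n. indicator {0..1} (x i)) \<partial>?N)"
    by (rule nn_integral_PiM_unit_cube_substitution[where F = "\<lambda>x. ennreal (f x)"])
      (use deriv cont T'_nonneg in auto)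
  also have "\<dots> = (\<integral>\<^sup>+x. ennreal (f x) \<partial>?N)"
    by (intro nn_integral_cong f_cube)
  also have "\<dots> = 1"
    unfolding f_def by (rule nn_integral_jacobi_density[OF M J])
  finally have "B * measure M (?X -` A \<inter> space M) \<le> 1"
    by (simp add: emeasure_eq_measure ennreal_mult'[symmetric] B_def)
  then have "measure M (?X -` A \<inter> space M) \<le> 1 / B"
    by (simp add: B_def field_simps)
  also have "1 / B = (9 / 2) ^ n * exp (- \<beta> * (\<tau> - 2 * \<delta>\<^sup>2 * (real n)\<^sup>2 * flow_const R z))"
  proof -
    have "1 / (exp X * (2 / 9) ^ n) = (9 / 2) ^ n * exp (- X)" for X :: real
      by (simp add: exp_minus power_divide field_simps)
    then show ?thesis
      by (simp only: B_def mult_minus_left)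
  qed
  finally show "measure M {\<omega> \<in> space M. \<tau> \<le> Re (e * loop_sum n p1 p2 \<zeta> (\<Lambda> \<omega>))}
      \<le> (9 / 2) ^ n * exp (- \<beta> * (\<tau> - 2 * \<delta>\<^sup>2 * (real n)\<^sup>2 * flow_const R z))"
    unfolding event .
qed

text \<open>
  With \<open>\<delta>\<close> a fixed small multiple of \<open>\<epsilon>\<close>, the exponent \<open>- \<beta> n\<^sup>2 \<delta> \<epsilon> / 2\<close> beats the
  entropy factor \<open>(9 / 2)\<^sup>n\<close> as soon as \<open>\<beta> n\<close> exceeds a constant; the probabilities are then
  at most \<open>exp (- n)\<close>.
\<close>
lemma beta_jacobi_loop_eventually_less:
  fixes z \<theta> :: complex
  assumes M: "prob_space M"
    and \<beta>: "\<And>n. n \<ge> 1 \<Longrightarrow> \<beta> n > 0"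
    and p1: "\<And>n. n \<ge> 1 \<Longrightarrow> p1 n \<ge> real n"
    and p2: "\<And>n. n \<ge> 1 \<Longrightarrow> p2 n \<ge> real n"
    and J: "\<And>n. n \<ge> 1 \<Longrightarrow> beta_jacobi_ensemble M n (\<beta> n) (p1 n) (p2 n) (\<Lambda> n)"
    and R: "\<And>n. n \<ge> 1 \<Longrightarrow> p1 n / p2 n \<le> R"
    and lim: "filterlim (\<lambda>n. \<beta> n * real n) at_top sequentially"
    and z: "Im z > 0" and \<theta>: "norm \<theta> \<le> 1" and \<epsilon>: "\<epsilon> > 0"
  shows "AE \<omega> in M. \<forall>\<^sub>F n in sequentially.
    Re (\<theta> * (loop_sum n (p1 n) (p2 n) (spectral_point n (p1 n) (p2 n) z) (\<Lambda> n \<omega>) /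
      of_real (real n * p2 n))) < \<epsilon>"
proof -
  interpret prob_space M by fact
  let ?S = "\<lambda>n \<omega>. loop_sum n (p1 n) (p2 n) (spectral_point n (p1 n) (p2 n) z) (\<Lambda> n \<omega>)"
  define b where "b = flow_bound R z"
  define C where "C = flow_const R z"
  have "p1 1 / p2 1 \<ge> 0" using p1[of 1] p2[of 1] by simp
  then have "R \<ge> 0" using R[of 1] by linarith
  have b: "b \<ge> 0" and C: "C \<ge> 0"
    using \<open>R \<ge> 0\<close> z by (auto simp: b_def C_def flow_bound_def flow_const_def)
  \<comment> \<open>The first two bounds keep the flow in the range of the estimates above, the third makes the
    quadratic loss at most half of the linear gain.\<close>
  define \<delta> where "\<delta> = min (min (1 / (2 * (b + 1))) (Im z / (2 * (1 + R)))) (\<epsilon> / (4 * (C + 1)))"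
  have \<delta>: "\<delta> > 0"
    using b C z \<epsilon> \<open>R \<ge> 0\<close> by (auto simp: \<delta>_def)
  have small1: "\<delta> * b \<le> 1 / 2"
  proof -
    have "\<delta> * b \<le> 1 / (2 * (b + 1)) * (b + 1)"
      using b by (intro mult_mono) (auto simp: \<delta>_def)
    also have "\<dots> = 1 / 2" using b by (simp add: field_simps)
    finally show ?thesis .
  qed
  have small2: "\<delta> * ((1 + R) / Im z) \<le> 1 / 2"
  proof -
    have "\<delta> * ((1 + R) / Im z) \<le> Im z / (2 * (1 + R)) * ((1 + R) / Im z)"
      using z \<open>R \<ge> 0\<close> by (intro mult_right_mono) (auto simp: \<delta>_def)
    also have "\<dots> = 1 / 2" using z \<open>R \<ge> 0\<close> by simp
    finally show ?thesis .
  qed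
  have small3: "2 * \<delta> * C \<le> \<epsilon> / 2"
  proof -
    have "\<delta> * C \<le> \<epsilon> / (4 * (C + 1)) * (C + 1)"
      using C \<epsilon> by (intro mult_mono) (auto simp: \<delta>_def)
    also have "\<dots> = \<epsilon> / 4" using C by (simp add: field_simps)
    finally show ?thesis by simp
  qed
  define e where "e n = \<theta> * of_real (\<delta> * real n / p2 n)" for n
  define \<tau> where "\<tau> n = \<delta> * (real n)\<^sup>2 * \<epsilon>" for n
  define A where "A n = (if n \<ge> 1 then {\<omega> \<in> space M. \<tau> n \<le> Re (e n * ?S n \<omega>)} else {})" for n
  have A_sets: "A n \<in> sets M" for n
  proof (cases "n \<ge> 1")
    case True
    then show ?thesis
      using beta_jacobi_loop_tail(1)[OF M J[OF True] \<beta>[OF True] True p1[OF True] p2[OF True] R[OF True]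
          z \<theta> \<delta> small1[unfolded b_def] small2]
      by (simp only: A_def e_def if_True)
  qed (simp add: A_def)
  define K where "K = (ln (9 / 2) + 1) / (\<delta> * \<epsilon> / 2)"
  have bound: "measure M (A n) \<le> exp (- 1) ^ n" if n: "n \<ge> 1" and K: "\<beta> n * real n \<ge> K" for n
  proof -
    have "measure M (A n) \<le> (9 / 2) ^ n * exp (- \<beta> n * (\<tau> n - 2 * \<delta>\<^sup>2 * (real n)\<^sup>2 * C))"
      unfolding A_def e_def C_def
      using beta_jacobi_loop_tail(2)[OF M J[OF n] \<beta>[OF n] n p1[OF n] p2[OF n] R[OF n] z \<theta> \<delta>, of "\<tau> n"]
        small1 small2 n by (simp only: b_def if_True)
    also have "\<dots> = exp (real n * ln (9 / 2) - \<beta> n * (\<tau> n - 2 * \<delta>\<^sup>2 * (real n)\<^sup>2 * C))"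
    proof -
      have "(9 / 2) ^ n = exp (real n * ln (9 / 2 :: real))"
        by (simp add: exp_of_nat_mult)
      then show ?thesis
        by (simp only: mult_minus_left exp_add[symmetric] diff_conv_add_uminus[symmetric])
    qed
    also have "\<dots> \<le> exp (- real n)"
    proof -
      have "\<delta> * (2 * \<delta> * C) \<le> \<delta> * (\<epsilon> / 2)"
        using \<delta> small3 by (intro mult_left_mono) auto
      then have "(real n)\<^sup>2 * (\<delta> * \<epsilon> / 2) \<le> (real n)\<^sup>2 * (\<delta> * \<epsilon> - 2 * \<delta>\<^sup>2 * C)"
        by (intro mult_left_mono) (auto simp: power2_eq_square)
      also have "\<dots> = \<tau> n - 2 * \<delta>\<^sup>2 * (real n)\<^sup>2 * C"
        by (simp add: \<tau>_def algebra_simps)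
      finally have "\<beta> n * ((real n)\<^sup>2 * (\<delta> * \<epsilon> / 2)) \<le> \<beta> n * (\<tau> n - 2 * \<delta>\<^sup>2 * (real n)\<^sup>2 * C)"
        using \<beta>[OF n] by (intro mult_left_mono) auto
      moreover have "real n * (ln (9 / 2) + 1) \<le> \<beta> n * ((real n)\<^sup>2 * (\<delta> * \<epsilon> / 2))"
      proof -
        have "ln (9 / 2) + 1 = K * (\<delta> * \<epsilon> / 2)"
          using \<delta> \<epsilon> by (simp add: K_def)
        also have "\<dots> \<le> \<beta> n * real n * (\<delta> * \<epsilon> / 2)"
          using K \<delta> \<epsilon> by (intro mult_right_mono) auto
        finally have "real n * (ln (9 / 2) + 1) \<le> real n * (\<beta> n * real n * (\<delta> * \<epsilon> / 2))"
          by (intro mult_left_mono) auto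
        then show ?thesis by (simp add: power2_eq_square mult_ac)
      qed
      ultimately show ?thesis by (simp add: distrib_left)
    qed
    also have "\<dots> = exp (- 1) ^ n"
      by (simp add: exp_of_nat_mult[symmetric])
    finally show ?thesis .
  qed
  have "AE \<omega> in M. \<forall>\<^sub>F n in sequentially. \<omega> \<in> space M - A n"
  proof (rule borel_cantelli_AE1[OF A_sets])
    show "emeasure M (A n) < \<infinity>" for n by (simp add: emeasure_eq_measure)
    have "\<forall>\<^sub>F n in sequentially. n \<ge> 1 \<and> \<beta> n * real n \<ge> K"
      using eventually_ge_at_top[of 1] lim unfolding filterlim_at_top by (auto intro: eventually_conj)
    then have "\<forall>\<^sub>F n in sequentially. norm (measure M (A n)) \<le> exp (- 1) ^ n"
      by eventually_elim (use bound in auto)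
    then show "summable (\<lambda>n. measure M (A n))"
      by (rule summable_comparison_test_ev) (simp add: summable_geometric)
  qed
  then show ?thesis
  proof eventually_elim
    case (elim \<omega>)
    have "\<forall>\<^sub>F n in sequentially. n \<ge> 1 \<and> \<omega> \<in> space M - A n"
      using elim eventually_ge_at_top[of 1] by (auto intro: eventually_conj)
    then show ?case
    proof eventually_elim
      case (elim n)
      then have n: "real n > 0" and p: "p2 n > 0" using p2[of n] by auto
      have "e n * ?S n \<omega> = of_real (\<delta> * (real n)\<^sup>2) * (\<theta> * (?S n \<omega> / of_real (real n * p2 n)))"
        using n p by (simp add: e_def power2_eq_square)
      then have "Re (e n * ?S n \<omega>) = \<delta> * (real n)\<^sup>2 * Re (\<theta> * (?S n \<omega> / of_real (real n * p2 n)))"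
        by (simp only: times_complex.sel(1)[of "of_real _"] Re_complex_of_real Im_complex_of_real
            mult_zero_left diff_zero)
      moreover have "Re (e n * ?S n \<omega>) < \<tau> n"
        using elim by (auto simp: A_def)
      ultimately have "\<delta> * (real n)\<^sup>2 * Re (\<theta> * (?S n \<omega> / of_real (real n * p2 n))) < \<delta> * (real n)\<^sup>2 * \<epsilon>"
        by (simp only: \<tau>_def)
      then show ?case
        using \<delta> n by (simp only: mult_less_cancel_left_pos zero_less_power mult_pos_pos)
    qed
  qed
qed

lemma tendsto_zero_if_Re_rotations_eventually_less:
  fixes f :: "nat \<Rightarrow> complex"
  assumes "\<And>\<theta> k. \<theta> \<in> {1, -1, \<i>, -\<i>} \<Longrightarrow>
    \<forall>\<^sub>F n in sequentially. Re (\<theta> * f n) < 1 / real (Suc k)"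
  shows "f \<longlonglongrightarrow> 0"
proof (rule tendstoI)
  fix r :: real assume "r > 0"
  then obtain k where k: "1 / real (Suc k) < r / 2"
    using reals_Archimedean[of "r / 2"] by (auto simp: inverse_eq_divide)
  have "\<forall>\<^sub>F n in sequentially. Re (1 * f n) < 1 / real (Suc k) \<and> Re (-1 * f n) < 1 / real (Suc k) \<and>
      Re (\<i> * f n) < 1 / real (Suc k) \<and> Re (-\<i> * f n) < 1 / real (Suc k)"
    by (intro eventually_conj assms) auto
  then show "\<forall>\<^sub>F n in sequentially. dist (f n) 0 < r"
  proof eventually_elim
    case (elim n)
    then have "\<bar>Re (f n)\<bar> < 1 / real (Suc k)" "\<bar>Im (f n)\<bar> < 1 / real (Suc k)"
      by auto
    then have "norm (f n) < r"
      using cmod_le[of "f n"] k by linarith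
    then show ?case by simp
  qed
qed

lemma beta_jacobi_loop_AE_tendsto_0:
  fixes z :: complex
  assumes M: "prob_space M"
    and \<beta>: "\<And>n. n \<ge> 1 \<Longrightarrow> \<beta> n > 0"
    and p1: "\<And>n. n \<ge> 1 \<Longrightarrow> p1 n \<ge> real n"
    and p2: "\<And>n. n \<ge> 1 \<Longrightarrow> p2 n \<ge> real n"
    and J: "\<And>n. n \<ge> 1 \<Longrightarrow> beta_jacobi_ensemble M n (\<beta> n) (p1 n) (p2 n) (\<Lambda> n)"
    and R: "\<And>n. n \<ge> 1 \<Longrightarrow> p1 n / p2 n \<le> R"
    and lim: "filterlim (\<lambda>n. \<beta> n * real n) at_top sequentially"
    and z: "Im z > 0"
  shows "AE \<omega> in M. (\<lambda>n. loop_sum n (p1 n) (p2 n) (spectral_point n (p1 n) (p2 n) z) (\<Lambda> n \<omega>) /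
      of_real (real n * p2 n)) \<longlonglongrightarrow> 0"
proof -
  have "AE \<omega> in M. \<forall>\<theta> \<in> {1, -1, \<i>, -\<i>}. \<forall>k. \<forall>\<^sub>F n in sequentially.
    Re (\<theta> * (loop_sum n (p1 n) (p2 n) (spectral_point n (p1 n) (p2 n) z) (\<Lambda> n \<omega>) /
      of_real (real n * p2 n))) < 1 / real (Suc k)"
  proof (intro AE_finite_allI AE_all_countable[THEN iffD2] allI)
    fix \<theta> :: complex and k assume "\<theta> \<in> {1, -1, \<i>, -\<i>}"
    then have "norm \<theta> \<le> 1" by auto
    then show "AE \<omega> in M. \<forall>\<^sub>F n in sequentially.
        Re (\<theta> * (loop_sum n (p1 n) (p2 n) (spectral_point n (p1 n) (p2 n) z) (\<Lambda> n \<omega>) /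
          of_real (real n * p2 n))) < 1 / real (Suc k)"
      by (intro beta_jacobi_loop_eventually_less[OF M \<beta> p1 p2 J R lim z]) auto
  qed simp
  then show ?thesis
    by eventually_elim (rule tendsto_zero_if_Re_rotations_eventually_less, blast)
qed

section \<open>The loop equation as a quadratic equation for the resolvent\<close>

lemma sum_pairs_prod:
  fixes f :: "nat \<Rightarrow> complex"
  shows "2 * (\<Sum>j<n. \<Sum>i<j. f i * f j) = (\<Sum>i<n. f i)\<^sup>2 - (\<Sum>i<n. (f i)\<^sup>2)"
proof (induction n)
  case (Suc n)
  have "(\<Sum>i<n. f i * f n) = (\<Sum>i<n. f i) * f n"
    by (simp add: sum_distrib_right)
  then show ?case
    using Suc by (simp add: distrib_left power2_sum power2_eq_square algebra_simps)
qed simp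

lemma loop_sum_resolvent:
  fixes x :: "nat \<Rightarrow> real" and n :: nat
  assumes "Im \<zeta> \<noteq> 0"
  defines "S1 \<equiv> (\<Sum>i<n. 1 / (\<zeta> - of_real (x i)))" and "S2 \<equiv> (\<Sum>i<n. (1 / (\<zeta> - of_real (x i)))\<^sup>2)"
  shows "2 * loop_sum n p1 p2 \<zeta> x = \<zeta> * (1 - \<zeta>) * (S1\<^sup>2 - S2) + of_nat n * (of_nat n - 1) +
    ((of_real p1 - of_nat n + 1) - (of_real p1 + of_real p2 - 2 * of_nat n + 2) * \<zeta>) * S1 +
    of_nat n * (of_real p1 + of_real p2 - 2 * of_nat n + 2)"
proof -
  define g where "g = (\<lambda>i. 1 / (\<zeta> - of_real (x i)))"
  have nz: "\<zeta> - of_real t \<noteq> 0" for t using assms(1) by (rule nonreal_minus_real_nonzero)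
  have q: "flow_quotient \<zeta> (x i) (x j) = \<zeta> * (1 - \<zeta>) * (g i * g j) + 1" for i j
    by (simp add: flow_quotient_def g_def)
  have ones: "2 * (\<Sum>j<n. of_nat j) = (of_nat n * (of_nat n - 1) :: complex)"
    by (induction n) (simp_all add: algebra_simps)
  have pairs: "2 * (\<Sum>j<n. \<Sum>i<j. flow_quotient \<zeta> (x i) (x j))
      = \<zeta> * (1 - \<zeta>) * (S1\<^sup>2 - S2) + of_nat n * (of_nat n - 1)"
  proof -
    have "2 * (\<Sum>j<n. \<Sum>i<j. flow_quotient \<zeta> (x i) (x j))
        = \<zeta> * (1 - \<zeta>) * (2 * (\<Sum>j<n. \<Sum>i<j. g i * g j)) + 2 * (\<Sum>j<n. of_nat j)"
      unfolding q by (simp add: sum.distrib sum_distrib_left mult_ac distrib_left)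
    then show ?thesis
      unfolding sum_pairs_prod ones by (simp add: S1_def S2_def g_def)
  qed
  have site: "2 * (of_real ((p1 - real n + 1) / 2 * (1 - t) - (p2 - real n + 1) / 2 * t) / (\<zeta> - of_real t))
      = ((of_real p1 - of_nat n + 1) - (of_real p1 + of_real p2 - 2 * of_nat n + 2) * \<zeta>) * (1 / (\<zeta> - of_real t)) +
        (of_real p1 + of_real p2 - 2 * of_nat n + 2)" for t
    using nz[of t] by (simp add: field_simps)
  have sites: "2 * (\<Sum>i<n. of_real ((p1 - real n + 1) / 2 * (1 - x i) - (p2 - real n + 1) / 2 * x i) / (\<zeta> - of_real (x i)))
      = ((of_real p1 - of_nat n + 1) - (of_real p1 + of_real p2 - 2 * of_nat n + 2) * \<zeta>) * S1 +
        of_nat n * (of_real p1 + of_real p2 - 2 * of_nat n + 2)"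
    unfolding sum_distrib_left site sum.distrib S1_def by (simp add: algebra_simps)
  show ?thesis
    unfolding loop_sum_def distrib_left[of 2] pairs sites by (simp add: add.assoc)
qed

text \<open>
  Pure algebra: \<open>p1\<close>, \<open>p2\<close> and the scale are expressed through \<open>N = n\<close>, \<open>s = \<surd>(n / p1)\<close> and
  \<open>r = p1 / p2\<close>, in which the equation has a limit.
\<close>
lemma loop_equation_rescaling:
  fixes N s r z G G2 :: complex
  assumes nz: "N \<noteq> 0" "s \<noteq> 0" "r \<noteq> 0" "1 + r \<noteq> 0"
  defines "\<zeta> \<equiv> r * (1 + s * z) / (1 + r)" and "h \<equiv> s * r / (1 + r)"
    and "P1 \<equiv> N / s\<^sup>2" and "P2 \<equiv> N / (r * s\<^sup>2)"
  shows "(\<zeta> * (1 - \<zeta>) * ((N * G / h)\<^sup>2 - N * G2 / h\<^sup>2) + N * (N - 1) +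
      ((P1 - N + 1) - (P1 + P2 - 2 * N + 2) * \<zeta>) * (N * G / h) + N * (P1 + P2 - 2 * N + 2)) / (N * P2)
    = (1 + s * z) * (1 - r * s * z) * G\<^sup>2 - ((1 + r - 2 * r * s\<^sup>2) * z + s * (1 - r)) * G + (1 + r - r * s\<^sup>2)
      + (- (1 + s * z) * (1 - r * s * z) * G2 + (s * (1 - r) - 2 * r * s\<^sup>2 * z) * G + r * s\<^sup>2) / N"
proof -
  have h: "h \<noteq> 0" using nz by (simp add: h_def)
  have 1: "1 - \<zeta> = (1 - r * s * z) / (1 + r)"
    using nz by (simp add: \<zeta>_def field_simps)
  have A: "\<zeta> * (1 - \<zeta>) / h\<^sup>2 = (1 + s * z) * (1 - r * s * z) / (r * s\<^sup>2)"
  proof -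
    have "\<zeta> * (1 - \<zeta>) / h\<^sup>2 = (r * ((1 + s * z) * (1 - r * s * z)) / (1 + r)\<^sup>2) / (r * (r * s\<^sup>2) / (1 + r)\<^sup>2)"
      unfolding 1 by (simp add: \<zeta>_def h_def power2_eq_square mult_ac)
    also have "\<dots> = (1 + s * z) * (1 - r * s * z) / (r * s\<^sup>2)"
      using nz by (simp add: power2_eq_square)
    finally show ?thesis .
  qed
  have P2: "P2 \<noteq> 0" "N / P2 = r * s\<^sup>2" "P1 / P2 = r" "1 / P2 = r * s\<^sup>2 / N" using nz by (simp_all add: P2_def P1_def)
  have C: "(N * (N - 1) + N * (P1 + P2 - 2 * N + 2)) / (N * P2) = (1 + r - r * s\<^sup>2) + r * s\<^sup>2 / N"
  proof -
    have "(N * (N - 1) + N * (P1 + P2 - 2 * N + 2)) / (N * P2) = N * (P1 + P2 - N + 1) / (N * P2)"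
      by (simp add: algebra_simps)
    also have "\<dots> = P1 / P2 + 1 - N / P2 + 1 / P2"
      using nz P2(1) by (simp add: add_divide_distrib diff_divide_distrib)
    finally show ?thesis unfolding P2 by (simp add: algebra_simps)
  qed
  have B: "((P1 - N + 1) - (P1 + P2 - 2 * N + 2) * \<zeta>) / (h * P2)
      = - ((1 + r - 2 * r * s\<^sup>2) * z + s * (1 - r)) + (s * (1 - r) - 2 * r * s\<^sup>2 * z) / N"
  proof -
    have "((P1 - N + 1) - (P1 + P2 - 2 * N + 2) * \<zeta>) / (h * P2)
       = ((P1 / P2 - N / P2 + 1 / P2) - (P1 / P2 + 1 - 2 * (N / P2) + 2 * (1 / P2)) * \<zeta>) / h"
      using nz P2(1) h by (simp add: add_divide_distrib diff_divide_distrib algebra_simps)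
    also have "\<dots> = ((r - r * s\<^sup>2 + r * s\<^sup>2 / N) * (1 + r) - (r + 1 - 2 * (r * s\<^sup>2) + 2 * (r * s\<^sup>2 / N)) * (r * (1 + s * z))) / (s * r)"
    proof -
      have "(A - B * (C / K)) / (D / K) = (A * K - B * C) / D" if "K \<noteq> 0" for A B C D K :: complex
        using that by (cases "D = 0") (simp_all add: field_simps)
      then show ?thesis
        unfolding P2 \<zeta>_def h_def using nz by blast
    qed
    also have "\<dots> = ((1 - s\<^sup>2 + s\<^sup>2 / N) * (1 + r) - (r + 1 - 2 * (r * s\<^sup>2) + 2 * (r * s\<^sup>2 / N)) * (1 + s * z)) / s"
    proof -
      have "(r - r * s\<^sup>2 + r * s\<^sup>2 / N) * (1 + r) - Y * (r * Z)
          = r * ((1 - s\<^sup>2 + s\<^sup>2 / N) * (1 + r) - Y * Z)" for Y Z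
        by (simp add: algebra_simps)
      then show ?thesis
        by (simp only: mult.commute[of s r] nonzero_mult_divide_mult_cancel_left[OF nz(3)])
    qed
    also have "\<dots> = - ((1 + r - 2 * r * s\<^sup>2) * z + s * (1 - r)) + (s * (1 - r) - 2 * r * s\<^sup>2 * z) / N"
    proof -
      have "(1 - s\<^sup>2 + s\<^sup>2 * M) * (1 + r) - (r + 1 - 2 * (r * s\<^sup>2) + 2 * (r * s\<^sup>2 * M)) * (1 + s * z)
        = s * (- ((1 + r - 2 * r * s\<^sup>2) * z + s * (1 - r)) + (s * (1 - r) - 2 * r * s\<^sup>2 * z) * M)" for M
        by (simp add: algebra_simps power2_eq_square)
      from this[of "1 / N"] show ?thesis using nz by (simp add: times_divide_eq_right mult.assoc)
    qed
    finally show ?thesis .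
  qed
  have "(X * ((N * G / h)\<^sup>2 - N * G2 / h\<^sup>2) + C1 + D * (N * G / h) + C2) / (N * P2)
      = X / h\<^sup>2 * (N / P2) * (G\<^sup>2 - G2 / N) + D / (h * P2) * G + (C1 + C2) / (N * P2)" for X D C1 C2
    using nz(1) P2(1) h by (simp add: divide_simps) (simp add: algebra_simps power2_eq_square)
  then have "(\<zeta> * (1 - \<zeta>) * ((N * G / h)\<^sup>2 - N * G2 / h\<^sup>2) + N * (N - 1) +
      ((P1 - N + 1) - (P1 + P2 - 2 * N + 2) * \<zeta>) * (N * G / h) + N * (P1 + P2 - 2 * N + 2)) / (N * P2)
    = (1 + s * z) * (1 - r * s * z) / (r * s\<^sup>2) * (r * s\<^sup>2) * (G\<^sup>2 - G2 / N) +
      (- ((1 + r - 2 * r * s\<^sup>2) * z + s * (1 - r)) + (s * (1 - r) - 2 * r * s\<^sup>2 * z) / N) * G +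
      ((1 + r - r * s\<^sup>2) + r * s\<^sup>2 / N)"
    by (simp only: A B C P2)
  also have "(1 + s * z) * (1 - r * s * z) / (r * s\<^sup>2) * (r * s\<^sup>2) = (1 + s * z) * (1 - r * s * z)"
    using nz by simp
  also have "Q * (G\<^sup>2 - G2 / N) + (- K + D / N) * G + (c + e / N)
      = Q * G\<^sup>2 - K * G + c + (- Q * G2 + D * G + e) / N" for Q K D c e
    using nz by (simp add: field_simps)
  finally show ?thesis
    by (simp only: mult_minus_left)
qed

definition rescaled :: "nat \<Rightarrow> real \<Rightarrow> real \<Rightarrow> (nat \<Rightarrow> real) \<Rightarrow> nat \<Rightarrow> real" where
  "rescaled n p1 p2 x i = ((p1 + p2) * x i - p1) / sqrt (real n * p1)"

definition resolvent_mean :: "nat \<Rightarrow> (nat \<Rightarrow> real) \<Rightarrow> complex \<Rightarrow> complex" where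
  "resolvent_mean n y z = (\<Sum>i<n. 1 / (z - of_real (y i))) / of_nat n"

definition resolvent_square_mean :: "nat \<Rightarrow> (nat \<Rightarrow> real) \<Rightarrow> complex \<Rightarrow> complex" where
  "resolvent_square_mean n y z = (\<Sum>i<n. (1 / (z - of_real (y i)))\<^sup>2) / of_nat n"

lemma norm_resolvent_le:
  assumes "Im z > 0"
  shows "norm (1 / (z - of_real y)) \<le> 1 / Im z"
  using abs_Im_le_cmod[of "z - of_real y"] assms by (simp add: norm_divide frac_le)

lemma norm_resolvent_mean_le:
  assumes "Im z > 0"
  shows "norm (resolvent_mean n y z) \<le> 1 / Im z"
proof (cases "n = 0")
  case False
  have "norm (\<Sum>i<n. 1 / (z - of_real (y i))) \<le> real n * (1 / Im z)"
    using sum_norm_bound[of "{..<n}" "\<lambda>i. 1 / (z - of_real (y i))" "1 / Im z"] norm_resolvent_le[OF assms] by simp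
  then show ?thesis
    unfolding resolvent_mean_def norm_divide using False by (simp add: field_simps)
qed (use assms in \<open>simp add: resolvent_mean_def\<close>)

lemma norm_resolvent_square_mean_le:
  assumes "Im z > 0"
  shows "norm (resolvent_square_mean n y z) \<le> (1 / Im z)\<^sup>2"
proof (cases "n = 0")
  case False
  have "norm ((1 / (z - of_real t))\<^sup>2) \<le> (1 / Im z)\<^sup>2" for t
    unfolding norm_power using norm_resolvent_le[OF assms] by (intro power_mono) auto
  then have "norm (\<Sum>i<n. (1 / (z - of_real (y i)))\<^sup>2) \<le> real n * (1 / Im z)\<^sup>2"
    using sum_norm_bound[of "{..<n}" "\<lambda>i. (1 / (z - of_real (y i)))\<^sup>2" "(1 / Im z)\<^sup>2"] by simp
  then show ?thesis
    unfolding resolvent_square_mean_def norm_divide using False by (simp add: field_simps)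
qed (simp add: resolvent_square_mean_def)

lemma loop_sum_eq_quadratic:
  fixes x :: "nat \<Rightarrow> real" and z :: complex
  assumes n: "n \<ge> 1" and p: "real n \<le> p1" "real n \<le> p2" and z: "Im z > 0"
  defines "s \<equiv> complex_of_real (sqrt (real n / p1))" and "\<rho> \<equiv> complex_of_real (p1 / p2)"
    and "G \<equiv> resolvent_mean n (rescaled n p1 p2 x) z" and "G2 \<equiv> resolvent_square_mean n (rescaled n p1 p2 x) z"
  shows "2 * (loop_sum n p1 p2 (spectral_point n p1 p2 z) x / of_real (real n * p2))
    = (1 + s * z) * (1 - \<rho> * s * z) * G\<^sup>2 - ((1 + \<rho> - 2 * \<rho> * s\<^sup>2) * z + s * (1 - \<rho>)) * G + (1 + \<rho> - \<rho> * s\<^sup>2)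
      + (- (1 + s * z) * (1 - \<rho> * s * z) * G2 + (s * (1 - \<rho>) - 2 * \<rho> * s\<^sup>2 * z) * G + \<rho> * s\<^sup>2) / of_nat n"
proof -
  let ?\<zeta> = "spectral_point n p1 p2 z" and ?h = "spectral_scale n p1 p2"
  define S where "S = sqrt (real n / p1)"
  define P where "P = p1 / p2"
  have p0: "p1 > 0" "p2 > 0" and n0: "real n > 0" using n p by auto
  have S0: "S > 0" and S2: "S\<^sup>2 = real n / p1" using p0 n0 by (simp_all add: S_def)
  have P0: "P > 0" using p0 by (simp add: P_def)
  have p1': "p1 = real n / S\<^sup>2" unfolding S2 using n0 p0 by simp
  have p2': "p2 = real n / (P * S\<^sup>2)" unfolding S2 P_def using n0 p0 by simp
  have P1: "P / (1 + P) = p1 / (p1 + p2)" unfolding P_def using p0 by (simp add: field_simps)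
  have sqrt_eq: "sqrt (real n * p1) = p1 * S"
  proof -
    have "real n * p1 = (p1 * S)\<^sup>2" unfolding power_mult_distrib S2 using p0 by (simp add: power2_eq_square)
    then show ?thesis using p0 S0 by simp
  qed
  have h: "?h = S * P / (1 + P)"
  proof -
    have "?h = S * (p1 / (p1 + p2))" by (simp add: spectral_scale_def sqrt_eq)
    then show ?thesis unfolding P1[symmetric] by simp
  qed
  have h0: "?h > 0" unfolding h using S0 P0 by simp
  have \<zeta>: "?\<zeta> = of_real P * (1 + of_real S * z) / (1 + of_real P)"
  proof -
    have "?\<zeta> = of_real (P / (1 + P)) + of_real (S * P / (1 + P)) * z"
      unfolding spectral_point_def h P1[symmetric] ..
    also have "\<dots> = of_real P * (1 + of_real S * z) / (1 + of_real P)"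
      by (simp add: add_divide_distrib[symmetric] algebra_simps)
    finally show ?thesis .
  qed
  have res: "1 / (?\<zeta> - of_real t) = 1 / of_real ?h * (1 / (z - of_real (((p1 + p2) * t - p1) / sqrt (real n * p1))))" for t
  proof -
    have "?h * (((p1 + p2) * t - p1) / sqrt (real n * p1)) = t - p1 / (p1 + p2)"
    proof -
      have "sqrt (real n * p1) \<noteq> 0" using p0 n0 by simp
      then have "?h * (((p1 + p2) * t - p1) / sqrt (real n * p1)) = ((p1 + p2) * t - p1) / (p1 + p2)"
        unfolding spectral_scale_def by simp
      also have "\<dots> = t - p1 / (p1 + p2)"
        using p0 by (simp add: diff_divide_distrib)
      finally show ?thesis .
    qed
    then have "of_real ?h * (z - of_real (((p1 + p2) * t - p1) / sqrt (real n * p1))) = of_real ?h * z - of_real (t - p1 / (p1 + p2))"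
      by (simp only: right_diff_distrib of_real_mult[symmetric])
    then have "?\<zeta> - of_real t = of_real ?h * (z - of_real (((p1 + p2) * t - p1) / sqrt (real n * p1)))"
      unfolding spectral_point_def by simp
    then show ?thesis by simp
  qed
  have S1: "(\<Sum>i<n. 1 / (?\<zeta> - of_real (x i))) = of_nat n * G / of_real ?h"
    unfolding res G_def resolvent_mean_def rescaled_def sum_distrib_left[symmetric] using n by simp
  have S2': "(\<Sum>i<n. (1 / (?\<zeta> - of_real (x i)))\<^sup>2) = of_nat n * G2 / (of_real ?h)\<^sup>2"
    unfolding res power_mult_distrib G2_def resolvent_square_mean_def rescaled_def sum_distrib_left[symmetric]
    using n by (simp add: power_divide)
  have Im: "Im ?\<zeta> \<noteq> 0"
    using h0 z by (simp add: spectral_point_def)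
  have ne: "of_nat n \<noteq> (0::complex)" "complex_of_real S \<noteq> 0" "complex_of_real P \<noteq> 0" "1 + complex_of_real P \<noteq> 0"
  proof -
    have "1 + complex_of_real P = of_real (1 + P)" by simp
    then show "1 + complex_of_real P \<noteq> 0" using P0 by (simp only: of_real_eq_0_iff)
  qed (use n S0 P0 in auto)
  have c1: "complex_of_real p1 = of_nat n / (of_real S)\<^sup>2" unfolding p1' by simp
  have c2: "complex_of_real p2 = of_nat n / (of_real P * (of_real S)\<^sup>2)" unfolding p2' by simp
  have ch: "complex_of_real ?h = of_real S * of_real P / (1 + of_real P)" unfolding h by simp
  have "2 * (loop_sum n p1 p2 ?\<zeta> x / of_real (real n * p2))
      = 2 * loop_sum n p1 p2 ?\<zeta> x / (of_nat n * of_real p2)" by simp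
  also have "\<dots> = (?\<zeta> * (1 - ?\<zeta>) * ((of_nat n * G / of_real ?h)\<^sup>2 - of_nat n * G2 / (of_real ?h)\<^sup>2) + of_nat n * (of_nat n - 1) +
      ((of_real p1 - of_nat n + 1) - (of_real p1 + of_real p2 - 2 * of_nat n + 2) * ?\<zeta>) * (of_nat n * G / of_real ?h) +
      of_nat n * (of_real p1 + of_real p2 - 2 * of_nat n + 2)) / (of_nat n * of_real p2)"
    unfolding loop_sum_resolvent[OF Im] S1 S2' ..
  also have "\<dots> = (1 + of_real S * z) * (1 - of_real P * of_real S * z) * G\<^sup>2 -
      ((1 + of_real P - 2 * of_real P * (of_real S)\<^sup>2) * z + of_real S * (1 - of_real P)) * G + (1 + of_real P - of_real P * (of_real S)\<^sup>2)
      + (- (1 + of_real S * z) * (1 - of_real P * of_real S * z) * G2 +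
         (of_real S * (1 - of_real P) - 2 * of_real P * (of_real S)\<^sup>2 * z) * G + of_real P * (of_real S)\<^sup>2) / of_nat n"
    unfolding \<zeta> ch c1 c2 by (rule loop_equation_rescaling[OF ne])
  finally show ?thesis
    unfolding s_def \<rho>_def S_def P_def .
qed

text \<open>
  Each term is \<open>(1 - c Y) / (z - Y)\<close> up to a real constant, and \<open>1 - c Y\<close> is a positive multiple of
  \<open>1 - x\<close>.
\<close>
lemma resolvent_mean_right_edge:
  assumes n: "n \<ge> 1" and p: "p1 > 0" "p2 > 0" and z: "Im z > 0" and x: "\<And>i. i < n \<Longrightarrow> x i \<le> 1"
  shows "Im ((1 - of_real (p1 / p2) * of_real (sqrt (real n / p1)) * z) * resolvent_mean n (rescaled n p1 p2 x) z) \<le> 0"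
proof -
  define c where "c = p1 / p2 * sqrt (real n / p1)"
  define y where "y = rescaled n p1 p2 x"
  have y: "1 - c * y i \<ge> 0" if "i < n" for i
  proof -
    have "sqrt (real n / p1) / sqrt (real n * p1) = 1 / p1"
    proof -
      have "sqrt (real n * p1) = sqrt (real n / p1) * p1"
      proof -
        have "real n * p1 = (real n / p1) * p1\<^sup>2" using p by (simp add: power2_eq_square)
        then show ?thesis using p by (simp only: real_sqrt_mult real_sqrt_abs abs_of_pos)
      qed
      then show ?thesis using p n by simp
    qed
    then have "c * y i = p1 / p2 * ((p1 + p2) * x i - p1) * (1 / p1)"
      unfolding c_def y_def rescaled_def by (metis (no_types, opaque_lifting) mult.assoc mult.commute times_divide_eq_right)
    also have "\<dots> = ((p1 + p2) * x i - p1) / p2"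
      using p by simp
    finally have "1 - c * y i = (p1 + p2) * (1 - x i) / p2"
      using p by (simp add: field_simps)
    then show ?thesis using x[OF that] p by simp
  qed
  have site: "Im ((1 - of_real c * z) * (1 / (z - of_real (y i)))) \<le> 0" if "i < n" for i
  proof -
    have nz: "z - of_real (y i) \<noteq> 0" using z by (auto simp: complex_eq_iff)
    have "(1 - of_real c * z) * (1 / (z - of_real (y i))) = of_real (1 - c * y i) * (1 / (z - of_real (y i))) - of_real c"
      using nz by (simp add: field_simps)
    moreover have "Im (1 / (z - of_real (y i))) \<le> 0"
      using z by (simp add: Im_divide divide_nonpos_nonneg)
    moreover have "Im (of_real a * W - of_real c) = a * Im W" for a W
      by simp
    ultimately show ?thesis
      using y[OF that] by (simp only: mult_nonneg_nonpos)
  qed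
  have "(1 - of_real c * z) * resolvent_mean n y z = (\<Sum>i<n. (1 - of_real c * z) * (1 / (z - of_real (y i)))) / of_nat n"
    unfolding resolvent_mean_def by (simp only: sum_distrib_left times_divide_eq_right)
  then have "Im ((1 - of_real c * z) * resolvent_mean n y z) = (\<Sum>i<n. Im ((1 - of_real c * z) * (1 / (z - of_real (y i))))) / real n"
    by (simp only: Im_divide_of_nat Im_sum)
  also have "\<dots> \<le> 0"
    by (intro divide_nonpos_nonneg sum_nonpos site) auto
  finally show ?thesis
    unfolding c_def y_def by simp
qed

section \<open>Chebyshev kernels and the Joukowski map\<close>

definition chebyshev_kernel :: "'a \<Rightarrow> real \<Rightarrow> 'a::{real_normed_field}" where
  "chebyshev_kernel w t = 1 - 2 * w * of_real (cos t) + w\<^sup>2"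

lemma norm_chebyshev_kernel_ge:
  fixes w :: complex
  assumes "norm w \<le> 1"
  shows "(1 - norm w)\<^sup>2 \<le> norm (chebyshev_kernel w t)"
proof -
  have fac: "chebyshev_kernel w t = (1 - w * cis t) * (1 - w * cis (- t))"
  proof -
    have "cis t + cis (- t) = 2 * of_real (cos t)" "cis t * cis (- t) = 1"
      by (simp_all add: complex_eq_iff cis_mult)
    moreover have "(1 - w * a) * (1 - w * b) = 1 - w * (a + b) + w\<^sup>2 * (a * b)" for a b
      by (simp add: algebra_simps power2_eq_square)
    ultimately show ?thesis
      by (simp only: chebyshev_kernel_def mult_1_right mult.left_commute[of w] mult.assoc)
  qed
  have "1 - norm w \<le> norm (1 - w * cis s)" for s
    using norm_triangle_ineq2[of 1 "w * cis s"] by (simp add: norm_mult)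
  then have "(1 - norm w) * (1 - norm w) \<le> norm (1 - w * cis t) * norm (1 - w * cis (- t))"
    using assms by (intro mult_mono) auto
  then show ?thesis by (simp add: fac norm_mult power2_eq_square)
qed

lemma chebyshev_kernel_nonzero: "norm w < 1 \<Longrightarrow> chebyshev_kernel (w :: complex) t \<noteq> 0"
  using norm_chebyshev_kernel_ge[of w t] by fastforce

lemma has_integral_sin_square: "((\<lambda>t. (sin t)\<^sup>2) has_integral pi / 2) {-pi..0}"
proof -
  have "((\<lambda>t. (sin t)\<^sup>2) has_integral (0 - sin 0 * cos 0) / 2 - (- pi - sin (- pi) * cos (- pi)) / 2) {-pi..0}"
  proof (rule fundamental_theorem_of_calculus)
    fix t :: real
    have "((\<lambda>t. (t - sin t * cos t) / 2) has_real_derivative (1 - (cos t * cos t - sin t * sin t)) / 2) (at t within {-pi..0})"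
      by (auto intro!: derivative_eq_intros)
    moreover have "(1 - (cos t * cos t - sin t * sin t)) / 2 = (sin t)\<^sup>2"
      using sin_cos_squared_add[of t] by (simp add: power2_eq_square)
    ultimately show "((\<lambda>t. (t - sin t * cos t) / 2) has_vector_derivative (sin t)\<^sup>2) (at t within {-pi..0})"
      by (simp add: has_real_derivative_iff_has_vector_derivative)
  qed simp
  then show ?thesis by simp
qed

lemma has_integral_sin_sin:
  assumes "k > 0"
  shows "((\<lambda>t. sin t * sin (real (Suc k) * t)) has_integral 0) {-pi..0}"
proof -
  have k: "real k \<noteq> 0" using assms by simp
  let ?F = "\<lambda>t. (sin (real k * t) / real k - sin (real (k + 2) * t) / real (k + 2)) / 2"
  have "((\<lambda>t. sin t * sin (real (Suc k) * t)) has_integral ?F 0 - ?F (- pi)) {-pi..0}"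
  proof (rule fundamental_theorem_of_calculus)
    fix t :: real
    have "(?F has_real_derivative (cos (real k * t) - cos (real (k + 2) * t)) / 2) (at t within {-pi..0})"
      using k by (auto intro!: derivative_eq_intros)
    moreover have "(cos (real k * t) - cos (real (k + 2) * t)) / 2 = sin t * sin (real (Suc k) * t)"
    proof -
      have "real k * t = real (Suc k) * t - t" "real (k + 2) * t = real (Suc k) * t + t"
        by (simp_all add: algebra_simps)
      then show ?thesis by (simp only: cos_add cos_diff) simp
    qed
    ultimately show "(?F has_vector_derivative sin t * sin (real (Suc k) * t)) (at t within {-pi..0})"
      by (simp add: has_real_derivative_iff_has_vector_derivative)
  qed simp
  moreover have "sin (- (real k * pi)) = 0" "sin (- (real (k + 2) * pi)) = 0"
    by (simp_all only: sin_minus sin_npi minus_zero)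
  ultimately show ?thesis
    by (simp del: of_nat_add of_nat_Suc)
qed

text \<open>
  Partial sums of \<open>\<Sum> w\<^sup>k sin ((k + 1) t) = sin t / (1 - 2 w cos t + w\<^sup>2)\<close>, the generating function
  of the Chebyshev polynomials of the second kind.
\<close>
lemma chebyshev_partial_sum:
  fixes w :: complex
  shows "chebyshev_kernel w t * (\<Sum>k<N. w ^ k * of_real (sin (real (Suc k) * t)))
    = of_real (sin t) - w ^ N * of_real (sin (real (Suc N) * t)) + w ^ Suc N * of_real (sin (real N * t))"
proof (induction N)
  case (Suc N)
  have trig: "sin (real (Suc (Suc N)) * t) = 2 * cos t * sin (real (Suc N) * t) - sin (real N * t)"
  proof -
    have "real (Suc (Suc N)) * t = real (Suc N) * t + t" "real N * t = real (Suc N) * t - t"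
      by (simp_all add: algebra_simps)
    then show ?thesis by (simp only: sin_add sin_diff) simp
  qed
  show ?case
    unfolding sum.lessThan_Suc distrib_left Suc.IH trig of_real_diff of_real_mult
    by (simp add: chebyshev_kernel_def algebra_simps power2_eq_square)
qed (simp add: chebyshev_kernel_def)

text \<open>
  By orthogonality of the sines only the first term of the expansion contributes, which is why the
  value does not depend on \<open>w\<close>.
\<close>
lemma has_integral_chebyshev_kernel:
  fixes w :: complex
  assumes w: "norm w < 1"
  shows "((\<lambda>t. of_real ((sin t)\<^sup>2) / chebyshev_kernel w t) has_integral of_real (pi / 2)) {-pi..0}"
proof -
  let ?f = "\<lambda>t. of_real ((sin t)\<^sup>2) / chebyshev_kernel w t"
  have nz: "chebyshev_kernel w t \<noteq> 0" for t using w by (rule chebyshev_kernel_nonzero)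
  have cont: "continuous_on A (chebyshev_kernel w)" for A
    unfolding chebyshev_kernel_def by (intro continuous_intros)
  define S where "S N t = (\<Sum>k<N. w ^ k * of_real (sin t * sin (real (Suc k) * t)))" for N t
  \<comment> \<open>Remainder after \<open>N\<close> terms of the expansion of the integrand in sines.\<close>
  define E where "E N t = of_real (sin t) * (w ^ N * of_real (sin (real (Suc N) * t)) -
      w ^ Suc N * of_real (sin (real N * t))) / chebyshev_kernel w t" for N t
  have f_eq: "?f t = S N t + E N t" for N t
  proof -
    have "S N t = of_real (sin t) * (\<Sum>k<N. w ^ k * of_real (sin (real (Suc k) * t)))"
      by (simp add: S_def sum_distrib_left mult_ac)
    moreover define A where "A = w ^ N * of_real (sin (real (Suc N) * t))"
    moreover define B where "B = w ^ Suc N * of_real (sin (real N * t))"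
    moreover have "(\<Sum>k<N. w ^ k * of_real (sin (real (Suc k) * t))) = (of_real (sin t) - A + B) / chebyshev_kernel w t"
      using chebyshev_partial_sum[of w t N] nz[of t] unfolding A_def B_def
      by (simp only: nonzero_eq_divide_eq mult.commute not_False_eq_True)
    moreover have "x * ((x - A + B) / K) + x * (A - B) / K = x\<^sup>2 / K" for x A B K :: complex
      by (cases "K = 0") (simp_all add: field_simps power2_eq_square)
    ultimately show ?thesis
      by (simp only: E_def of_real_power)
  qed
  have S_int: "(S N has_integral of_real (pi / 2)) {-pi..0}" if "N > 0" for N
  proof -
    have "((\<lambda>t. w ^ k * of_real (sin t * sin (real (Suc k) * t))) has_integral
        w ^ k * of_real (if k = 0 then pi / 2 else 0)) {-pi..0}" for k
    proof (intro has_integral_mult_right has_integral_of_real)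
      show "((\<lambda>t. sin t * sin (real (Suc k) * t)) has_integral (if k = 0 then pi / 2 else 0)) {-pi..0}"
        using has_integral_sin_square has_integral_sin_sin[of k]
        by (cases "k = 0") (auto simp: power2_eq_square)
    qed
    then have "(S N has_integral (\<Sum>k<N. w ^ k * of_real (if k = 0 then pi / 2 else 0))) {-pi..0}"
      unfolding S_def by (intro has_integral_sum) auto
    moreover have "(\<Sum>k<N. w ^ k * of_real (if k = 0 then pi / 2 else 0)) = (of_real (pi / 2) :: complex)"
      using that by (subst sum.remove[of _ 0]) auto
    ultimately show ?thesis by simp
  qed
  have f_int: "?f integrable_on {-pi..0}"
    by (intro integrable_continuous_interval continuous_intros cont) (use nz in auto)
  have "norm (integral {-pi..0} ?f - of_real (pi / 2)) \<le> 2 * norm w ^ N / (1 - norm w)\<^sup>2 * pi"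
    if N: "N > 0" for N
  proof -
    have E_int: "(E N has_integral (integral {-pi..0} ?f - of_real (pi / 2))) {-pi..0}"
    proof -
      have "E N = (\<lambda>t. ?f t - S N t)" using f_eq[of _ N] by (simp add: fun_eq_iff)
      then show ?thesis
        using has_integral_diff[OF integrable_integral[OF f_int] S_int[OF N]] by simp
    qed
    have "norm (E N t) \<le> 2 * norm w ^ N / (1 - norm w)\<^sup>2" for t
    proof -
      have "norm (w ^ N * of_real (sin (real (Suc N) * t)) - w ^ Suc N * of_real (sin (real N * t)))
          \<le> norm w ^ N * 1 + norm w ^ Suc N * 1"
      proof (rule order.trans[OF norm_triangle_ineq4 add_mono])
        show "norm (w ^ N * of_real (sin (real (Suc N) * t))) \<le> norm w ^ N * 1"
          unfolding norm_mult norm_power norm_of_real by (intro mult_left_mono) auto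
        show "norm (w ^ Suc N * of_real (sin (real N * t))) \<le> norm w ^ Suc N * 1"
          unfolding norm_mult norm_power norm_of_real by (intro mult_left_mono) auto
      qed
      also have "\<dots> \<le> 2 * norm w ^ N"
        using w by (simp add: mult_left_le_one_le)
      finally have "norm (of_real (sin t) * (w ^ N * of_real (sin (real (Suc N) * t)) - w ^ Suc N * of_real (sin (real N * t))))
          \<le> 1 * (2 * norm w ^ N)"
        unfolding norm_mult[of "of_real (sin t)"] norm_of_real by (intro mult_mono) auto
      then show ?thesis
        unfolding E_def norm_divide using norm_chebyshev_kernel_ge[of w t] w
        by (intro frac_le) auto
    qed
    then have "norm (integral {-pi..0} ?f - of_real (pi / 2)) \<le> 2 * norm w ^ N / (1 - norm w)\<^sup>2 * measure lborel {-pi..0}"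
      by (intro has_integral_bound[where f = "E N" and a = "-pi" and b = 0, unfolded cbox_interval, OF _ E_int]) auto
    then show ?thesis by simp
  qed
  then have "\<forall>\<^sub>F N in sequentially. norm (integral {-pi..0} ?f - of_real (pi / 2)) \<le> 2 * norm w ^ N / (1 - norm w)\<^sup>2 * pi"
    using eventually_gt_at_top[of 0] by (rule eventually_mono[rotated]) auto
  moreover have "(\<lambda>N. 2 * norm w ^ N / (1 - norm w)\<^sup>2 * pi) \<longlonglongrightarrow> 2 * 0 / (1 - norm w)\<^sup>2 * pi"
    using w by (intro tendsto_intros LIMSEQ_power_zero) auto
  ultimately have "norm (integral {-pi..0} ?f - of_real (pi / 2)) \<le> 0"
    using tendsto_lowerbound by fastforce
  then have "integral {-pi..0} ?f = of_real (pi / 2)" by simp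
  then show ?thesis
    using integrable_integral[OF f_int] by (simp only:)
qed

text \<open>
  This boundary value is needed when \<open>\<gamma> = 1\<close>, where the limit density is unbounded at its left edge.
\<close>
lemma has_integral_chebyshev_kernel_minus_1:
  "((\<lambda>t. of_real ((sin t)\<^sup>2) / chebyshev_kernel (-1) t) has_integral (of_real (pi / 2) :: complex)) {-pi..0}"
proof -
  have "((\<lambda>t. (1 - cos t) / 2) has_integral (0 - sin 0) / 2 - (- pi - sin (- pi)) / 2) {-pi..0}"
  proof (rule fundamental_theorem_of_calculus)
    fix t :: real
    have "((\<lambda>t. (t - sin t) / 2) has_real_derivative (1 - cos t) / 2) (at t within {-pi..0})"
      by (auto intro!: derivative_eq_intros)
    then show "((\<lambda>t. (t - sin t) / 2) has_vector_derivative (1 - cos t) / 2) (at t within {-pi..0})"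
      by (simp add: has_real_derivative_iff_has_vector_derivative)
  qed simp
  then have "((\<lambda>t. of_real ((1 - cos t) / 2)) has_integral (of_real (pi / 2) :: complex)) {-pi..0}"
    by (intro has_integral_of_real) simp
  moreover have "of_real ((1 - cos t) / 2) = of_real ((sin t)\<^sup>2) / (chebyshev_kernel (-1) t :: complex)"
    if "t \<in> {-pi..0} - {-pi}" for t
  proof -
    have "cos t \<noteq> -1"
    proof
      assume "cos t = -1"
      then have "cos (- t) = cos pi" by simp
      then have "- t = pi" using that cos_inj_pi[of "- t" pi] by auto
      with that show False by auto
    qed
    then have c: "1 + cos t \<noteq> 0" by linarith
    have "chebyshev_kernel (-1) t = (of_real (2 * (1 + cos t)) :: complex)"
      by (simp add: chebyshev_kernel_def)
    then have "of_real ((sin t)\<^sup>2) / (chebyshev_kernel (-1) t :: complex) = of_real ((sin t)\<^sup>2 / (2 * (1 + cos t)))"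
      by simp
    also have "(sin t)\<^sup>2 / (2 * (1 + cos t)) = (1 - cos t) / 2"
      unfolding sin_squared_eq using c by (simp add: field_simps power2_eq_square)
    finally show ?thesis by simp
  qed
  ultimately show ?thesis
    using has_integral_spike_finite[of "{-pi}" "{-pi..0}"
        "\<lambda>t. of_real ((sin t)\<^sup>2) / (chebyshev_kernel (-1) t :: complex)"
        "\<lambda>t. of_real ((1 - cos t) / 2)"] by simp
qed

lemma chebyshev_kernel_combination:
  fixes u v :: complex
  shows "v * chebyshev_kernel u t - u * chebyshev_kernel v t = (v - u) * (1 - u * v)"
proof -
  have "v * (1 - 2 * u * c + u\<^sup>2) - u * (1 - 2 * v * c + v\<^sup>2) = (v - u) * (1 - u * v)" for c
    by algebra
  then show ?thesis
    unfolding chebyshev_kernel_def .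
qed

text \<open>
  The parameters that occur: the two edges \<open>- b\<close> and \<open>\<sigma> b\<close> of the limit law, of which only the
  first can reach the unit circle, and the Joukowski variable of a nonreal point.
\<close>
definition kernel_parameter :: "complex \<Rightarrow> bool" where
  "kernel_parameter w \<longleftrightarrow> norm w < 1 \<or> w = -1"

lemma has_integral_inverse_chebyshev_kernel:
  assumes "kernel_parameter w"
  shows "((\<lambda>t. of_real ((sin t)\<^sup>2) / chebyshev_kernel w t) has_integral of_real (pi / 2)) {-pi..0}"
  using assms has_integral_chebyshev_kernel has_integral_chebyshev_kernel_minus_1
  unfolding kernel_parameter_def by blast

lemma kernel_parameter_kernel_nonzero:
  assumes "kernel_parameter w" "sin t \<noteq> 0"
  shows "chebyshev_kernel w t \<noteq> 0"
proof (cases "norm w < 1")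
  case False
  then have w: "w = -1" using assms(1) by (simp add: kernel_parameter_def)
  have "1 + cos t \<noteq> 0"
  proof
    assume "1 + cos t = 0"
    then have "(cos t)\<^sup>2 = 1" by (simp add: add_eq_0_iff)
    then show False using sin_cos_squared_add[of t] assms(2) by simp
  qed
  moreover have "chebyshev_kernel w t = (of_real (2 * (1 + cos t)) :: complex)"
    by (simp add: w chebyshev_kernel_def)
  ultimately show ?thesis
    by (simp only: of_real_eq_0_iff mult_eq_0_iff) simp
qed (rule chebyshev_kernel_nonzero)

lemma kernel_parameters_mult:
  assumes "kernel_parameter u" "kernel_parameter v" "u \<noteq> v"
  shows "1 - u * v \<noteq> 0"
proof
  assume "1 - u * v = 0"
  then have uv: "norm u * norm v = 1" by (metis eq_iff_diff_eq_0 norm_mult norm_one)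
  have le: "norm u \<le> 1" "norm v \<le> 1" using assms by (auto simp: kernel_parameter_def)
  have "norm u * norm v \<le> norm u" "norm u * norm v \<le> norm v"
    using le by (auto intro: mult_right_le_one_le mult_left_le_one_le)
  then have "u = -1" "v = -1"
    using uv assms by (auto simp: kernel_parameter_def)
  then show False using assms(3) by simp
qed

lemma inverse_chebyshev_kernels_partial_fractions:
  assumes "kernel_parameter u" "kernel_parameter v" "u \<noteq> v"
  shows "of_real ((sin t)\<^sup>2) / (chebyshev_kernel u t * chebyshev_kernel v t)
    = (v * (of_real ((sin t)\<^sup>2) / chebyshev_kernel v t) - u * (of_real ((sin t)\<^sup>2) / chebyshev_kernel u t)) /
      ((v - u) * (1 - u * v))"
proof (cases "sin t = 0")
  case False
  have nz: "chebyshev_kernel u t \<noteq> 0" "chebyshev_kernel v t \<noteq> 0" "(v - u) * (1 - u * v) \<noteq> 0"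
    using kernel_parameter_kernel_nonzero[OF _ False] assms kernel_parameters_mult by auto
  have "v * (s / V) - u * (s / U) = s * (v * U - u * V) / (U * V)" if "U \<noteq> 0" "V \<noteq> 0" for s U V
    using that by (simp add: field_simps)
  from this[OF nz(1,2)] show ?thesis
    unfolding chebyshev_kernel_combination using nz by simp
qed simp

lemma has_integral_inverse_chebyshev_kernel_2:
  assumes "kernel_parameter u" "kernel_parameter v" "u \<noteq> v"
  shows "((\<lambda>t. of_real ((sin t)\<^sup>2) / (chebyshev_kernel u t * chebyshev_kernel v t))
    has_integral of_real (pi / 2) / (1 - u * v)) {-pi..0}"
proof -
  have "((\<lambda>t. (v * (of_real ((sin t)\<^sup>2) / chebyshev_kernel v t) - u * (of_real ((sin t)\<^sup>2) / chebyshev_kernel u t)) /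
      ((v - u) * (1 - u * v))) has_integral
      (v * of_real (pi / 2) - u * of_real (pi / 2)) / ((v - u) * (1 - u * v))) {-pi..0}"
    using assms
    by (intro has_integral_divide has_integral_diff has_integral_mult_right has_integral_inverse_chebyshev_kernel)
  moreover have "(v * of_real (pi / 2) - u * of_real (pi / 2)) / ((v - u) * (1 - u * v))
      = of_real (pi / 2) / (1 - u * v)"
    using assms(3) by (simp only: left_diff_distrib[symmetric]) simp
  ultimately show ?thesis
    by (simp only: inverse_chebyshev_kernels_partial_fractions[OF assms])
qed

lemma has_integral_inverse_chebyshev_kernel_3:
  assumes "kernel_parameter u" "kernel_parameter v" "kernel_parameter w" "u \<noteq> v" "u \<noteq> w" "v \<noteq> w"
  shows "((\<lambda>t. of_real ((sin t)\<^sup>2) / (chebyshev_kernel u t * chebyshev_kernel v t * chebyshev_kernel w t))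
    has_integral of_real (pi / 2) / ((1 - u * v) * (1 - u * w) * (1 - v * w))) {-pi..0}"
proof -
  have nz: "1 - u * v \<noteq> 0" "1 - u * w \<noteq> 0" "1 - v * w \<noteq> 0"
    using kernel_parameters_mult[OF assms(1,2,4)] kernel_parameters_mult[OF assms(1,3,5)]
      kernel_parameters_mult[OF assms(2,3,6)] by auto
  have "((\<lambda>t. (v * (of_real ((sin t)\<^sup>2) / (chebyshev_kernel v t * chebyshev_kernel w t)) -
        u * (of_real ((sin t)\<^sup>2) / (chebyshev_kernel u t * chebyshev_kernel w t))) /
      ((v - u) * (1 - u * v))) has_integral
      (v * (of_real (pi / 2) / (1 - v * w)) - u * (of_real (pi / 2) / (1 - u * w))) / ((v - u) * (1 - u * v))) {-pi..0}"
    using assms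
    by (intro has_integral_divide has_integral_diff has_integral_mult_right has_integral_inverse_chebyshev_kernel_2)
  moreover have "(v * (P / (1 - v * w)) - u * (P / (1 - u * w))) / ((v - u) * (1 - u * v))
      = P / ((1 - u * v) * (1 - u * w) * (1 - v * w))" for P
  proof -
    have "v * (P / (1 - v * w)) - u * (P / (1 - u * w)) = P * (v - u) / ((1 - u * w) * (1 - v * w))"
      using nz by (simp add: divide_simps) (simp add: algebra_simps)
    then show ?thesis using nz assms(4) by simp
  qed
  moreover have "of_real ((sin t)\<^sup>2) / (chebyshev_kernel u t * chebyshev_kernel v t * chebyshev_kernel w t)
      = (v * (of_real ((sin t)\<^sup>2) / (chebyshev_kernel v t * chebyshev_kernel w t)) -
        u * (of_real ((sin t)\<^sup>2) / (chebyshev_kernel u t * chebyshev_kernel w t))) /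
      ((v - u) * (1 - u * v))" for t
  proof -
    have "of_real ((sin t)\<^sup>2) / (chebyshev_kernel u t * chebyshev_kernel v t * chebyshev_kernel w t)
        = of_real ((sin t)\<^sup>2) / (chebyshev_kernel u t * chebyshev_kernel v t) / chebyshev_kernel w t"
      by simp
    then show ?thesis
      unfolding inverse_chebyshev_kernels_partial_fractions[OF assms(1,2,4)]
      by (simp add: diff_divide_distrib mult_ac)
  qed
  ultimately show ?thesis
    by (simp only:)
qed

text \<open>
  The two roots of \<open>w\<^sup>2 - Z w + 1 = 0\<close> are inverse to each other, and they cannot lie on the unit
  circle because \<open>Z\<close> is not real.
\<close>
lemma joukowski_preimage:
  assumes "Im Z > 0"
  obtains w where "norm w < 1" "Im w < 0" "Z = w + 1 / w"
proof -
  define d where "d = csqrt (Z\<^sup>2 - 4)"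
  have d: "d\<^sup>2 = Z\<^sup>2 - 4" by (simp add: d_def)
  define w1 where "w1 = (Z - d) / 2"
  define w2 where "w2 = (Z + d) / 2"
  have prod: "w1 * w2 = 1" and sum: "w1 + w2 = Z"
    using d by (simp_all add: w1_def w2_def field_simps power2_eq_square)
  have key: "norm w < 1 \<and> Im w < 0" if w: "Z = w + 1 / w" "w \<noteq> 0" "norm w \<le> 1" for w
  proof -
    have inv: "1 / w = cnj w / of_real ((norm w)\<^sup>2)"
      unfolding complex_norm_square using w(2) by simp
    have Im: "Im Z = Im w * (1 - 1 / (norm w)\<^sup>2)"
      unfolding w(1) inv using w(2) by (simp add: algebra_simps)
    have "(norm w)\<^sup>2 \<le> 1" using w(3) by (simp add: power_le_one)
    moreover have "(norm w)\<^sup>2 \<noteq> 1" using Im assms by auto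
    ultimately have lt: "(norm w)\<^sup>2 < 1" by simp
    then have "1 - 1 / (norm w)\<^sup>2 < 0" using w(2) by (simp add: field_simps)
    then have "Im w < 0" using Im assms by (metis mult_less_0_iff not_less_iff_gr_or_eq zero_less_mult_iff)
    moreover have "norm w < 1" using lt by (simp add: power_less_one_iff abs_square_less_1)
    ultimately show ?thesis by simp
  qed
  have nz: "w1 \<noteq> 0" "w2 \<noteq> 0" using prod by auto
  then have "1 / w1 = w2" "1 / w2 = w1"
    using prod by (simp_all add: divide_eq_eq mult.commute)
  then have "Z = w1 + 1 / w1" "Z = w2 + 1 / w2"
    using sum by (simp_all add: add.commute)
  moreover have "norm w1 \<le> 1 \<or> norm w2 \<le> 1"
  proof (rule ccontr)
    assume "\<not> ?thesis"
    then have "1 < norm w1 * norm w2" by (simp add: less_1_mult)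
    then show False using prod by (simp add: norm_mult[symmetric])
  qed
  ultimately show ?thesis
    using key[of w1] key[of w2] nz that by blast
qed

section \<open>The limit law and its Stieltjes transform\<close>

locale jacobi_limit =
  fixes \<gamma> \<sigma> :: real
  assumes \<gamma>: "0 \<le> \<gamma>" "\<gamma> \<le> 1" and \<sigma>: "0 \<le> \<sigma>" and \<sigma>\<gamma>: "\<sigma> * \<gamma> < 1"
begin

text \<open>
  The support of the limit law is \<open>[m - r, m + r]\<close>, and \<open>A\<close>, \<open>b\<close> are chosen such that
  \<open>1 + \<surd>\<gamma> x = norm (A (1 + b e\<^sup>i\<^sup>t))\<^sup>2\<close> and \<open>1 - \<sigma> \<surd>\<gamma> x = norm (A (1 - \<sigma> b e\<^sup>i\<^sup>t))\<^sup>2\<close> for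
  \<open>x = m + r cos t\<close>. The numbers \<open>A\<close> and \<open>A b\<close> are the two square roots in the end points of the
  Wachter law.
\<close>
definition A :: real where "A = sqrt ((1 + \<sigma> - \<sigma> * \<gamma>) / (1 + \<sigma>))"
definition b :: real where "b = sqrt (\<gamma> / (1 + \<sigma>)) / A"
definition r :: real where "r = 2 * A / sqrt (1 + \<sigma>)"
definition m :: real where "m = sqrt \<gamma> * (1 - \<sigma>) / (1 + \<sigma>)"

text \<open>
  Limit of the product \<open>x (1 - x)\<close> as a function of the rescaled point, up to a constant factor.
\<close>
definition edge_factor :: "'a \<Rightarrow> 'a::real_normed_field" where
  "edge_factor z = (1 + of_real (sqrt \<gamma>) * z) * (1 - of_real (\<sigma> * sqrt \<gamma>) * z)"

lemma A_pos: "A > 0"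
  unfolding A_def using \<sigma> \<sigma>\<gamma> by (intro real_sqrt_gt_zero divide_pos_pos) auto

lemma A_square: "A\<^sup>2 = (1 + \<sigma> - \<sigma> * \<gamma>) / (1 + \<sigma>)"
  unfolding A_def using \<sigma> \<sigma>\<gamma> by (intro real_sqrt_pow2 divide_nonneg_pos) auto

lemma A_b: "A * b = sqrt (\<gamma> / (1 + \<sigma>))"
  using A_pos by (simp add: b_def)

lemma A_b_square: "A\<^sup>2 * b\<^sup>2 = \<gamma> / (1 + \<sigma>)"
  using A_b \<gamma> \<sigma> by (metis power_mult_distrib real_sqrt_pow2 add_nonneg_nonneg divide_nonneg_nonneg zero_le_one)

lemma r_pos: "r > 0"
  unfolding r_def using A_pos \<sigma> by simp

lemma r_square: "r\<^sup>2 * (1 + \<sigma>) = 4 * A\<^sup>2"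
  unfolding r_def using \<sigma> by (simp add: power_divide power_mult_distrib)

lemma sqrt_\<gamma>_r: "sqrt \<gamma> * r = 2 * A\<^sup>2 * b"
proof -
  have "sqrt \<gamma> * r = 2 * A * sqrt (\<gamma> / (1 + \<sigma>))"
    by (simp add: r_def real_sqrt_divide)
  then show ?thesis
    unfolding A_b[symmetric] by (simp add: power2_eq_square)
qed

lemma b_nonneg: "0 \<le> b"
  unfolding b_def using A_pos \<gamma> \<sigma> by simp

lemma b_le_1: "b \<le> 1"
proof -
  have "\<gamma> / (1 + \<sigma>) \<le> (1 + \<sigma> - \<sigma> * \<gamma>) / (1 + \<sigma>)"
  proof (rule divide_right_mono)
    have "0 \<le> (1 - \<gamma>) * (1 + \<sigma>)" using \<gamma> \<sigma> by simp
    then show "\<gamma> \<le> 1 + \<sigma> - \<sigma> * \<gamma>" by (simp add: algebra_simps)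
  qed (use \<sigma> in auto)
  then have "A\<^sup>2 * b\<^sup>2 \<le> A\<^sup>2 * 1" unfolding A_b_square by (simp add: A_square)
  then have "b\<^sup>2 \<le> 1" using A_pos by (simp add: mult_le_cancel_left_pos)
  then show ?thesis by (rule power2_le_imp_le[of b 1, simplified])
qed

lemma \<sigma>_b_less_1: "\<sigma> * b < 1"
proof -
  have "\<sigma>\<^sup>2 * (\<gamma> / (1 + \<sigma>)) < (1 + \<sigma> - \<sigma> * \<gamma>) / (1 + \<sigma>)"
  proof -
    have "0 < (1 - \<sigma> * \<gamma>) * (1 + \<sigma>)" using \<sigma> \<sigma>\<gamma> by simp
    then have "\<sigma>\<^sup>2 * \<gamma> < 1 + \<sigma> - \<sigma> * \<gamma>" by (simp add: algebra_simps power2_eq_square)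
    then show ?thesis using \<sigma> by (simp add: divide_strict_right_mono)
  qed
  then have "A\<^sup>2 * (\<sigma> * b)\<^sup>2 < A\<^sup>2 * 1"
    unfolding A_square[symmetric] A_b_square[symmetric] by (simp add: power_mult_distrib mult_ac)
  then have "(\<sigma> * b)\<^sup>2 < 1\<^sup>2" using A_pos by simp
  then show ?thesis by (rule power2_less_imp_less) simp
qed

lemma total_mass_identity: "A\<^sup>2 * (1 + \<sigma> * b\<^sup>2) = 1"
proof -
  have "A\<^sup>2 * (1 + \<sigma> * b\<^sup>2) = A\<^sup>2 + \<sigma> * (A\<^sup>2 * b\<^sup>2)" by (simp add: algebra_simps)
  also have "\<dots> = 1"
    unfolding A_b_square unfolding A_square times_divide_eq_right add_divide_distrib[symmetric] using \<sigma> by simp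
  finally show ?thesis .
qed

lemma left_center: "1 + sqrt \<gamma> * m = A\<^sup>2 * (1 + b\<^sup>2)"
proof -
  have "A\<^sup>2 * (1 + b\<^sup>2) = A\<^sup>2 + A\<^sup>2 * b\<^sup>2" by (simp add: algebra_simps)
  moreover have "sqrt \<gamma> * m = \<gamma> * (1 - \<sigma>) / (1 + \<sigma>)" using \<gamma> by (simp add: m_def)
  moreover have "1 + \<gamma> * (1 - \<sigma>) / (1 + \<sigma>) = (1 + \<sigma> - \<sigma> * \<gamma>) / (1 + \<sigma>) + \<gamma> / (1 + \<sigma>)"
    using \<sigma> by (subst add_divide_distrib[symmetric]) (simp add: add_divide_eq_iff, simp add: algebra_simps)
  ultimately show ?thesis
    unfolding A_b_square unfolding A_square by simp
qed

lemma right_center: "1 - \<sigma> * sqrt \<gamma> * m = A\<^sup>2 * (1 + (\<sigma> * b)\<^sup>2)"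
proof -
  have "A\<^sup>2 * (1 + (\<sigma> * b)\<^sup>2) = A\<^sup>2 + \<sigma>\<^sup>2 * (A\<^sup>2 * b\<^sup>2)" by (simp add: algebra_simps)
  moreover have "\<sigma> * sqrt \<gamma> * m = \<sigma> * (\<gamma> * (1 - \<sigma>) / (1 + \<sigma>))" using \<gamma> by (simp add: m_def)
  moreover have "1 - \<sigma> * (\<gamma> * (1 - \<sigma>) / (1 + \<sigma>))
      = (1 + \<sigma> - \<sigma> * \<gamma>) / (1 + \<sigma>) + \<sigma>\<^sup>2 * (\<gamma> / (1 + \<sigma>))"
    using \<sigma> unfolding times_divide_eq_right
    by (subst add_divide_distrib[symmetric]) (simp add: diff_divide_eq_iff, simp add: algebra_simps power2_eq_square)
  ultimately show ?thesis
    unfolding A_b_square unfolding A_square by simp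
qed

lemma edge_factor_cos:
  "edge_factor (m + r * cos t) = A\<^sup>2 * chebyshev_kernel (-b) t * (A\<^sup>2 * chebyshev_kernel (\<sigma> * b) t)"
proof -
  have "1 + sqrt \<gamma> * (m + r * cos t) = (1 + sqrt \<gamma> * m) + (sqrt \<gamma> * r) * cos t"
    by (simp add: algebra_simps)
  also have "\<dots> = A\<^sup>2 * chebyshev_kernel (-b) t"
    unfolding left_center sqrt_\<gamma>_r by (simp add: chebyshev_kernel_def algebra_simps)
  finally have 1: "1 + sqrt \<gamma> * (m + r * cos t) = A\<^sup>2 * chebyshev_kernel (-b) t" .
  have "1 - \<sigma> * sqrt \<gamma> * (m + r * cos t) = (1 - \<sigma> * sqrt \<gamma> * m) - \<sigma> * (sqrt \<gamma> * r) * cos t"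
    by (simp add: algebra_simps)
  also have "\<dots> = A\<^sup>2 * chebyshev_kernel (\<sigma> * b) t"
    unfolding right_center sqrt_\<gamma>_r by (simp add: chebyshev_kernel_def algebra_simps)
  finally have 2: "1 - \<sigma> * sqrt \<gamma> * (m + r * cos t) = A\<^sup>2 * chebyshev_kernel (\<sigma> * b) t" .
  show ?thesis
    unfolding edge_factor_def of_real_eq_id id_apply 1 2 ..
qed

text \<open>
  One formula for the three cases: the Marchenko-Pastur and the semicircle case are the values at
  \<open>\<sigma> = 0\<close> and \<open>\<gamma> = 0\<close> of the expression that the Wachter case gives.
\<close>
lemma limit_density_eq:
  "limit_density \<gamma> \<sigma> x =
    (if \<bar>x - m\<bar> \<le> r then (1 + \<sigma>) * sqrt (r\<^sup>2 - (x - m)\<^sup>2) / (2 * pi * edge_factor x) else 0)"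
proof -
  define y where "y = x - m"
  have x: "x = m + y" by (simp add: y_def)
  have abs_y: "\<bar>y\<bar> \<le> r \<longleftrightarrow> -r \<le> y \<and> y \<le> r" by auto
  have rr: "(y + r) * (r - y) = r\<^sup>2 - y\<^sup>2" by (simp add: algebra_simps power2_eq_square)
  have sign: "0 < k \<Longrightarrow> 0 \<le> k * v \<longleftrightarrow> 0 \<le> v" for k v :: real
    by (auto simp: zero_le_mult_iff)
  have left: "1 + sqrt \<gamma> * x = A\<^sup>2 + A\<^sup>2 * b\<^sup>2 + sqrt \<gamma> * y"
    using left_center by (simp add: x algebra_simps)
  have cross: "2 * A * (A * b) = sqrt \<gamma> * r"
    by (simp add: sqrt_\<gamma>_r power2_eq_square)
  consider (wachter) "\<gamma> > 0" "\<sigma> > 0" | (marchenko_pastur) "\<gamma> > 0" "\<sigma> = 0" | (semicircle) "\<gamma> = 0"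
    using \<gamma> \<sigma> by linarith
  then show ?thesis
  proof cases
    case wachter
    define c where "c = \<sigma> / (1 + \<sigma>)"
    define B where "B = sqrt (\<gamma> / (1 + \<sigma>))"
    have c: "c > 0" using wachter by (simp add: c_def)
    have A': "sqrt (1 - \<sigma> * \<gamma> / (1 + \<sigma>)) = A"
      unfolding A_def using \<sigma> by (simp add: field_simps)
    have AB: "A * b = B" by (simp add: A_b B_def)
    define \<xi> where "\<xi> = c * (sqrt \<gamma> * x + 1)"
    define u1 where "u1 = c * (A - B)\<^sup>2"
    define u2 where "u2 = c * (A + B)\<^sup>2"
    have sq: "(A - B)\<^sup>2 = A\<^sup>2 + A\<^sup>2 * b\<^sup>2 - sqrt \<gamma> * r" "(A + B)\<^sup>2 = A\<^sup>2 + A\<^sup>2 * b\<^sup>2 + sqrt \<gamma> * r"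
      unfolding cross[symmetric] AB[symmetric] by (simp_all add: algebra_simps power2_eq_square)
    have l: "\<xi> - u1 = c * sqrt \<gamma> * (y + r)"
      using left unfolding \<xi>_def u1_def sq by (simp add: algebra_simps)
    have u: "u2 - \<xi> = c * sqrt \<gamma> * (r - y)"
      using left unfolding \<xi>_def u2_def sq by (simp add: algebra_simps)
    have ind: "(\<xi> \<in> {u1..u2}) = (\<bar>y\<bar> \<le> r)"
    proof -
      have "\<xi> \<in> {u1..u2} \<longleftrightarrow> 0 \<le> \<xi> - u1 \<and> 0 \<le> u2 - \<xi>" by auto
      also have "\<dots> \<longleftrightarrow> 0 \<le> y + r \<and> 0 \<le> r - y"
        unfolding l u using mult_pos_pos[OF c real_sqrt_gt_zero[OF wachter(1)]]
        by (simp only: sign)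
      finally show ?thesis unfolding abs_y by auto
    qed
    have one_minus: "1 - \<xi> = (1 - \<sigma> * sqrt \<gamma> * x) / (1 + \<sigma>)"
      unfolding \<xi>_def c_def using \<sigma> by (simp add: field_simps)
    have den: "\<xi> * (1 - \<xi>) = \<sigma> / (1 + \<sigma>)\<^sup>2 * edge_factor x"
      unfolding one_minus unfolding \<xi>_def c_def edge_factor_def of_real_eq_id id_apply
      by (simp add: power2_eq_square add.commute)
    have num: "sqrt ((\<xi> - u1) * (u2 - \<xi>)) = c * sqrt \<gamma> * sqrt (r\<^sup>2 - y\<^sup>2)"
    proof -
      have "(\<xi> - u1) * (u2 - \<xi>) = (c * sqrt \<gamma>)\<^sup>2 * ((y + r) * (r - y))"
        unfolding l u by (simp add: power2_eq_square)
      then show ?thesis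
        unfolding rr using c \<gamma> by (simp add: real_sqrt_mult)
    qed
    have "limit_density \<gamma> \<sigma> x = \<sigma> * sqrt \<gamma> / (1 + \<sigma>) * wachter_density \<gamma> \<sigma> \<xi>"
      unfolding limit_density_def \<xi>_def c_def using wachter \<sigma>\<gamma> by simp
    also have "wachter_density \<gamma> \<sigma> \<xi> = (1 + \<sigma>) / (2 * pi * \<sigma> * \<gamma>) *
        (sqrt ((\<xi> - u1) * (u2 - \<xi>)) / (\<xi> * (1 - \<xi>))) * indicator {u1..u2} \<xi>"
      unfolding wachter_density_def Let_def A' B_def[symmetric] u1_def u2_def c_def ..
    also have "\<sigma> * sqrt \<gamma> / (1 + \<sigma>) * \<dots> =
        (if \<bar>y\<bar> \<le> r then (1 + \<sigma>) * sqrt (r\<^sup>2 - y\<^sup>2) / (2 * pi * edge_factor x) else 0)"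
    proof (cases "\<bar>y\<bar> \<le> r")
      case True
      have "\<sigma> * g / D * (D / (2 * pi * \<sigma> * g\<^sup>2) * (\<sigma> / D * g * S / (\<sigma> / D\<^sup>2 * E)))
          = D * S / (2 * pi * E)" if "g > 0" "D > 0" for g D S E
        using that wachter(2) by (cases "E = 0") (simp_all add: field_simps power2_eq_square)
      from this[of "sqrt \<gamma>" "1 + \<sigma>" "sqrt (r\<^sup>2 - y\<^sup>2)" "edge_factor x"] show ?thesis
        using True wachter ind unfolding num den c_def by simp
    next
      case False
      then show ?thesis using ind by simp
    qed
    finally show ?thesis by (simp add: y_def)
  next
    case marchenko_pastur
    define g where "g = sqrt \<gamma>"
    have g: "g > 0" "g\<^sup>2 = \<gamma>" using marchenko_pastur by (auto simp: g_def)
    have A1: "A = 1" unfolding A_def using marchenko_pastur by simp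
    have b: "b = g" unfolding b_def A1 g_def using marchenko_pastur by simp
    have r2: "r = 2" unfolding r_def A1 using marchenko_pastur by simp
    have mg: "m = g" unfolding m_def g_def using marchenko_pastur by simp
    define \<xi> where "\<xi> = 1 + g * x"
    have l: "\<xi> - (g - 1)\<^sup>2 = g * (y + r)"
      by (simp add: \<xi>_def x mg r2 power2_eq_square algebra_simps)
    have u: "(g + 1)\<^sup>2 - \<xi> = g * (r - y)"
      by (simp add: \<xi>_def x mg r2 power2_eq_square algebra_simps)
    have ind: "(\<xi> \<in> {(g - 1)\<^sup>2..(g + 1)\<^sup>2}) = (\<bar>y\<bar> \<le> r)"
    proof -
      have "\<xi> \<in> {(g - 1)\<^sup>2..(g + 1)\<^sup>2} \<longleftrightarrow> 0 \<le> \<xi> - (g - 1)\<^sup>2 \<and> 0 \<le> (g + 1)\<^sup>2 - \<xi>" by auto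
      also have "\<dots> \<longleftrightarrow> 0 \<le> y + r \<and> 0 \<le> r - y"
        unfolding l u using g(1) by (simp only: sign)
      finally show ?thesis unfolding abs_y by auto
    qed
    have num: "sqrt ((\<xi> - (g - 1)\<^sup>2) * ((g + 1)\<^sup>2 - \<xi>)) = g * sqrt (r\<^sup>2 - y\<^sup>2)"
    proof -
      have "(\<xi> - (g - 1)\<^sup>2) * ((g + 1)\<^sup>2 - \<xi>) = g\<^sup>2 * ((y + r) * (r - y))"
        unfolding l u by (simp add: power2_eq_square)
      then show ?thesis
        unfolding rr using g(1) by (simp only: real_sqrt_mult real_sqrt_abs abs_of_pos)
    qed
    have "limit_density \<gamma> \<sigma> x = g * marchenko_pastur_density \<gamma> \<xi>"
      unfolding limit_density_def \<xi>_def g_def using marchenko_pastur \<gamma> by simp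
    also have "marchenko_pastur_density \<gamma> \<xi> = 1 / (2 * pi * g\<^sup>2 * \<xi>) *
        sqrt ((\<xi> - (g - 1)\<^sup>2) * ((g + 1)\<^sup>2 - \<xi>)) * indicator {(g - 1)\<^sup>2..(g + 1)\<^sup>2} \<xi>"
      unfolding marchenko_pastur_density_def Let_def g_def[symmetric] g(2) ..
    also have "g * \<dots> = (if \<bar>y\<bar> \<le> r then (1 + \<sigma>) * sqrt (r\<^sup>2 - y\<^sup>2) / (2 * pi * edge_factor x) else 0)"
    proof (cases "\<bar>y\<bar> \<le> r")
      case True
      have "edge_factor x = \<xi>"
        unfolding edge_factor_def \<xi>_def g_def using marchenko_pastur by simp
      then have "(1 + \<sigma>) * sqrt (r\<^sup>2 - y\<^sup>2) / (2 * pi * edge_factor x) = sqrt (r\<^sup>2 - y\<^sup>2) / (2 * pi * \<xi>)"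
        using marchenko_pastur by simp
      moreover have "g * (1 / (2 * pi * g\<^sup>2 * \<xi>) * (g * S) * 1) = S / (2 * pi * \<xi>)" for S
        using g(1) by (simp add: power2_eq_square)
      ultimately show ?thesis
        using True ind unfolding num by simp
    next
      case False
      then show ?thesis using ind by simp
    qed
    finally show ?thesis by (simp add: y_def)
  next
    case semicircle
    have A1: "A = 1" unfolding A_def using \<sigma> semicircle by simp
    have r2: "r\<^sup>2 = 4 / (1 + \<sigma>)" using r_square \<sigma> unfolding A1 by (simp add: field_simps)
    have m0: "m = 0" unfolding m_def using semicircle by simp
    have "x\<^sup>2 \<le> 4 / (1 + \<sigma>) \<longleftrightarrow> \<bar>x\<bar> \<le> r"
      unfolding r2[symmetric] using r_pos abs_le_square_iff[of x r] by simp
    then show ?thesis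
      unfolding limit_density_def m0 r2 edge_factor_def using \<sigma> semicircle by simp
  qed
qed

text \<open>
  Density of the limit law in the angle \<open>t\<close>, \<open>x = m + r cos t\<close>, with \<open>t\<close> in \<open>[- \<pi>, 0]\<close> so that
  \<open>x\<close> increases with \<open>t\<close>.
\<close>
definition angle_density :: "real \<Rightarrow> real" where
  "angle_density t = 2 / (pi * A\<^sup>2) * ((sin t)\<^sup>2 / (chebyshev_kernel (-b) t * chebyshev_kernel (\<sigma> * b) t))"

lemma chebyshev_kernel_real_nonneg: "0 \<le> chebyshev_kernel (w :: real) t"
proof -
  have "chebyshev_kernel w t = (w - cos t)\<^sup>2 + (sin t)\<^sup>2"
    using sin_cos_squared_add[of t] by (simp add: chebyshev_kernel_def power2_diff)
  then show ?thesis by simp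
qed

lemma angle_density_nonneg: "0 \<le> angle_density t"
  unfolding angle_density_def
  by (intro mult_nonneg_nonneg divide_nonneg_nonneg chebyshev_kernel_real_nonneg) auto

lemma borel_measurable_limit_density [measurable]: "limit_density \<gamma> \<sigma> \<in> borel_measurable borel"
  unfolding limit_density_eq[abs_def] edge_factor_def by measurable

lemma borel_measurable_angle_density [measurable]: "angle_density \<in> borel_measurable borel"
  unfolding angle_density_def[abs_def] chebyshev_kernel_def by measurable

lemma limit_density_cos:
  assumes "t \<in> {-pi..0}"
  shows "limit_density \<gamma> \<sigma> (m + r * cos t) * (- r * sin t) = angle_density t"
proof -
  have sin: "sin t \<le> 0"
    using assms sin_ge_zero[of "- t"] by simp
  have "\<bar>r * cos t\<bar> \<le> r * 1"
    unfolding abs_mult using r_pos by (intro mult_mono) auto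
  moreover have "r\<^sup>2 - (r * cos t)\<^sup>2 = (r * sin t)\<^sup>2"
  proof -
    have "(r * sin t)\<^sup>2 + (r * cos t)\<^sup>2 = r\<^sup>2 * ((sin t)\<^sup>2 + (cos t)\<^sup>2)"
      by (simp only: power_mult_distrib distrib_left)
    then show ?thesis unfolding sin_cos_squared_add by simp
  qed
  then have "sqrt (r\<^sup>2 - (r * cos t)\<^sup>2) = - r * sin t"
    using sin r_pos by (simp add: abs_mult)
  ultimately have "limit_density \<gamma> \<sigma> (m + r * cos t) * (- r * sin t)
      = (1 + \<sigma>) * (- r * sin t) / (2 * pi * edge_factor (m + r * cos t)) * (- r * sin t)"
    by (simp add: limit_density_eq)
  also have "\<dots> = (r\<^sup>2 * (1 + \<sigma>)) * (sin t)\<^sup>2 / (2 * pi * edge_factor (m + r * cos t))"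
    by (simp add: power2_eq_square)
  also have "\<dots> = angle_density t"
    unfolding r_square edge_factor_cos angle_density_def using A_pos by (simp add: power2_eq_square)
  finally show ?thesis .
qed

lemma limit_measure_eq_distr:
  "limit_measure \<gamma> \<sigma> =
    distr (density lborel (\<lambda>t. ennreal (angle_density t * indicator {-pi..0} t))) borel (\<lambda>t. m + r * cos t)"
proof (rule measure_eqI)
  fix S assume "S \<in> sets (limit_measure \<gamma> \<sigma>)"
  then have [measurable]: "S \<in> sets borel" by (simp add: limit_measure_def)
  let ?g = "\<lambda>t. m + r * cos t"
  let ?f = "\<lambda>x. ennreal (limit_density \<gamma> \<sigma> x) * indicator S x"
  have "emeasure (limit_measure \<gamma> \<sigma>) S = (\<integral>\<^sup>+x. ?f x \<partial>lborel)"
    unfolding limit_measure_def by (subst emeasure_density) auto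
  also have "\<dots> = (\<integral>\<^sup>+x. ?f x * indicator {?g (-pi)..?g 0} x \<partial>lborel)"
    by (intro nn_integral_cong) (auto simp: limit_density_eq indicator_def)
  also have "\<dots> = (\<integral>\<^sup>+t. ?f (?g t) * ennreal (- r * sin t) * indicator {-pi..0} t \<partial>lborel)"
  proof (rule nn_integral_substitution_aux)
    show "?f \<in> borel_measurable borel" by measurable
    show "(?g has_real_derivative - r * sin t) (at t)" for t
      by (auto intro!: derivative_eq_intros)
    show "continuous_on {-pi..0} (\<lambda>t. - r * sin t)" by (intro continuous_intros)
    show "0 \<le> - r * sin t" if "t \<in> {-pi..0}" for t
      using that sin_ge_zero[of "- t"] r_pos by (simp add: mult_nonneg_nonpos)
  qed auto
  also have "\<dots> = (\<integral>\<^sup>+t. ennreal (angle_density t * indicator {-pi..0} t) * indicator (?g -` S) t \<partial>lborel)"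
  proof (rule nn_integral_cong)
    fix t
    show "?f (?g t) * ennreal (- r * sin t) * indicator {-pi..0} t
        = ennreal (angle_density t * indicator {-pi..0} t) * indicator (?g -` S) t"
    proof (cases "t \<in> {-pi..0}")
      case True
      have "0 \<le> - r * sin t" using True sin_ge_zero[of "- t"] r_pos by (simp add: mult_nonneg_nonpos)
      then have "ennreal (limit_density \<gamma> \<sigma> (?g t)) * ennreal (- r * sin t) = ennreal (angle_density t)"
        unfolding limit_density_cos[OF True, symmetric] by (rule ennreal_mult''[symmetric])
      then show ?thesis
        using True by (simp add: indicator_def)
    qed simp
  qed
  also have "\<dots> = emeasure (density lborel (\<lambda>t. ennreal (angle_density t * indicator {-pi..0} t))) (?g -` S)"
    by (subst emeasure_density) (auto intro: measurable_sets_borel[of _ borel])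
  also have "\<dots> = emeasure (distr (density lborel (\<lambda>t. ennreal (angle_density t * indicator {-pi..0} t))) borel ?g) S"
    by (subst emeasure_distr) auto
  finally show "emeasure (limit_measure \<gamma> \<sigma>) S = \<dots>" .
qed (simp add: limit_measure_def)

lemma chebyshev_kernel_of_real: "chebyshev_kernel (complex_of_real w) t = of_real (chebyshev_kernel w t)"
  by (simp add: chebyshev_kernel_def)

lemma kernel_parameters_edges: "kernel_parameter (of_real (-b))" "kernel_parameter (of_real (\<sigma> * b))"
  using b_nonneg b_le_1 \<sigma>_b_less_1 \<sigma> by (auto simp: kernel_parameter_def norm_mult)

lemma edges_equal: "- b = \<sigma> * b \<Longrightarrow> b = 0"
  using b_nonneg \<sigma> by (metis add.right_inverse add_nonneg_eq_0_iff mult_nonneg_nonneg neg_eq_iff_add_eq_0)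

lemma has_integral_angle_density: "(angle_density has_integral 1) {-pi..0}"
proof -
  let ?u = "complex_of_real (-b)" and ?v = "complex_of_real (\<sigma> * b)"
  have "((\<lambda>t. of_real ((sin t)\<^sup>2) / (chebyshev_kernel ?u t * chebyshev_kernel ?v t))
      has_integral of_real (pi / 2) / (1 - ?u * ?v)) {-pi..0}"
  proof (cases "?u = ?v")
    case True
    then have "b = 0" using edges_equal of_real_eq_iff by blast
    then show ?thesis
      using has_integral_inverse_chebyshev_kernel[of 0]
      by (simp add: kernel_parameter_def) (simp add: chebyshev_kernel_def)
  qed (rule has_integral_inverse_chebyshev_kernel_2[OF kernel_parameters_edges])
  from has_integral_linear[OF has_integral_mult_right[OF this, of "of_real (2 / (pi * A\<^sup>2))"] bounded_linear_Re]
  have "((\<lambda>t. Re (of_real (2 / (pi * A\<^sup>2)) * (of_real ((sin t)\<^sup>2) / (chebyshev_kernel ?u t * chebyshev_kernel ?v t))))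
      has_integral Re (of_real (2 / (pi * A\<^sup>2)) * (of_real (pi / 2) / (1 - ?u * ?v)))) {-pi..0}"
    by (simp only: o_def)
  moreover have "Re (of_real (2 / (pi * A\<^sup>2)) * (of_real ((sin t)\<^sup>2) / (chebyshev_kernel ?u t * chebyshev_kernel ?v t)))
      = angle_density t" for t
    unfolding chebyshev_kernel_of_real of_real_mult[symmetric] of_real_divide[symmetric] Re_complex_of_real
      angle_density_def ..
  moreover have "Re (of_real (2 / (pi * A\<^sup>2)) * (of_real (pi / 2) / (1 - ?u * ?v))) = 1"
  proof -
    have "1 - ?u * ?v = of_real (1 + \<sigma> * b\<^sup>2)"
      by (simp add: power2_eq_square)
    then have "Re (of_real (2 / (pi * A\<^sup>2)) * (of_real (pi / 2) / (1 - ?u * ?v)))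
        = 2 / (pi * A\<^sup>2) * (pi / 2 / (1 + \<sigma> * b\<^sup>2))"
      by (simp only: of_real_mult[symmetric] of_real_divide[symmetric] Re_complex_of_real)
    also have "2 / (pi * A\<^sup>2) * (pi / 2 / X) = 1 / (A\<^sup>2 * X)" for X by simp
    finally show ?thesis unfolding total_mass_identity by simp
  qed
  ultimately show ?thesis by (simp only:)
qed

lemma real_distribution_limit_measure: "real_distribution (limit_measure \<gamma> \<sigma>)"
proof -
  have "(\<integral>\<^sup>+t. ennreal (angle_density t * indicator {-pi..0} t) \<partial>lborel) = ennreal 1"
  proof (rule nn_integral_has_integral_lborel)
    have "((\<lambda>t. if t \<in> {-pi..0} then angle_density t else 0) has_integral 1) UNIV"
      using has_integral_angle_density by (simp only: has_integral_restrict_UNIV)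
    moreover have "(\<lambda>t. if t \<in> {-pi..0} then angle_density t else 0) = (\<lambda>t. angle_density t * indicator {-pi..0} t)"
      by (auto simp: fun_eq_iff)
    ultimately show "((\<lambda>t. angle_density t * indicator {-pi..0} t) has_integral 1) UNIV"
      by simp
  qed (auto simp: angle_density_nonneg)
  then have "prob_space (density lborel (\<lambda>t. ennreal (angle_density t * indicator {-pi..0} t)))"
    by (intro prob_spaceI) (simp add: emeasure_density)
  then have "prob_space (limit_measure \<gamma> \<sigma>)"
    unfolding limit_measure_eq_distr by (rule prob_space.prob_space_distr) simp
  then show ?thesis
    by (simp add: real_distribution_def real_distribution_axioms_def limit_measure_def)
qed

lemma has_integral_limit_measure:
  fixes f :: "real \<Rightarrow> complex"
  assumes [measurable]: "f \<in> borel_measurable borel" and bound: "\<And>x. norm (f x) \<le> C"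
  shows "((\<lambda>t. of_real (angle_density t) * f (m + r * cos t)) has_integral
    (\<integral>x. f x \<partial>limit_measure \<gamma> \<sigma>)) {-pi..0}"
proof -
  interpret L: real_distribution "limit_measure \<gamma> \<sigma>" by (rule real_distribution_limit_measure)
  let ?k = "\<lambda>t. angle_density t * indicator {-pi..0} t"
  let ?F = "\<lambda>t. ?k t *\<^sub>R f (m + r * cos t)"
  have k: "AE t in lborel. 0 \<le> ?k t" by (simp add: angle_density_nonneg)
  have "integrable (limit_measure \<gamma> \<sigma>) f"
    by (rule L.integrable_const_bound[where B = C]) (auto simp: bound)
  then have "integrable (density lborel (\<lambda>t. ennreal (?k t))) (\<lambda>t. f (m + r * cos t))"
    unfolding limit_measure_eq_distr by (subst (asm) integrable_distr_eq) auto
  then have "integrable lborel ?F"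
    by (subst (asm) integrable_density) (use k in auto)
  from has_integral_integral_lborel[OF this]
  have "(?F has_integral (\<integral>t. ?F t \<partial>lborel)) UNIV" .
  also have "(\<integral>t. ?F t \<partial>lborel) = (\<integral>t. f (m + r * cos t) \<partial>density lborel (\<lambda>t. ennreal (?k t)))"
    by (rule integral_density[symmetric]) (use k in auto)
  also have "\<dots> = (\<integral>x. f x \<partial>limit_measure \<gamma> \<sigma>)"
    unfolding limit_measure_eq_distr by (rule integral_distr[symmetric]) auto
  also have "?F = (\<lambda>t. if t \<in> {-pi..0} then of_real (angle_density t) * f (m + r * cos t) else 0)"
    by (auto simp: fun_eq_iff scaleR_conv_of_real)
  finally show ?thesis
    by (simp only: has_integral_restrict_UNIV)
qed

text \<open>
  Both roots of the limiting quadratic equation at \<open>z = m + (r / 2) (w + 1 / w)\<close>: one at \<open>w\<close>, the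
  other at \<open>1 / w\<close>.
\<close>
definition resolvent_branch :: "complex \<Rightarrow> complex" where
  "resolvent_branch w = 2 / of_real r * w / ((1 + of_real b * w) * (1 - of_real (\<sigma> * b) * w))"

lemma stieltjes_limit_measure:
  assumes w: "norm w < 1" "Im w < 0" and z: "z = of_real m + of_real (r / 2) * (w + 1 / w)" "Im z > 0"
  shows "(\<integral>x. 1 / (z - of_real x) \<partial>limit_measure \<gamma> \<sigma>) = resolvent_branch w"
proof -
  let ?u = "complex_of_real (-b)" and ?v = "complex_of_real (\<sigma> * b)"
  let ?P = "complex_of_real (pi / 2)"
  have nz: "w \<noteq> 0" "?u \<noteq> w" "?v \<noteq> w" "z - of_real x \<noteq> 0" for x
    using w(2) z(2) by (auto simp: complex_eq_iff)
  have wj: "kernel_parameter w" using w by (simp add: kernel_parameter_def)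
  have meas: "(\<lambda>x. 1 / (z - of_real x)) \<in> borel_measurable borel" by measurable
  have bound: "norm (1 / (z - of_real x)) \<le> 1 / Im z" for x
    using abs_Im_le_cmod[of "z - of_real x"] z(2) by (simp add: norm_divide frac_le)
  have I: "((\<lambda>t. of_real ((sin t)\<^sup>2) / (chebyshev_kernel ?u t * chebyshev_kernel ?v t * chebyshev_kernel w t))
      has_integral ?P / ((1 - ?u * ?v) * (1 - ?u * w) * (1 - ?v * w))) {-pi..0}"
  proof (cases "?u = ?v")
    case True
    then have "b = 0" using edges_equal of_real_eq_iff by blast
    then show ?thesis
      using has_integral_inverse_chebyshev_kernel[OF wj]
      by (simp add: chebyshev_kernel_def[of 0])
  next
    case False
    then show ?thesis
      by (intro has_integral_inverse_chebyshev_kernel_3 kernel_parameters_edges wj nz)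
  qed
  have kernel: "of_real (angle_density t) * (1 / (z - of_real (m + r * cos t)))
      = of_real (2 / (pi * A\<^sup>2)) * (2 * w / of_real r) *
        (of_real ((sin t)\<^sup>2) / (chebyshev_kernel ?u t * chebyshev_kernel ?v t * chebyshev_kernel w t))" for t
  proof -
    have "z - of_real (m + r * cos t) = of_real r / (2 * w) * chebyshev_kernel w t"
      unfolding z chebyshev_kernel_def using nz(1) r_pos by (simp add: field_simps power2_eq_square)
    then have "1 / (z - of_real (m + r * cos t)) = 2 * w / of_real r / chebyshev_kernel w t"
      using nz(1) by simp
    moreover have "of_real (angle_density t)
        = of_real (2 / (pi * A\<^sup>2)) * (of_real ((sin t)\<^sup>2) / (chebyshev_kernel ?u t * chebyshev_kernel ?v t))"
      unfolding angle_density_def chebyshev_kernel_of_real of_real_mult[symmetric] of_real_divide[symmetric] ..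
    ultimately show ?thesis by (simp add: mult_ac)
  qed
  have "(\<integral>x. 1 / (z - of_real x) \<partial>limit_measure \<gamma> \<sigma>)
      = of_real (2 / (pi * A\<^sup>2)) * (2 * w / of_real r) * (?P / ((1 - ?u * ?v) * (1 - ?u * w) * (1 - ?v * w)))"
    using has_integral_unique[OF has_integral_limit_measure[OF meas bound, unfolded kernel]
        has_integral_mult_right[OF I]] .
  also have "\<dots> = (2 * w / of_real r) * (of_real (2 / (pi * A\<^sup>2)) * ?P / (1 - ?u * ?v)) / ((1 - ?u * w) * (1 - ?v * w))"
    by simp
  also have "of_real (2 / (pi * A\<^sup>2)) * ?P / (1 - ?u * ?v) = 1"
  proof -
    have "1 - ?u * ?v = of_real (1 + \<sigma> * b\<^sup>2)"
      by (simp add: power2_eq_square)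
    then have "of_real (2 / (pi * A\<^sup>2)) * ?P / (1 - ?u * ?v) = of_real (2 / (pi * A\<^sup>2) * (pi / 2) / (1 + \<sigma> * b\<^sup>2))"
      by (simp only: of_real_mult of_real_divide)
    also have "2 / (pi * A\<^sup>2) * (pi / 2) / X = 1 / (A\<^sup>2 * X)" for X by simp
    finally show ?thesis unfolding total_mass_identity by simp
  qed
  finally show ?thesis
    by (simp add: resolvent_branch_def)
qed

text \<open>
  Coefficient of \<open>z\<close> in the linear term of the limiting quadratic equation.
\<close>
definition edge_slope :: real where "edge_slope = 1 + \<sigma> - 2 * \<sigma> * \<gamma>"

lemma edge_factor_joukowski:
  fixes w v z :: complex
  assumes "w * v = 1" and z: "z = of_real m + of_real (r / 2) * (w + v)"
  shows "1 + of_real (sqrt \<gamma>) * z = of_real (A\<^sup>2) * (1 + of_real b * w) * (1 + of_real b * v)"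
    and "1 - of_real (\<sigma> * sqrt \<gamma>) * z = of_real (A\<^sup>2) * (1 - of_real (\<sigma> * b) * w) * (1 - of_real (\<sigma> * b) * v)"
proof -
  have "1 + of_real (sqrt \<gamma>) * z = of_real (1 + sqrt \<gamma> * m) + of_real (sqrt \<gamma> * r) * ((w + v) / 2)"
    by (simp add: z algebra_simps)
  also have "\<dots> = of_real (A\<^sup>2) * (1 + of_real b * (w + v) + of_real b * of_real b * (w * v))"
    unfolding left_center sqrt_\<gamma>_r assms(1) by (simp add: algebra_simps power2_eq_square)
  also have "1 + of_real b * (w + v) + of_real b * of_real b * (w * v) = (1 + of_real b * w) * (1 + of_real b * v)"
    by (simp add: algebra_simps)
  finally show "1 + of_real (sqrt \<gamma>) * z = of_real (A\<^sup>2) * (1 + of_real b * w) * (1 + of_real b * v)"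
    by (simp only: mult.assoc)
  have "1 - of_real (\<sigma> * sqrt \<gamma>) * z = of_real (1 - \<sigma> * sqrt \<gamma> * m) - of_real (\<sigma> * (sqrt \<gamma> * r)) * ((w + v) / 2)"
    by (simp add: z algebra_simps)
  also have "\<dots> = of_real (A\<^sup>2) * (1 - of_real (\<sigma> * b) * (w + v) + of_real (\<sigma> * b) * of_real (\<sigma> * b) * (w * v))"
    unfolding right_center sqrt_\<gamma>_r assms(1) by (simp add: algebra_simps power2_eq_square)
  also have "1 - c * (w + v) + c * c * (w * v) = (1 - c * w) * (1 - c * v)" for c
    by (simp add: algebra_simps)
  finally show "1 - of_real (\<sigma> * sqrt \<gamma>) * z
      = of_real (A\<^sup>2) * (1 - of_real (\<sigma> * b) * w) * (1 - of_real (\<sigma> * b) * v)"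
    by (simp only: mult.assoc)
qed

text \<open>
  Each factor of \<open>edge_factor z\<close> splits as a function of \<open>w\<close> times the same function of
  \<open>1 / w\<close>, so multiplying by it clears the denominators of both branches; their sum and product
  are then compared with the coefficients.
\<close>
lemma loop_equation_factorization:
  fixes w v z :: complex
  assumes wv: "w * v = 1" and z: "z = of_real m + of_real (r / 2) * (w + v)" and w: "Im w \<noteq> 0"
  shows "edge_factor z \<noteq> 0"
    and "edge_factor z * X\<^sup>2 - (of_real edge_slope * z + of_real (sqrt \<gamma> * (1 - \<sigma>))) * X + of_real (1 + \<sigma> - \<sigma> * \<gamma>)
      = edge_factor z * ((X - resolvent_branch w) * (X - resolvent_branch v))"
proof -
  have w0: "w \<noteq> 0" "v \<noteq> 0" using wv by auto
  have v: "v = 1 / w" using wv w0 by (simp add: field_simps)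
  have Im_v: "Im v \<noteq> 0"
  proof
    assume "Im v = 0"
    then have "v = of_real (Re v)" by (simp add: complex_eq_iff)
    then have "w = of_real (1 / Re v)" using wv w0 by (metis nonzero_divide_eq_eq of_real_1 of_real_divide)
    then show False using w by (metis Im_complex_of_real)
  qed
  have nonreal: "1 + of_real c * u \<noteq> 0" if "Im u \<noteq> 0" for u and c :: real
  proof
    assume eq: "1 + of_real c * u = 0"
    then have "c * Im u = 0" by (simp add: complex_eq_iff)
    then have "c = 0" using that by simp
    then show False using eq by simp
  qed
  define P :: "complex \<Rightarrow> complex" where "P = (\<lambda>u. 1 + of_real b * u)"
  define Q :: "complex \<Rightarrow> complex" where "Q = (\<lambda>u. 1 - of_real (\<sigma> * b) * u)"
  define a where "a = complex_of_real (A\<^sup>2)"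
  define \<rho> where "\<rho> = 2 / complex_of_real r"
  have PQ: "P u \<noteq> 0" "Q u \<noteq> 0" if "Im u \<noteq> 0" for u
    using nonreal[OF that, of b] nonreal[OF that, of "- (\<sigma> * b)"] by (auto simp: P_def Q_def)
  have a: "a \<noteq> 0" using A_pos by (simp add: a_def)
  have E: "edge_factor z = a * P w * P v * (a * Q w * Q v)"
    unfolding edge_factor_def edge_factor_joukowski[OF wv z] P_def Q_def a_def ..
  show "edge_factor z \<noteq> 0"
    unfolding E using a PQ[OF w] PQ[OF Im_v] by simp
  have G: "resolvent_branch u = \<rho> * u / (P u * Q u)" for u
    by (simp add: resolvent_branch_def P_def Q_def \<rho>_def)
  have EG: "edge_factor z * resolvent_branch w = a\<^sup>2 * \<rho> * (w * P v * Q v)"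
    "edge_factor z * resolvent_branch v = a\<^sup>2 * \<rho> * (v * P w * Q w)"
    unfolding E G using PQ[OF w] PQ[OF Im_v] by (simp_all add: field_simps power2_eq_square)
  have prod: "edge_factor z * (resolvent_branch w * resolvent_branch v) = of_real (1 + \<sigma> - \<sigma> * \<gamma>)"
  proof -
    have "edge_factor z * (resolvent_branch w * resolvent_branch v)
        = edge_factor z * resolvent_branch w * resolvent_branch v"
      by (simp only: mult.assoc)
    also have "\<dots> = a\<^sup>2 * \<rho> * (w * P v * Q v) * resolvent_branch v"
      unfolding EG ..
    also have "\<dots> = a\<^sup>2 * \<rho>\<^sup>2 * (w * v)"
      unfolding G using PQ[OF Im_v] by (simp add: power2_eq_square)
    also have "\<dots> = of_real ((A\<^sup>2)\<^sup>2 * (2 / r)\<^sup>2)"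
      unfolding wv by (simp add: a_def \<rho>_def)
    also have "(A\<^sup>2)\<^sup>2 * (2 / r)\<^sup>2 = A\<^sup>2 * (4 * A\<^sup>2) / r\<^sup>2"
      by (simp add: power2_eq_square)
    also have "\<dots> = 1 + \<sigma> - \<sigma> * \<gamma>"
      unfolding r_square[symmetric] using r_pos \<sigma> by (simp add: A_square)
    finally show ?thesis .
  qed
  have sum: "edge_factor z * (resolvent_branch w + resolvent_branch v)
      = of_real edge_slope * z + of_real (sqrt \<gamma> * (1 - \<sigma>))"
  proof -
    have "w * P v * Q v + v * P w * Q w = (w + v) * (1 - of_real (\<sigma> * b) * of_real b * (w * v))
        + 2 * (w * v) * (of_real b - of_real (\<sigma> * b))"
      unfolding P_def Q_def by (simp add: algebra_simps)
    then have *: "w * P v * Q v + v * P w * Q w = (w + v) * of_real (1 - \<sigma> * b\<^sup>2) + of_real (2 * b * (1 - \<sigma>))"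
      unfolding wv by (simp add: algebra_simps power2_eq_square)
    have "edge_factor z * (resolvent_branch w + resolvent_branch v)
        = a\<^sup>2 * \<rho> * (w * P v * Q v + v * P w * Q w)"
      by (simp only: distrib_left EG)
    also have "\<dots> = of_real ((A\<^sup>2)\<^sup>2 * (2 / r) * (1 - \<sigma> * b\<^sup>2)) * (w + v) + of_real ((A\<^sup>2)\<^sup>2 * (2 / r) * (2 * b * (1 - \<sigma>)))"
    proof -
      have "a\<^sup>2 * \<rho> = of_real ((A\<^sup>2)\<^sup>2 * (2 / r))" by (simp add: a_def \<rho>_def)
      then show ?thesis
        unfolding * by (simp only: distrib_left of_real_mult mult_ac)
    qed
    also have "(A\<^sup>2)\<^sup>2 * (2 / r) * (1 - \<sigma> * b\<^sup>2) = edge_slope * (r / 2)"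
    proof -
      have "A\<^sup>2 * (1 - \<sigma> * b\<^sup>2) = A\<^sup>2 - \<sigma> * (A\<^sup>2 * b\<^sup>2)" by (simp add: algebra_simps)
      also have "\<dots> = edge_slope / (1 + \<sigma>)"
        unfolding A_b_square unfolding A_square edge_slope_def times_divide_eq_right diff_divide_distrib[symmetric]
        by (simp add: algebra_simps)
      finally have 1: "A\<^sup>2 * (1 - \<sigma> * b\<^sup>2) = edge_slope / (1 + \<sigma>)" .
      have "(A\<^sup>2)\<^sup>2 * (2 / r) * (1 - \<sigma> * b\<^sup>2) = (4 * A\<^sup>2) * (A\<^sup>2 * (1 - \<sigma> * b\<^sup>2)) / (2 * r)"
        by (simp add: power2_eq_square)
      also have "\<dots> = edge_slope * (r / 2)"
        unfolding 1 r_square[symmetric] using r_pos \<sigma> by (simp add: power2_eq_square)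
      finally show ?thesis .
    qed
    also have "(A\<^sup>2)\<^sup>2 * (2 / r) * (2 * b * (1 - \<sigma>)) = edge_slope * m + sqrt \<gamma> * (1 - \<sigma>)"
    proof -
      have "(A\<^sup>2)\<^sup>2 * (2 / r) * (2 * b * (1 - \<sigma>)) = A\<^sup>2 * (2 * A\<^sup>2 * b) * (2 / r) * (1 - \<sigma>)"
        by (simp add: power2_eq_square)
      also have "\<dots> = 2 * A\<^sup>2 * (sqrt \<gamma> * (1 - \<sigma>))"
        unfolding sqrt_\<gamma>_r[symmetric] using r_pos by simp
      also have "2 * A\<^sup>2 = edge_slope / (1 + \<sigma>) + 1"
        unfolding A_square edge_slope_def using \<sigma> by (simp add: add_divide_eq_iff divide_add_eq_iff) 
      also have "(edge_slope / (1 + \<sigma>) + 1) * (sqrt \<gamma> * (1 - \<sigma>)) = edge_slope * m + sqrt \<gamma> * (1 - \<sigma>)"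
        unfolding m_def by (simp add: algebra_simps)
      finally show ?thesis .
    qed
    finally show ?thesis
      unfolding z by (simp add: algebra_simps)
  qed
  have "edge_factor z * ((X - resolvent_branch w) * (X - resolvent_branch v))
      = edge_factor z * X\<^sup>2 - edge_factor z * (resolvent_branch w + resolvent_branch v) * X +
        edge_factor z * (resolvent_branch w * resolvent_branch v)"
    by (simp add: algebra_simps power2_eq_square)
  then show "edge_factor z * X\<^sup>2 - (of_real edge_slope * z + of_real (sqrt \<gamma> * (1 - \<sigma>))) * X + of_real (1 + \<sigma> - \<sigma> * \<gamma>)
      = edge_factor z * ((X - resolvent_branch w) * (X - resolvent_branch v))"
    unfolding sum prod ..
qed

text \<open>
  After cancellation the quantity is a positive multiple of \<open>(1 - \<sigma> b w) / (w + b)\<close>, a Moebius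
  map that sends the lower half plane to the upper one.
\<close>
lemma Im_other_branch_pos:
  fixes w v z :: complex
  assumes wv: "w * v = 1" and z: "z = of_real m + of_real (r / 2) * (w + v)" and w: "Im w < 0"
  shows "Im ((1 - of_real (\<sigma> * sqrt \<gamma>) * z) * resolvent_branch v) > 0"
proof -
  have w0: "w \<noteq> 0" using wv by auto
  have v: "v = 1 / w" using wv w0 by (simp add: field_simps)
  have wb: "w + of_real b \<noteq> 0" using w by (auto simp: complex_eq_iff)
  have Qv: "1 - of_real (\<sigma> * b) * v \<noteq> 0"
  proof
    assume "1 - of_real (\<sigma> * b) * v = 0"
    then have "w = of_real (\<sigma> * b)" using w0 by (simp add: v field_simps)
    then show False using w by simp
  qed
  have Pv: "v / (1 + of_real b * v) = 1 / (w + of_real b)"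
    using w0 wb by (simp add: v field_simps)
  have "(1 - of_real (\<sigma> * sqrt \<gamma>) * z) * resolvent_branch v
      = of_real (A\<^sup>2) * (1 - of_real (\<sigma> * b) * w) * (2 / of_real r) * (v / (1 + of_real b * v))"
    unfolding edge_factor_joukowski(2)[OF wv z] resolvent_branch_def using Qv by simp
  also have "\<dots> = of_real (2 * A\<^sup>2 / r) * ((1 - of_real (\<sigma> * b) * w) / (w + of_real b))"
    unfolding Pv by simp
  also have "(1 - of_real (\<sigma> * b) * w) / (w + of_real b)
      = of_real (1 / (norm (w + of_real b))\<^sup>2) * ((1 - of_real (\<sigma> * b) * w) * cnj (w + of_real b))"
  proof -
    have "of_real (1 / (norm W)\<^sup>2) * (X * cnj W) = X / W" if "W \<noteq> 0" for W X :: complex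
      unfolding of_real_divide complex_norm_square using that by simp
    from this[OF wb] show ?thesis ..
  qed
  finally have eq: "(1 - of_real (\<sigma> * sqrt \<gamma>) * z) * resolvent_branch v
      = of_real (2 * A\<^sup>2 / r * (1 / (norm (w + of_real b))\<^sup>2)) * ((1 - of_real (\<sigma> * b) * w) * cnj (w + of_real b))"
    by simp
  have "Im ((1 - of_real (\<sigma> * b) * w) * cnj (w + of_real b)) = - Im w * (1 + \<sigma> * b * b)"
    by (simp add: algebra_simps)
  moreover have "0 < - Im w * (1 + \<sigma> * b * b)"
    using w \<sigma> b_nonneg by (intro mult_pos_pos add_pos_nonneg) auto
  moreover have "0 < 2 * A\<^sup>2 / r * (1 / (norm (w + of_real b))\<^sup>2)"
    using A_pos r_pos wb by simp
  ultimately show ?thesis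
    unfolding eq by (simp only: Im_complex_of_real Re_complex_of_real times_complex.sel(2)[of "of_real _"]
        mult_zero_left add_0_right mult_pos_pos)
qed

end

section \<open>Weak convergence from Stieltjes transforms\<close>

definition cauchy_kernel :: "real \<Rightarrow> real \<Rightarrow> real" where
  "cauchy_kernel y u = y / (pi * (u\<^sup>2 + y\<^sup>2))"

lemma cauchy_kernel_nonneg: "y > 0 \<Longrightarrow> 0 \<le> cauchy_kernel y u"
  by (simp add: cauchy_kernel_def)

lemma borel_measurable_cauchy_kernel [measurable]:
  "cauchy_kernel y \<in> borel_measurable borel"
  unfolding cauchy_kernel_def by measurable

lemma cauchy_kernel_scale:
  assumes "y > 0"
  shows "y * cauchy_kernel y (y * u) = cauchy_kernel 1 u"
proof -
  have "y * y / (pi * ((y * u)\<^sup>2 + y\<^sup>2)) = (y * y) * 1 / ((y * y) * (pi * (u\<^sup>2 + 1)))"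
    by (simp add: power2_eq_square algebra_simps)
  also have "\<dots> = 1 / (pi * (u\<^sup>2 + 1))"
    using assms by (subst mult_divide_mult_cancel_left) auto
  finally show ?thesis
    by (simp add: cauchy_kernel_def)
qed

lemma nn_integral_standard_cauchy: "(\<integral>\<^sup>+u. ennreal (cauchy_kernel 1 u) \<partial>lborel) = 1"
proof -
  have half: "(\<integral>\<^sup>+u. ennreal (cauchy_kernel 1 u) * indicator {0..} u \<partial>lborel) = ennreal (1 / 2)"
  proof -
    have "(\<integral>\<^sup>+u. ennreal (cauchy_kernel 1 u) * indicator {0..} u \<partial>lborel)
        = ennreal (1 / 2 - arctan 0 / pi)"
    proof (rule nn_integral_FTC_atLeast)
      show "((\<lambda>u. arctan u / pi) has_real_derivative cauchy_kernel 1 u) (at u)" for u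
        by (auto intro!: derivative_eq_intros simp: cauchy_kernel_def inverse_eq_divide add.commute mult.commute)
      have "((\<lambda>u. arctan u / pi) \<longlongrightarrow> (pi / 2) / pi) at_top"
        by (intro tendsto_intros tendsto_arctan_at_top) auto
      then show "((\<lambda>u. arctan u / pi) \<longlongrightarrow> 1 / 2) at_top" by simp
    qed (auto simp: cauchy_kernel_nonneg)
    then show ?thesis by simp
  qed
  have sym: "(\<integral>\<^sup>+u. ennreal (cauchy_kernel 1 u) * indicator {..0} u \<partial>lborel) = ennreal (1 / 2)"
    unfolding half[symmetric]
    by (subst nn_integral_real_affine[where c = "-1" and t = 0])
      (auto simp: cauchy_kernel_def indicator_def intro!: nn_integral_cong)
  have "(\<integral>\<^sup>+u. ennreal (cauchy_kernel 1 u) \<partial>lborel)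
      = (\<integral>\<^sup>+u. ennreal (cauchy_kernel 1 u) * indicator {..0} u +
           ennreal (cauchy_kernel 1 u) * indicator {0..} u \<partial>lborel)"
    by (rule nn_integral_cong_AE, rule AE_mp[OF AE_lborel_singleton[of 0]])
      (auto simp: indicator_def intro!: AE_I2)
  also have "\<dots> = 1"
    by (subst nn_integral_add) (simp_all only: half sym ennreal_plus[symmetric], simp_all)
  finally show ?thesis .
qed

lemma nn_integral_cauchy_smoothing:
  assumes [measurable]: "f \<in> borel_measurable borel" and "y > 0"
  shows "(\<integral>\<^sup>+t. f t * ennreal (cauchy_kernel y (t - x)) \<partial>lborel)
    = (\<integral>\<^sup>+u. f (x + y * u) * ennreal (cauchy_kernel 1 u) \<partial>lborel)"
proof -
  have "(\<integral>\<^sup>+t. f t * ennreal (cauchy_kernel y (t - x)) \<partial>lborel)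
      = ennreal \<bar>y\<bar> * (\<integral>\<^sup>+u. f (x + y * u) * ennreal (cauchy_kernel y (y * u)) \<partial>lborel)"
    using \<open>y > 0\<close> by (subst nn_integral_real_affine[where c = y and t = x]) auto
  also have "\<dots> = (\<integral>\<^sup>+u. f (x + y * u) * ennreal (y * cauchy_kernel y (y * u)) \<partial>lborel)"
    using \<open>y > 0\<close> by (subst nn_integral_cmult[symmetric])
      (auto simp: ennreal_mult cauchy_kernel_nonneg mult_ac intro!: nn_integral_cong)
  finally show ?thesis
    unfolding cauchy_kernel_scale[OF \<open>y > 0\<close>] .
qed

definition poisson_integral :: "real measure \<Rightarrow> real \<Rightarrow> real \<Rightarrow> real" where
  "poisson_integral \<mu> y t = (\<integral>x. cauchy_kernel y (t - x) \<partial>\<mu>)"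

context real_distribution
begin

lemma integrable_cauchy_kernel:
  assumes "y > 0"
  shows "integrable M (\<lambda>x. cauchy_kernel y (t - x))"
proof (rule integrable_const_bound[where B = "1 / (pi * y)"])
  show "AE x in M. norm (cauchy_kernel y (t - x)) \<le> 1 / (pi * y)"
  proof (rule AE_I2)
    fix x
    have "y / (pi * ((t - x)\<^sup>2 + y\<^sup>2)) \<le> y / (pi * y\<^sup>2)"
      using assms by (intro divide_left_mono mult_left_mono mult_pos_pos add_nonneg_pos) auto
    then show "norm (cauchy_kernel y (t - x)) \<le> 1 / (pi * y)"
      using assms cauchy_kernel_nonneg[OF assms, of "t - x"]
      by (simp add: cauchy_kernel_def power2_eq_square)
  qed
qed measurable

lemma poisson_integral_eq_nn_integral:
  assumes "y > 0"
  shows "ennreal (poisson_integral M y t) = (\<integral>\<^sup>+x. ennreal (cauchy_kernel y (t - x)) \<partial>M)"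
  unfolding poisson_integral_def
  by (rule nn_integral_eq_integral[symmetric])
    (auto simp: integrable_cauchy_kernel assms cauchy_kernel_nonneg)

lemma poisson_integral_nonneg: "y > 0 \<Longrightarrow> 0 \<le> poisson_integral M y t"
  unfolding poisson_integral_def by (intro integral_nonneg_AE) (simp add: cauchy_kernel_nonneg)

lemma borel_measurable_poisson_integral [measurable]:
  "poisson_integral M y \<in> borel_measurable borel"
  unfolding poisson_integral_def by measurable

lemma nn_integral_poisson_integral:
  assumes [measurable]: "f \<in> borel_measurable borel" and y: "y > 0"
  shows "(\<integral>\<^sup>+t. f t * ennreal (poisson_integral M y t) \<partial>lborel)
    = (\<integral>\<^sup>+x. (\<integral>\<^sup>+u. f (x + y * u) * ennreal (cauchy_kernel 1 u) \<partial>lborel) \<partial>M)"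
proof -
  interpret P: pair_sigma_finite lborel M ..
  have "(\<integral>\<^sup>+t. f t * ennreal (poisson_integral M y t) \<partial>lborel)
      = (\<integral>\<^sup>+t. (\<integral>\<^sup>+x. f t * ennreal (cauchy_kernel y (t - x)) \<partial>M) \<partial>lborel)"
    unfolding poisson_integral_eq_nn_integral[OF y]
    by (intro nn_integral_cong nn_integral_cmult[symmetric]) measurable
  also have "\<dots> = (\<integral>\<^sup>+x. (\<integral>\<^sup>+t. f t * ennreal (cauchy_kernel y (t - x)) \<partial>lborel) \<partial>M)"
    by (rule P.Fubini'[symmetric]) measurable
  finally show ?thesis
    by (simp only: nn_integral_cauchy_smoothing[OF assms])
qed

lemma nn_integral_poisson_integral_1:
  assumes "y > 0"
  shows "(\<integral>\<^sup>+t. ennreal (poisson_integral M y t) \<partial>lborel) = 1"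
  using nn_integral_poisson_integral[of "\<lambda>_. 1" y] assms
  by (simp add: nn_integral_standard_cauchy emeasure_space_1[simplified])

text \<open>
  The smoothed integral is the mean of \<open>f (x + y u)\<close> over \<open>x\<close> and an independent standard Cauchy
  variable \<open>u\<close>. The error bound does not depend on the distribution, so it is uniform along a
  sequence.
\<close>
lemma smoothing_error:
  fixes f w :: "real \<Rightarrow> real"
  assumes [measurable]: "f \<in> borel_measurable borel" "w \<in> borel_measurable borel"
    and f: "\<And>x. 0 \<le> f x" and w: "\<And>x. 0 \<le> w x"
    and y: "y > 0" and fw: "\<And>x u. \<bar>f (x + y * u) - f x\<bar> \<le> w u"
  defines "\<omega> \<equiv> (\<integral>\<^sup>+u. ennreal (w u) * ennreal (cauchy_kernel 1 u) \<partial>lborel)"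
  shows "(\<integral>\<^sup>+t. ennreal (f t) * ennreal (poisson_integral M y t) \<partial>lborel) \<le> (\<integral>\<^sup>+x. ennreal (f x) \<partial>M) + \<omega>"
    and "(\<integral>\<^sup>+x. ennreal (f x) \<partial>M) \<le> (\<integral>\<^sup>+t. ennreal (f t) * ennreal (poisson_integral M y t) \<partial>lborel) + \<omega>"
proof -
  have split: "(\<integral>\<^sup>+u. (ennreal (h u) + ennreal (w u)) * ennreal (cauchy_kernel 1 u) \<partial>lborel)
      = (\<integral>\<^sup>+u. ennreal (h u) * ennreal (cauchy_kernel 1 u) \<partial>lborel) + \<omega>"
    if [measurable]: "h \<in> borel_measurable borel" for h :: "real \<Rightarrow> real"
    unfolding \<omega>_def distrib_right by (rule nn_integral_add) measurable
  have const: "(\<integral>\<^sup>+u. ennreal c * ennreal (cauchy_kernel 1 u) \<partial>lborel) = ennreal c" for c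
    by (subst nn_integral_cmult) (auto simp: nn_integral_standard_cauchy)
  have mass: "(\<integral>\<^sup>+x. g x + \<omega> \<partial>M) = (\<integral>\<^sup>+x. g x \<partial>M) + \<omega>"
    if [measurable]: "g \<in> borel_measurable borel" for g
    by (subst nn_integral_add) (auto simp: emeasure_space_1[simplified])
  have meas [measurable]: "(\<lambda>x. \<integral>\<^sup>+u. ennreal (f (x + y * u)) * ennreal (cauchy_kernel 1 u) \<partial>lborel)
      \<in> borel_measurable borel"
    by measurable
  have upper: "(\<integral>\<^sup>+u. ennreal (f (x + y * u)) * ennreal (cauchy_kernel 1 u) \<partial>lborel) \<le> ennreal (f x) + \<omega>" for x
  proof -
    have "(\<integral>\<^sup>+u. ennreal (f (x + y * u)) * ennreal (cauchy_kernel 1 u) \<partial>lborel)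
        \<le> (\<integral>\<^sup>+u. (ennreal (f x) + ennreal (w u)) * ennreal (cauchy_kernel 1 u) \<partial>lborel)"
    proof (intro nn_integral_mono mult_right_mono)
      fix u
      have "f (x + y * u) \<le> f x + w u" using fw[of x u] by linarith
      then show "ennreal (f (x + y * u)) \<le> ennreal (f x) + ennreal (w u)"
        using f w by (simp add: ennreal_plus[symmetric] ennreal_leI del: ennreal_plus)
    qed auto
    also have "\<dots> = ennreal (f x) + \<omega>"
      by (subst split) (auto simp: const)
    finally show ?thesis .
  qed
  have lower: "ennreal (f x) \<le> (\<integral>\<^sup>+u. ennreal (f (x + y * u)) * ennreal (cauchy_kernel 1 u) \<partial>lborel) + \<omega>" for x
  proof -
    have "ennreal (f x) = (\<integral>\<^sup>+u. ennreal (f x) * ennreal (cauchy_kernel 1 u) \<partial>lborel)"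
      by (simp add: const)
    also have "\<dots> \<le> (\<integral>\<^sup>+u. (ennreal (f (x + y * u)) + ennreal (w u)) * ennreal (cauchy_kernel 1 u) \<partial>lborel)"
    proof (intro nn_integral_mono mult_right_mono)
      fix u
      have "f x \<le> f (x + y * u) + w u" using fw[of x u] by linarith
      then show "ennreal (f x) \<le> ennreal (f (x + y * u)) + ennreal (w u)"
        using f w by (simp add: ennreal_plus[symmetric] ennreal_leI del: ennreal_plus)
    qed auto
    also have "\<dots> = (\<integral>\<^sup>+u. ennreal (f (x + y * u)) * ennreal (cauchy_kernel 1 u) \<partial>lborel) + \<omega>"
      by (rule split) measurable
    finally show ?thesis .
  qed
  have P: "(\<integral>\<^sup>+t. ennreal (f t) * ennreal (poisson_integral M y t) \<partial>lborel)
      = (\<integral>\<^sup>+x. (\<integral>\<^sup>+u. ennreal (f (x + y * u)) * ennreal (cauchy_kernel 1 u) \<partial>lborel) \<partial>M)"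
    by (rule nn_integral_poisson_integral) (use y in auto)
  have "(\<integral>\<^sup>+x. (\<integral>\<^sup>+u. ennreal (f (x + y * u)) * ennreal (cauchy_kernel 1 u) \<partial>lborel) \<partial>M)
      \<le> (\<integral>\<^sup>+x. ennreal (f x) + \<omega> \<partial>M)"
    by (intro nn_integral_mono upper)
  then show "(\<integral>\<^sup>+t. ennreal (f t) * ennreal (poisson_integral M y t) \<partial>lborel) \<le> (\<integral>\<^sup>+x. ennreal (f x) \<partial>M) + \<omega>"
    unfolding P by (simp add: mass)
  have "(\<integral>\<^sup>+x. ennreal (f x) \<partial>M) \<le>
      (\<integral>\<^sup>+x. (\<integral>\<^sup>+u. ennreal (f (x + y * u)) * ennreal (cauchy_kernel 1 u) \<partial>lborel) + \<omega> \<partial>M)"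
    by (intro nn_integral_mono lower)
  then show "(\<integral>\<^sup>+x. ennreal (f x) \<partial>M) \<le> (\<integral>\<^sup>+t. ennreal (f t) * ennreal (poisson_integral M y t) \<partial>lborel) + \<omega>"
    unfolding P by (simp add: mass)
qed

end

lemma cts_step_bounds: "a < b \<Longrightarrow> 0 \<le> cts_step a b x \<and> cts_step a b x \<le> 1"
  by (auto simp: cts_step_def divide_simps)

lemma cts_step_lipschitz:
  assumes "a < b"
  shows "\<bar>cts_step a b x - cts_step a b x'\<bar> \<le> \<bar>x - x'\<bar> / (b - a)"
  using assms by (auto simp: cts_step_def divide_simps abs_if)

lemma cauchy_kernel_eq_Im: "cauchy_kernel y u = - Im (1 / Complex u y) / pi"
  by (simp add: cauchy_kernel_def Im_divide power2_eq_square)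

lemma cauchy_kernel_lipschitz:
  assumes "y > 0"
  shows "\<bar>cauchy_kernel y u - cauchy_kernel y v\<bar> \<le> \<bar>u - v\<bar> / (pi * y\<^sup>2)"
proof -
  have nz: "Complex u y \<noteq> 0" "Complex v y \<noteq> 0" using assms by (auto simp: complex_eq_iff)
  have ge: "y \<le> norm (Complex t y)" for t
    using abs_Im_le_cmod[of "Complex t y"] by simp
  have "1 / Complex u y - 1 / Complex v y = (Complex v y - Complex u y) / (Complex u y * Complex v y)"
    using nz by (simp add: divide_simps)
  also have "Complex v y - Complex u y = of_real (v - u)" by (simp add: complex_eq_iff)
  finally have "norm (1 / Complex u y - 1 / Complex v y) = \<bar>u - v\<bar> / (norm (Complex u y) * norm (Complex v y))"
    by (simp only: norm_divide norm_mult norm_of_real abs_minus_commute)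
  also have "\<dots> \<le> \<bar>u - v\<bar> / (y * y)"
    using assms ge[of u] ge[of v] by (intro divide_left_mono mult_mono mult_pos_pos) auto
  finally have "\<bar>Im (1 / Complex u y - 1 / Complex v y)\<bar> \<le> \<bar>u - v\<bar> / y\<^sup>2"
    using abs_Im_le_cmod order.trans by (fastforce simp: power2_eq_square)
  then have "\<bar>Im (1 / Complex u y - 1 / Complex v y)\<bar> / pi \<le> \<bar>u - v\<bar> / y\<^sup>2 / pi"
    by (rule divide_right_mono) simp
  moreover have "cauchy_kernel y u - cauchy_kernel y v = - Im (1 / Complex u y - 1 / Complex v y) / pi"
    unfolding cauchy_kernel_eq_Im minus_complex.sel by (simp add: diff_divide_distrib)
  ultimately show ?thesis
    by (simp add: mult.commute abs_minus_commute)
qed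

lemma (in real_distribution) poisson_integral_lipschitz:
  assumes "y > 0"
  shows "\<bar>poisson_integral M y s - poisson_integral M y t\<bar> \<le> \<bar>s - t\<bar> / (pi * y\<^sup>2)"
proof -
  have "poisson_integral M y s - poisson_integral M y t
      = (\<integral>x. cauchy_kernel y (s - x) - cauchy_kernel y (t - x) \<partial>M)"
    unfolding poisson_integral_def
    by (rule Bochner_Integration.integral_diff[symmetric]) (intro integrable_cauchy_kernel assms)+
  also have "\<bar>\<dots>\<bar> \<le> (\<integral>x. \<bar>cauchy_kernel y (s - x) - cauchy_kernel y (t - x)\<bar> \<partial>M)"
    by (rule integral_abs_bound)
  also have "\<dots> \<le> (\<integral>x. \<bar>s - t\<bar> / (pi * y\<^sup>2) \<partial>M)"
  proof (rule integral_mono)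
    show "\<bar>cauchy_kernel y (s - x) - cauchy_kernel y (t - x)\<bar> \<le> \<bar>s - t\<bar> / (pi * y\<^sup>2)" for x
      using cauchy_kernel_lipschitz[OF assms, of "s - x" "t - x"] by simp
  qed (auto intro!: integrable_cauchy_kernel assms)
  finally show ?thesis using prob_space by simp
qed

lemma poisson_integrals_converge_everywhere:
  assumes \<mu>_n: "\<And>n. real_distribution (\<mu>_n n)" and \<mu>: "real_distribution \<mu>" and y: "y > 0"
    and conv: "\<And>q. q \<in> \<rat> \<Longrightarrow> (\<lambda>n. poisson_integral (\<mu>_n n) y q) \<longlonglongrightarrow> poisson_integral \<mu> y q"
  shows "(\<lambda>n. poisson_integral (\<mu>_n n) y t) \<longlonglongrightarrow> poisson_integral \<mu> y t"
proof (rule LIMSEQ_I)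
  fix e :: real assume e: "0 < e"
  define c where "c = pi * y\<^sup>2"
  have c: "c > 0" using y by (simp add: c_def)
  have "t < t + c * (e / 3)" using c e by simp
  then obtain q where q: "q \<in> \<rat>" "t < q" "q < t + c * (e / 3)" using Rats_dense_in_real by blast
  have "\<bar>t - q\<bar> / c < e / 3"
  proof -
    have "\<bar>t - q\<bar> < e / 3 * c" using q by (simp add: mult.commute)
    then show ?thesis using c by (simp add: pos_divide_less_eq)
  qed
  then have lip: "\<bar>poisson_integral \<nu> y t - poisson_integral \<nu> y q\<bar> < e / 3" if "real_distribution \<nu>" for \<nu>
    using real_distribution.poisson_integral_lipschitz[OF that y, of t q] unfolding c_def by linarith
  have "\<exists>N. \<forall>n\<ge>N. norm (poisson_integral (\<mu>_n n) y q - poisson_integral \<mu> y q) < e / 3"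
    using LIMSEQ_D[OF conv[OF q(1)], of "e / 3"] e by simp
  then obtain N where N: "\<bar>poisson_integral (\<mu>_n n) y q - poisson_integral \<mu> y q\<bar> < e / 3" if "n \<ge> N" for n
    by auto
  have "norm (poisson_integral (\<mu>_n n) y t - poisson_integral \<mu> y t) < e" if "n \<ge> N" for n
    using N[OF that] lip[OF \<mu>_n[of n]] lip[OF \<mu>] unfolding real_norm_def by linarith
  then show "\<exists>N. \<forall>n\<ge>N. norm (poisson_integral (\<mu>_n n) y t - poisson_integral \<mu> y t) < e" by blast
qed

text \<open>
  The smoothed measures are probability densities, so their pointwise convergence is convergence in
  \<open>L\<^sup>1\<close> by Scheffe's lemma. Rational points suffice because the smoothed densities are
  equi-Lipschitz.
\<close>
theorem weak_conv_m_if_poisson_integrals_converge: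
  assumes \<mu>_n: "\<And>n. real_distribution (\<mu>_n n)" and \<mu>: "real_distribution \<mu>"
    and conv: "\<And>k q. q \<in> \<rat> \<Longrightarrow> (\<lambda>n. poisson_integral (\<mu>_n n) (1 / real (Suc k)) q)
      \<longlonglongrightarrow> poisson_integral \<mu> (1 / real (Suc k)) q"
  shows "weak_conv_m \<mu>_n \<mu>"
proof (rule integral_cts_step_conv_imp_weak_conv[OF \<mu>_n \<mu>])
  fix a b :: real assume ab: "a < b"
  let ?f = "cts_step a b"
  define y where "y k = 1 / real (Suc k)" for k
  have y: "y k > 0" for k by (simp add: y_def)
  define w where "w k u = min 1 (y k * \<bar>u\<bar> / (b - a))" for k u
  define \<omega> where "\<omega> k = (\<integral>\<^sup>+u. ennreal (w k u) * ennreal (cauchy_kernel 1 u) \<partial>lborel)" for k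
  define D where "D k n = (\<integral>\<^sup>+t. ennreal (norm (poisson_integral (\<mu>_n n) (y k) t - poisson_integral \<mu> (y k) t)) \<partial>lborel)"
    for k n
  have f_meas [measurable]: "?f \<in> borel_measurable borel"
    unfolding cts_step_def by measurable
  have w_meas [measurable]: "w k \<in> borel_measurable borel" for k
    unfolding w_def by measurable
  have w_nonneg: "0 \<le> w k u" for k u
    using ab y[of k] by (simp add: w_def)
  have f_nonneg: "0 \<le> ?f x" for x using cts_step_bounds[OF ab] by simp
  have fw: "\<bar>?f (x + y k * u) - ?f x\<bar> \<le> w k u" for x k u
    using cts_step_lipschitz[OF ab, of "x + y k * u" x] cts_step_bounds[OF ab, of x]
      cts_step_bounds[OF ab, of "x + y k * u"] y[of k]
    by (auto simp: w_def abs_mult)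
  have "\<omega> \<longlonglongrightarrow> (\<integral>\<^sup>+u. 0 \<partial>(lborel :: real measure))"
    unfolding \<omega>_def
  proof (rule nn_integral_dominated_convergence[where w = "\<lambda>u. ennreal (cauchy_kernel 1 u)"])
    show "AE u in lborel. ennreal (w k u) * ennreal (cauchy_kernel 1 u) \<le> ennreal (cauchy_kernel 1 u)" for k
    proof (rule AE_I2)
      fix u
      have "ennreal (w k u) * ennreal (cauchy_kernel 1 u) \<le> 1 * ennreal (cauchy_kernel 1 u)"
        by (intro mult_right_mono) (auto simp: w_def simp flip: ennreal_1 intro!: ennreal_leI)
      then show "ennreal (w k u) * ennreal (cauchy_kernel 1 u) \<le> ennreal (cauchy_kernel 1 u)" by simp
    qed
    show "AE u in lborel. (\<lambda>k. ennreal (w k u) * ennreal (cauchy_kernel 1 u)) \<longlonglongrightarrow> 0"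
    proof (rule AE_I2)
      fix u :: real
      have "y \<longlonglongrightarrow> 0"
        unfolding y_def using LIMSEQ_inverse_real_of_nat by (simp add: inverse_eq_divide)
      then have "(\<lambda>k. min 1 (y k * \<bar>u\<bar> / (b - a))) \<longlonglongrightarrow> min 1 (0 * \<bar>u\<bar> / (b - a))"
        by (intro tendsto_intros) (use ab in auto)
      then have "(\<lambda>k. w k u) \<longlonglongrightarrow> 0" by (simp add: w_def)
      then have "(\<lambda>k. ennreal (w k u * cauchy_kernel 1 u)) \<longlonglongrightarrow> ennreal (0 * cauchy_kernel 1 u)"
        by (intro tendsto_intros)
      then show "(\<lambda>k. ennreal (w k u) * ennreal (cauchy_kernel 1 u)) \<longlonglongrightarrow> 0"
        by (simp add: ennreal_mult w_nonneg cauchy_kernel_nonneg)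
    qed
  qed (auto simp: nn_integral_standard_cauchy)
  then have \<omega>_lim: "\<omega> \<longlonglongrightarrow> 0" by simp
  have D_lim: "D k \<longlonglongrightarrow> 0" for k
    unfolding D_def
  proof (rule Scheffe_lemma2)
    interpret \<mu>: real_distribution \<mu> by (rule \<mu>)
    show "poisson_integral (\<mu>_n n) (y k) \<in> borel_measurable lborel" for n
      using real_distribution.borel_measurable_poisson_integral[OF \<mu>_n] by simp
    show "integrable lborel (poisson_integral \<mu> (y k))"
      using \<mu>.nn_integral_poisson_integral_1[OF y] \<mu>.poisson_integral_nonneg[OF y]
      by (intro integrableI_nonneg) auto
    show "AE t in lborel. (\<lambda>n. poisson_integral (\<mu>_n n) (y k) t) \<longlonglongrightarrow> poisson_integral \<mu> (y k) t"
    proof (rule AE_I2)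
      fix t
      show "(\<lambda>n. poisson_integral (\<mu>_n n) (y k) t) \<longlonglongrightarrow> poisson_integral \<mu> (y k) t"
        by (rule poisson_integrals_converge_everywhere[OF \<mu>_n \<mu> y]) (use conv in \<open>simp add: y_def\<close>)
    qed
    show "(\<integral>\<^sup>+t. norm (poisson_integral (\<mu>_n n) (y k) t) \<partial>lborel)
        \<le> (\<integral>\<^sup>+t. norm (poisson_integral \<mu> (y k) t) \<partial>lborel)" for n
      using \<mu>.nn_integral_poisson_integral_1[OF y] \<mu>.poisson_integral_nonneg[OF y]
        real_distribution.nn_integral_poisson_integral_1[OF \<mu>_n y]
        real_distribution.poisson_integral_nonneg[OF \<mu>_n y]
      by simp
  qed
  have compare: "(\<integral>\<^sup>+x. ennreal (?f x) \<partial>\<mu>1) \<le> (\<integral>\<^sup>+x. ennreal (?f x) \<partial>\<mu>2) + 2 * \<omega> k +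
      (\<integral>\<^sup>+t. ennreal (norm (poisson_integral \<mu>1 (y k) t - poisson_integral \<mu>2 (y k) t)) \<partial>lborel)"
    if "real_distribution \<mu>1" "real_distribution \<mu>2" for \<mu>1 \<mu>2 k
  proof -
    interpret m1: real_distribution \<mu>1 by fact
    interpret m2: real_distribution \<mu>2 by fact
    let ?d = "\<lambda>t. ennreal (norm (poisson_integral \<mu>1 (y k) t - poisson_integral \<mu>2 (y k) t))"
    have "(\<integral>\<^sup>+x. ennreal (?f x) \<partial>\<mu>1) \<le>
        (\<integral>\<^sup>+t. ennreal (?f t) * ennreal (poisson_integral \<mu>1 (y k) t) \<partial>lborel) + \<omega> k"
      unfolding \<omega>_def by (rule m1.smoothing_error(2)) (auto simp: f_nonneg w_nonneg y fw)
    also have "(\<integral>\<^sup>+t. ennreal (?f t) * ennreal (poisson_integral \<mu>1 (y k) t) \<partial>lborel)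
        \<le> (\<integral>\<^sup>+t. ennreal (?f t) * ennreal (poisson_integral \<mu>2 (y k) t) + ?d t \<partial>lborel)"
    proof (rule nn_integral_mono)
      fix t
      have "?f t * poisson_integral \<mu>1 (y k) t \<le>
          ?f t * poisson_integral \<mu>2 (y k) t + 1 * norm (poisson_integral \<mu>1 (y k) t - poisson_integral \<mu>2 (y k) t)"
      proof -
        have "?f t * (poisson_integral \<mu>1 (y k) t - poisson_integral \<mu>2 (y k) t)
            \<le> ?f t * norm (poisson_integral \<mu>1 (y k) t - poisson_integral \<mu>2 (y k) t)"
          using f_nonneg by (intro mult_left_mono) auto
        also have "\<dots> \<le> 1 * norm (poisson_integral \<mu>1 (y k) t - poisson_integral \<mu>2 (y k) t)"
          using cts_step_bounds[OF ab] by (intro mult_right_mono) auto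
        finally show ?thesis by (simp add: algebra_simps)
      qed
      then have "ennreal (?f t * poisson_integral \<mu>1 (y k) t) \<le> ennreal (?f t * poisson_integral \<mu>2 (y k) t +
           norm (poisson_integral \<mu>1 (y k) t - poisson_integral \<mu>2 (y k) t))"
        by (intro ennreal_leI) simp
      then show "ennreal (?f t) * ennreal (poisson_integral \<mu>1 (y k) t)
          \<le> ennreal (?f t) * ennreal (poisson_integral \<mu>2 (y k) t) + ?d t"
        using f_nonneg m1.poisson_integral_nonneg[OF y] m2.poisson_integral_nonneg[OF y]
        by (simp add: ennreal_mult[symmetric])
    qed
    also have "\<dots> = (\<integral>\<^sup>+t. ennreal (?f t) * ennreal (poisson_integral \<mu>2 (y k) t) \<partial>lborel) + (\<integral>\<^sup>+t. ?d t \<partial>lborel)"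
      by (rule nn_integral_add) auto
    also have "(\<integral>\<^sup>+t. ennreal (?f t) * ennreal (poisson_integral \<mu>2 (y k) t) \<partial>lborel)
        \<le> (\<integral>\<^sup>+x. ennreal (?f x) \<partial>\<mu>2) + \<omega> k"
      unfolding \<omega>_def by (rule m2.smoothing_error(1)) (auto simp: f_nonneg w_nonneg y fw)
    finally show ?thesis
      by (simp add: add_ac mult_2 add_mono)
  qed
  have real: "(\<integral>\<^sup>+x. ennreal (?f x) \<partial>\<mu>1) = ennreal (integral\<^sup>L \<mu>1 ?f)"
    if "real_distribution \<mu>1" for \<mu>1
    using real_distribution.integrable_cts_step[OF that ab] f_nonneg
    by (intro nn_integral_eq_integral) auto
  have nonneg: "0 \<le> integral\<^sup>L \<mu>1 ?f" for \<mu>1 using f_nonneg by simp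
  show "(\<lambda>n. integral\<^sup>L (\<mu>_n n) ?f) \<longlonglongrightarrow> integral\<^sup>L \<mu> ?f"
  proof (rule LIMSEQ_I)
    fix r :: real assume r: "0 < r"
    have "\<forall>\<^sub>F k in sequentially. \<omega> k < ennreal (r / 4)"
      using \<omega>_lim r by (intro order_tendstoD) auto
    then obtain k where k: "\<omega> k < ennreal (r / 4)" by (auto simp: eventually_sequentially)
    have "\<forall>\<^sub>F n in sequentially. D k n < ennreal (r / 4)"
      using D_lim r by (intro order_tendstoD) auto
    then obtain N where N: "D k n < ennreal (r / 4)" if "n \<ge> N" for n
      by (auto simp: eventually_sequentially)
    have "norm (integral\<^sup>L (\<mu>_n n) ?f - integral\<^sup>L \<mu> ?f) < r" if "n \<ge> N" for n
    proof -
      have err: "2 * \<omega> k + D k n \<le> ennreal (3 * r / 4)"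
      proof -
        have "2 * \<omega> k + D k n \<le> 2 * ennreal (r / 4) + ennreal (r / 4)"
          using k N[OF that] by (intro add_mono mult_left_mono) auto
        also have "\<dots> = ennreal (3 * r / 4)"
          using r by (simp add: mult_2 ennreal_plus[symmetric] del: ennreal_plus)
        finally show ?thesis .
      qed
      have le: "integral\<^sup>L \<mu>1 ?f \<le> integral\<^sup>L \<mu>2 ?f + 3 * r / 4"
        if "real_distribution \<mu>1" "real_distribution \<mu>2"
          "(\<integral>\<^sup>+t. ennreal (norm (poisson_integral \<mu>1 (y k) t - poisson_integral \<mu>2 (y k) t)) \<partial>lborel) = D k n"
        for \<mu>1 \<mu>2
      proof -
        have "ennreal (integral\<^sup>L \<mu>1 ?f) \<le> ennreal (integral\<^sup>L \<mu>2 ?f) + (2 * \<omega> k + D k n)"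
          using compare[OF that(1,2), of k] by (simp only: real that add.assoc)
        also have "\<dots> \<le> ennreal (integral\<^sup>L \<mu>2 ?f) + ennreal (3 * r / 4)"
          using err by (intro add_left_mono)
        also have "\<dots> = ennreal (integral\<^sup>L \<mu>2 ?f + 3 * r / 4)"
          using r nonneg by (intro ennreal_plus[symmetric]) auto
        finally show ?thesis
          using r nonneg[of \<mu>2] by (subst (asm) ennreal_le_iff) auto
      qed
      have "integral\<^sup>L (\<mu>_n n) ?f \<le> integral\<^sup>L \<mu> ?f + 3 * r / 4"
        by (rule le[OF \<mu>_n \<mu>]) (simp add: D_def)
      moreover have "integral\<^sup>L \<mu> ?f \<le> integral\<^sup>L (\<mu>_n n) ?f + 3 * r / 4"
        by (rule le[OF \<mu> \<mu>_n]) (simp add: D_def abs_minus_commute)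
      ultimately show ?thesis using r by (simp add: abs_less_iff)
    qed
    then show "\<exists>no. \<forall>n\<ge>no. norm (integral\<^sup>L (\<mu>_n n) ?f - integral\<^sup>L \<mu> ?f) < r" by blast
  qed
qed

section \<open>Convergence of the resolvents and of the empirical measures\<close>

text \<open>
  The sign condition keeps the sequence at a positive distance from the wrong root \<open>G'\<close>, so the
  other factor has to vanish.
\<close>
lemma tendsto_root_if_quadratic_tendsto_0:
  fixes X :: "nat \<Rightarrow> complex" and E G G' v :: complex and v' :: "nat \<Rightarrow> complex"
  assumes Q: "(\<lambda>n. E * ((X n - G) * (X n - G'))) \<longlonglongrightarrow> 0" and E: "E \<noteq> 0"
    and v: "v' \<longlonglongrightarrow> v" and bound: "\<And>n. norm (X n) \<le> C"
    and sign: "\<forall>\<^sub>F n in sequentially. Im (v' n * X n) \<le> 0" and pos: "Im (v * G') > 0"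
  shows "X \<longlonglongrightarrow> G"
proof -
  define d where "d = Im (v * G')"
  have C: "C \<ge> 0" using bound[of 0] norm_ge_zero order.trans by blast
  have v0: "norm v > 0" using pos by auto
  have "(\<lambda>n. norm (v - v' n) * C) \<longlonglongrightarrow> norm (v - v) * C"
    by (intro tendsto_intros v)
  then have "\<forall>\<^sub>F n in sequentially. norm (v - v' n) * C < d / 2"
    using pos by (intro order_tendstoD(2)) (auto simp: d_def)
  \<comment> \<open>The imaginary part separates \<open>X n\<close> from \<open>G'\<close>.\<close>
  with sign have far: "\<forall>\<^sub>F n in sequentially. d / (2 * norm v) \<le> norm (X n - G')"
  proof eventually_elim
    case (elim n)
    have "norm ((v - v' n) * X n) \<le> norm (v - v' n) * C"
      unfolding norm_mult by (intro mult_left_mono bound) auto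
    then have "Im ((v - v' n) * X n) < d / 2"
      using elim abs_Im_le_cmod[of "(v - v' n) * X n"] by linarith
    moreover have "Im (v * (G' - X n)) = d - Im (v' n * X n) - Im ((v - v' n) * X n)"
      unfolding d_def by (simp add: algebra_simps)
    ultimately have "d / 2 \<le> Im (v * (G' - X n))" using elim by linarith
    also have "\<dots> \<le> norm (v * (G' - X n))" using abs_Im_le_cmod[of "v * (G' - X n)"] by linarith
    also have "\<dots> = norm v * norm (X n - G')" by (simp add: norm_mult norm_minus_commute)
    finally show ?case using v0 by (simp add: field_simps)
  qed
  have "(\<lambda>n. norm (E * ((X n - G) * (X n - G'))) / (norm E * (d / (2 * norm v)))) \<longlonglongrightarrow> 0 / (norm E * (d / (2 * norm v)))"
    by (intro tendsto_divide tendsto_norm_zero Q tendsto_const) (use E v0 pos in \<open>auto simp: d_def\<close>)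
  then have lim: "(\<lambda>n. norm (E * ((X n - G) * (X n - G'))) / (norm E * (d / (2 * norm v)))) \<longlonglongrightarrow> 0" by simp
  have "\<forall>\<^sub>F n in sequentially. norm (X n - G) \<le> norm (E * ((X n - G) * (X n - G'))) / (norm E * (d / (2 * norm v)))"
    using far
  proof eventually_elim
    case (elim n)
    have dd: "0 < norm E * (d / (2 * norm v))" using E v0 pos by (simp add: d_def)
    have "norm (X n - G) * (norm E * (d / (2 * norm v))) \<le> norm (X n - G) * (norm E * norm (X n - G'))"
      using elim by (intro mult_left_mono) auto
    also have "\<dots> = norm (E * ((X n - G) * (X n - G')))" by (simp add: norm_mult)
    finally show ?case unfolding pos_le_divide_eq[OF dd] .
  qed
  then have "(\<lambda>n. X n - G) \<longlonglongrightarrow> 0"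
    by (rule Lim_null_comparison[OF _ lim])
  then show ?thesis by (rule LIM_zero_cancel)
qed

lemma resolvent_mean_tendsto:
  fixes x :: "nat \<Rightarrow> nat \<Rightarrow> real" and z :: complex
  assumes J: "jacobi_limit \<gamma> \<sigma>"
    and p1: "\<And>n. n \<ge> 1 \<Longrightarrow> p1 n \<ge> real n" and p2: "\<And>n. n \<ge> 1 \<Longrightarrow> p2 n \<ge> real n"
    and \<gamma>: "(\<lambda>n. real n / p1 n) \<longlonglongrightarrow> \<gamma>" and \<sigma>: "(\<lambda>n. p1 n / p2 n) \<longlonglongrightarrow> \<sigma>"
    and x: "\<And>n i. n \<ge> 1 \<Longrightarrow> i < n \<Longrightarrow> x n i \<le> 1" and z: "Im z > 0"
    and L: "(\<lambda>n. loop_sum n (p1 n) (p2 n) (spectral_point n (p1 n) (p2 n) z) (x n) / of_real (real n * p2 n)) \<longlonglongrightarrow> 0"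
  shows "(\<lambda>n. resolvent_mean n (rescaled n (p1 n) (p2 n) (x n)) z) \<longlonglongrightarrow> (\<integral>t. 1 / (z - of_real t) \<partial>limit_measure \<gamma> \<sigma>)"
proof -
  interpret J: jacobi_limit \<gamma> \<sigma> by fact
  define Z where "Z = 2 / of_real J.r * (z - of_real J.m)"
  have "Z = of_real (2 / J.r) * (z - of_real J.m)" by (simp add: Z_def)
  then have "Im Z = 2 / J.r * Im z" by (simp only: times_complex.sel Re_complex_of_real Im_complex_of_real) simp
  then have "Im Z > 0" using z J.r_pos by simp
  then obtain w where w: "norm w < 1" "Im w < 0" "Z = w + 1 / w"
    by (rule joukowski_preimage)
  define v where "v = 1 / w"
  have wv: "w * v = 1" using w(2) by (auto simp: v_def)
  have z_eq: "z = of_real J.m + of_real (J.r / 2) * (w + v)"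
  proof -
    have "of_real (J.r / 2) * (2 / of_real J.r * X) = X" for X :: complex
      using J.r_pos by simp
    from this[of "z - of_real J.m"] show ?thesis
      unfolding v_def w(3)[symmetric] Z_def by (metis add.commute diff_add_cancel)
  qed
  have Im_w: "Im w \<noteq> 0" using w by simp
  have limit: "(\<integral>t. 1 / (z - of_real t) \<partial>limit_measure \<gamma> \<sigma>) = J.resolvent_branch w"
    by (rule J.stieltjes_limit_measure[OF w(1,2) z_eq[unfolded v_def] z])
  define s where "s = (\<lambda>n. complex_of_real (sqrt (real n / p1 n)))"
  define \<rho> where "\<rho> = (\<lambda>n. complex_of_real (p1 n / p2 n))"
  define G where "G = (\<lambda>n. resolvent_mean n (rescaled n (p1 n) (p2 n) (x n)) z)"
  define G2 where "G2 = (\<lambda>n. resolvent_square_mean n (rescaled n (p1 n) (p2 n) (x n)) z)"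
  define q where "q = (\<lambda>n. (1 + s n * z) * (1 - \<rho> n * s n * z))"
  define k where "k = (\<lambda>n. (1 + \<rho> n - 2 * \<rho> n * (s n)\<^sup>2) * z + s n * (1 - \<rho> n))"
  define c where "c = (\<lambda>n. 1 + \<rho> n - \<rho> n * (s n)\<^sup>2)"
  define k1 where "k1 = (\<lambda>n. s n * (1 - \<rho> n) - 2 * \<rho> n * (s n)\<^sup>2 * z)"
  define e where "e = (\<lambda>n. (- q n * G2 n + k1 n * G n + \<rho> n * (s n)\<^sup>2) / of_nat n)"
  define E where "E = J.edge_factor z"
  define K where "K = of_real J.edge_slope * z + of_real (sqrt \<gamma> * (1 - \<sigma>))"
  define C where "C = complex_of_real (1 + \<sigma> - \<sigma> * \<gamma>)"
  have s_lim: "s \<longlonglongrightarrow> of_real (sqrt \<gamma>)"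
    unfolding s_def by (intro tendsto_of_real tendsto_real_sqrt \<gamma>)
  have \<rho>_lim: "\<rho> \<longlonglongrightarrow> of_real \<sigma>"
    unfolding \<rho>_def by (intro tendsto_of_real \<sigma>)
  have s2: "(complex_of_real (sqrt \<gamma>))\<^sup>2 = of_real \<gamma>"
    using J.\<gamma>(1) by (simp flip: of_real_power)
  have q_lim: "q \<longlonglongrightarrow> E"
    unfolding q_def E_def J.edge_factor_def of_real_mult by (intro tendsto_intros s_lim \<rho>_lim)
  have k_lim: "k \<longlonglongrightarrow> K"
  proof -
    have "k \<longlonglongrightarrow> (1 + of_real \<sigma> - 2 * of_real \<sigma> * (of_real (sqrt \<gamma>))\<^sup>2) * z + of_real (sqrt \<gamma>) * (1 - of_real \<sigma>)"
      unfolding k_def by (intro tendsto_intros s_lim \<rho>_lim)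
    then show ?thesis unfolding s2 K_def J.edge_slope_def by simp
  qed
  have c_lim: "c \<longlonglongrightarrow> C"
  proof -
    have "c \<longlonglongrightarrow> 1 + of_real \<sigma> - of_real \<sigma> * (of_real (sqrt \<gamma>))\<^sup>2"
      unfolding c_def by (intro tendsto_intros s_lim \<rho>_lim)
    then show ?thesis unfolding s2 C_def by simp
  qed
  have G_bound: "norm (G n) \<le> 1 / Im z" and G2_bound: "norm (G2 n) \<le> (1 / Im z)\<^sup>2" for n
    unfolding G_def G2_def by (rule norm_resolvent_mean_le[OF z] norm_resolvent_square_mean_le[OF z])+
  have G_sq_bound: "norm ((G n)\<^sup>2) \<le> (1 / Im z)\<^sup>2" for n
    unfolding norm_power using G_bound[of n] by (intro power_mono) auto
  have small: "(\<lambda>n. f n * g n) \<longlonglongrightarrow> 0"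
    if "f \<longlonglongrightarrow> 0" "\<And>n. norm (g n) \<le> B" for f g :: "nat \<Rightarrow> complex" and B
  proof (rule lim_null_mult_right_bounded[OF that(1)])
    show "\<forall>\<^sub>F n in sequentially. norm (g n) \<le> B"
      using that(2) by (intro always_eventually) blast
  qed
  have inv_n: "(\<lambda>n. 1 / of_nat n :: complex) \<longlonglongrightarrow> 0"
    using lim_inverse_n[where 'a = complex] by (simp add: inverse_eq_divide)
  have e_lim: "e \<longlonglongrightarrow> 0"
  proof -
    have "(\<lambda>n. - (q n * (1 / of_nat n)) * G2 n + k1 n * (1 / of_nat n) * G n + \<rho> n * (s n)\<^sup>2 * (1 / of_nat n)) \<longlonglongrightarrow> 0 + 0 + of_real \<sigma> * (of_real (sqrt \<gamma>))\<^sup>2 * 0"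
    proof (intro tendsto_add)
      have "(\<lambda>n. - (q n * (1 / of_nat n))) \<longlonglongrightarrow> - (E * 0)" by (intro tendsto_intros q_lim inv_n)
      then show "(\<lambda>n. - (q n * (1 / of_nat n)) * G2 n) \<longlonglongrightarrow> 0" by (intro small[OF _ G2_bound]) simp
      have "(\<lambda>n. k1 n * (1 / of_nat n)) \<longlonglongrightarrow>
          (of_real (sqrt \<gamma>) * (1 - of_real \<sigma>) - 2 * of_real \<sigma> * (of_real (sqrt \<gamma>))\<^sup>2 * z) * 0"
        unfolding k1_def by (intro tendsto_intros s_lim \<rho>_lim inv_n)
      then show "(\<lambda>n. k1 n * (1 / of_nat n) * G n) \<longlonglongrightarrow> 0" by (intro small[OF _ G_bound]) simp
      show "(\<lambda>n. \<rho> n * (s n)\<^sup>2 * (1 / of_nat n)) \<longlonglongrightarrow> of_real \<sigma> * (of_real (sqrt \<gamma>))\<^sup>2 * 0"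
        by (intro tendsto_intros s_lim \<rho>_lim inv_n)
    qed
    moreover have "e = (\<lambda>n. - (q n * (1 / of_nat n)) * G2 n + k1 n * (1 / of_nat n) * G n + \<rho> n * (s n)\<^sup>2 * (1 / of_nat n))"
      by (rule ext) (simp add: e_def add_divide_distrib diff_divide_distrib)
    ultimately have "e \<longlonglongrightarrow> 0 + 0 + of_real \<sigma> * (of_real (sqrt \<gamma>))\<^sup>2 * 0"
      by (simp only:)
    then show ?thesis by simp
  qed
  let ?L = "\<lambda>n. loop_sum n (p1 n) (p2 n) (spectral_point n (p1 n) (p2 n) z) (x n) / of_real (real n * p2 n)"
  have eq: "2 * ?L n = q n * (G n)\<^sup>2 - k n * G n + c n + e n" if "n \<ge> 1" for n
    unfolding q_def k_def c_def e_def k1_def G_def G2_def s_def \<rho>_def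
    using loop_sum_eq_quadratic[OF that p1[OF that] p2[OF that] z, of "x n"] by (simp only: mult_minus_left)
  \<comment> \<open>Replacing the coefficients by their limits costs o(1) because the resolvents are bounded.\<close>
  have rhs_lim: "(\<lambda>n. 2 * ?L n - e n - (q n - E) * (G n)\<^sup>2 + (k n - K) * G n - (c n - C)) \<longlonglongrightarrow> 2 * 0 - 0 - 0 + 0 - 0"
  proof (intro tendsto_add tendsto_diff tendsto_mult_left L e_lim)
    show "(\<lambda>n. (q n - E) * (G n)\<^sup>2) \<longlonglongrightarrow> 0" by (intro small[OF _ G_sq_bound] LIM_zero q_lim)
    show "(\<lambda>n. (k n - K) * G n) \<longlonglongrightarrow> 0" by (intro small[OF _ G_bound] LIM_zero k_lim)
    show "(\<lambda>n. c n - C) \<longlonglongrightarrow> 0" by (intro LIM_zero c_lim)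
  qed
  have "(\<lambda>n. E * (G n)\<^sup>2 - K * G n + C) \<longlonglongrightarrow> 0"
  proof (rule Lim_transform_eventually[OF rhs_lim[unfolded mult_zero_right diff_zero add_0_right]])
    show "\<forall>\<^sub>F n in sequentially. 2 * ?L n - e n - (q n - E) * (G n)\<^sup>2 + (k n - K) * G n - (c n - C) = E * (G n)\<^sup>2 - K * G n + C"
      using eventually_ge_at_top[of 1]
    proof eventually_elim
      case (elim n)
      show ?case unfolding eq[OF elim] by (simp add: algebra_simps)
    qed
  qed
  then have quad: "(\<lambda>n. E * ((G n - J.resolvent_branch w) * (G n - J.resolvent_branch v))) \<longlonglongrightarrow> 0"
    unfolding E_def K_def C_def J.loop_equation_factorization(2)[OF wv z_eq Im_w] .
  have "G \<longlonglongrightarrow> J.resolvent_branch w"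
  proof (rule tendsto_root_if_quadratic_tendsto_0[OF quad])
    show "E \<noteq> 0" unfolding E_def by (rule J.loop_equation_factorization(1)[OF wv z_eq Im_w])
    show "(\<lambda>n. 1 - \<rho> n * s n * z) \<longlonglongrightarrow> 1 - of_real (\<sigma> * sqrt \<gamma>) * z"
      unfolding of_real_mult by (intro tendsto_intros s_lim \<rho>_lim)
    show "norm (G n) \<le> 1 / Im z" for n by (rule G_bound)
    show "\<forall>\<^sub>F n in sequentially. Im ((1 - \<rho> n * s n * z) * G n) \<le> 0"
      using eventually_ge_at_top[of 1]
    proof eventually_elim
      case (elim n)
      have "real n > 0" using elim by simp
      then have pos: "p1 n > 0" "p2 n > 0" using p1[OF elim] p2[OF elim] by linarith+
      show ?case
        unfolding G_def \<rho>_def s_def using elim by (intro resolvent_mean_right_edge pos z x)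
    qed
    show "Im ((1 - of_real (\<sigma> * sqrt \<gamma>) * z) * J.resolvent_branch v) > 0"
      by (rule J.Im_other_branch_pos[OF wv z_eq w(2)])
  qed
  then show ?thesis
    unfolding limit G_def .
qed

lemma integral_empirical_measure:
  fixes f :: "real \<Rightarrow> 'b::{banach, second_countable_topology}"
  assumes [measurable]: "f \<in> borel_measurable borel"
  shows "(\<integral>t. f t \<partial>empirical_measure n y) = (\<Sum>i<n. f (y i)) /\<^sub>R real n"
proof -
  have "(\<integral>t. f t \<partial>empirical_measure n y) = (\<integral>i. f (y i) \<partial>uniform_count_measure {..<n})"
    unfolding empirical_measure_def
  proof (rule integral_distr)
    show "y \<in> measurable (uniform_count_measure {..<n}) borel"
      by (auto simp: measurable_def sets_uniform_count_measure space_uniform_count_measure)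
  qed fact
  also have "\<dots> = (\<Sum>i<n. (1 / real n) *\<^sub>R f (y i))"
    unfolding uniform_count_measure_def by (simp add: lebesgue_integral_point_measure_finite)
  finally show ?thesis
    by (simp add: scaleR_sum_right inverse_eq_divide)
qed

lemma real_distribution_empirical_measure:
  assumes "n \<ge> 1"
  shows "real_distribution (empirical_measure n y)"
proof -
  have "prob_space (uniform_count_measure {..<n})"
    using assms by (intro prob_space_uniform_count_measure) (auto simp: lessThan_empty_iff)
  then have "prob_space (empirical_measure n y)"
    unfolding empirical_measure_def
    by (rule prob_space.prob_space_distr) (auto simp: measurable_def sets_uniform_count_measure space_uniform_count_measure)
  then show ?thesis
    by (simp add: real_distribution_def real_distribution_axioms_def empirical_measure_def)
qed

lemma poisson_integral_eq_Im_stieltjes: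
  assumes "real_distribution \<mu>" "y > 0"
  shows "poisson_integral \<mu> y q = - Im (\<integral>t. 1 / (Complex q y - of_real t) \<partial>\<mu>) / pi"
proof -
  interpret real_distribution \<mu> by fact
  have "integrable \<mu> (\<lambda>t. 1 / (Complex q y - of_real t))"
  proof (rule integrable_const_bound[where B = "1 / y"])
    show "AE t in \<mu>. norm (1 / (Complex q y - of_real t)) \<le> 1 / y"
      using norm_resolvent_le[of "Complex q y"] assms(2) by simp
  qed measurable
  then have "(\<integral>t. Im (1 / (Complex q y - of_real t)) \<partial>\<mu>) = Im (\<integral>t. 1 / (Complex q y - of_real t) \<partial>\<mu>)"
    by (rule integral_Im)
  moreover have "cauchy_kernel y (q - t) = - Im (1 / (Complex q y - of_real t)) / pi" for t
  proof -
    have "Complex q y - of_real t = Complex (q - t) y" by (simp add: complex_eq_iff)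
    then show ?thesis by (simp only: cauchy_kernel_eq_Im)
  qed
  ultimately show ?thesis
    unfolding poisson_integral_def by simp
qed

lemma stieltjes_empirical_measure:
  "(\<integral>t. 1 / (z - of_real t) \<partial>empirical_measure n y) = resolvent_mean n y z"
  by (subst integral_empirical_measure)
    (auto simp: resolvent_mean_def scaleR_conv_of_real divide_inverse mult.commute)

theorem theorem1:
  fixes M :: "'a measure"
    and \<Lambda> :: "nat \<Rightarrow> 'a \<Rightarrow> nat \<Rightarrow> real"
    and \<beta> p1 p2 :: "nat \<Rightarrow> real"
    and \<gamma> \<sigma> :: real
  assumes "prob_space M"
    and "\<And>n. n \<ge> 1 \<Longrightarrow> \<beta> n > 0"
    and "\<And>n. n \<ge> 1 \<Longrightarrow> p1 n \<ge> real n"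
    and "\<And>n. n \<ge> 1 \<Longrightarrow> p2 n \<ge> real n"
    and "\<And>n. n \<ge> 1 \<Longrightarrow> beta_jacobi_ensemble M n (\<beta> n) (p1 n) (p2 n) (\<Lambda> n)"
    and "(\<lambda>n. real n / p1 n) \<longlonglongrightarrow> \<gamma>" and "0 \<le> \<gamma>" and "\<gamma> \<le> 1"
    and "(\<lambda>n. p1 n / p2 n) \<longlonglongrightarrow> \<sigma>" and "0 \<le> \<sigma>" and "\<gamma> = 0 \<or> \<sigma> < 1 / \<gamma>"
    and "filterlim (\<lambda>n. \<beta> n * real n) at_top sequentially"
  shows "prob_space (limit_measure \<gamma> \<sigma>) \<and>
    (AE \<omega> in M. weak_conv_m
       (\<lambda>n. empirical_measure n
          (\<lambda>i. ((p1 n + p2 n) * \<Lambda> n \<omega> i - p1 n) / sqrt (real n * p1 n)))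
       (limit_measure \<gamma> \<sigma>))"
proof -
  have J: "jacobi_limit \<gamma> \<sigma>"
  proof
    show "\<sigma> * \<gamma> < 1"
      using assms(7,11) by (cases "\<gamma> = 0") (auto simp: pos_less_divide_eq)
  qed (use assms in auto)
  then interpret jacobi_limit \<gamma> \<sigma> .
  obtain R where R: "p1 n / p2 n \<le> R" for n
  proof -
    have "Bseq (\<lambda>n. p1 n / p2 n)" using assms(9) by (intro convergent_imp_Bseq convergentI)
    then obtain R where "norm (p1 n / p2 n) \<le> R" for n unfolding Bseq_def by blast
    then have "p1 n / p2 n \<le> R" for n by (metis abs_ge_self order.trans real_norm_def)
    then show ?thesis by (rule that)
  qed
  \<comment> \<open>Countably many spectral points, so that their exceptional events can be discarded together.\<close>
  define D where "D = (\<lambda>(k, q). Complex q (1 / real (Suc k))) ` (UNIV \<times> (\<rat> :: real set))"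
  have D: "countable D" "\<And>z. z \<in> D \<Longrightarrow> Im z > 0"
    unfolding D_def by (auto intro: countable_rat)
  let ?L = "\<lambda>\<omega> z n. loop_sum n (p1 n) (p2 n) (spectral_point n (p1 n) (p2 n) z) (\<Lambda> n \<omega>) / of_real (real n * p2 n)"
  have cube: "AE \<omega> in M. \<forall>n. n \<ge> 1 \<longrightarrow> (\<forall>i<n. \<Lambda> n \<omega> i \<in> {0..1})"
    unfolding AE_all_countable
  proof
    fix n
    show "AE \<omega> in M. n \<ge> 1 \<longrightarrow> (\<forall>i<n. \<Lambda> n \<omega> i \<in> {0..1})"
      using beta_jacobi_AE_unit_cube[OF assms(5)[of n]] by (cases "n \<ge> 1") auto
  qed
  have loop: "AE \<omega> in M. \<forall>z\<in>D. ?L \<omega> z \<longlonglongrightarrow> 0"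
    unfolding AE_ball_countable[OF D(1)]
  proof
    fix z assume "z \<in> D"
    then show "AE \<omega> in M. ?L \<omega> z \<longlonglongrightarrow> 0"
      by (intro beta_jacobi_loop_AE_tendsto_0[OF assms(1-5) R assms(12) D(2)])
  qed
  have "AE \<omega> in M. weak_conv_m
       (\<lambda>n. empirical_measure n (rescaled n (p1 n) (p2 n) (\<Lambda> n \<omega>))) (limit_measure \<gamma> \<sigma>)"
    using cube loop
  proof eventually_elim
    case (elim \<omega>)
    let ?\<mu> = "\<lambda>n. empirical_measure n (rescaled n (p1 n) (p2 n) (\<Lambda> n \<omega>))"
    \<comment> \<open>The index is shifted because the empirical measure of no points is not a probability measure.\<close>
    have "weak_conv_m (\<lambda>n. ?\<mu> (Suc n)) (limit_measure \<gamma> \<sigma>)"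
    proof (rule weak_conv_m_if_poisson_integrals_converge)
      show \<mu>: "real_distribution (?\<mu> (Suc n))" for n
        by (rule real_distribution_empirical_measure) simp
      show \<nu>: "real_distribution (limit_measure \<gamma> \<sigma>)"
        by (rule real_distribution_limit_measure)
      fix k and q :: real
      have y: "1 / real (Suc k) > 0" by simp
      assume "q \<in> \<rat>"
      define z where "z = Complex q (1 / real (Suc k))"
      have "z \<in> D" using \<open>q \<in> \<rat>\<close> by (auto simp: D_def z_def)
      then have "(\<lambda>n. resolvent_mean n (rescaled n (p1 n) (p2 n) (\<Lambda> n \<omega>)) z)
          \<longlonglongrightarrow> (\<integral>t. 1 / (z - of_real t) \<partial>limit_measure \<gamma> \<sigma>)"
        using elim D(2) by (intro resolvent_mean_tendsto[OF J assms(3,4,6,9)]) auto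
      then have "(\<lambda>n. - Im (resolvent_mean (Suc n) (rescaled (Suc n) (p1 (Suc n)) (p2 (Suc n)) (\<Lambda> (Suc n) \<omega>)) z) / pi)
          \<longlonglongrightarrow> - Im (\<integral>t. 1 / (z - of_real t) \<partial>limit_measure \<gamma> \<sigma>) / pi"
        by (intro tendsto_intros LIMSEQ_Suc[of "\<lambda>n. resolvent_mean n (rescaled n (p1 n) (p2 n) (\<Lambda> n \<omega>)) z"]) auto
      then show "(\<lambda>n. poisson_integral (?\<mu> (Suc n)) (1 / real (Suc k)) q)
          \<longlonglongrightarrow> poisson_integral (limit_measure \<gamma> \<sigma>) (1 / real (Suc k)) q"
        unfolding poisson_integral_eq_Im_stieltjes[OF \<mu> y] poisson_integral_eq_Im_stieltjes[OF \<nu> y]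
          stieltjes_empirical_measure z_def .
    qed
    then show ?case
      unfolding weak_conv_m_def weak_conv_def by (blast intro: LIMSEQ_imp_Suc)
  qed
  moreover have "prob_space (limit_measure \<gamma> \<sigma>)"
    using real_distribution_limit_measure by (simp add: real_distribution_def)
  ultimately show ?thesis
    unfolding rescaled_def by (simp add: rescaled_def[abs_def])
qed

end
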